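(* Let $\boldsymbol a=(a_1,a_2,a_3)\in\mathbb{C}^3$ with $\delta_{\boldsymbol a}=\mathrm{disc}_t(t^3+a_1t^2+a_2t+a_3)\neq 0$, let $\mathcal{E}=\{\eta^2=\zeta^3+a_1\zeta^2+a_2\zeta+a_3\}$ be the corresponding elliptic curve (with its point at infinity $\infty$ as neutral element of the group of points) and let $\sigma:(\zeta,\eta)\mapsto(\zeta,-\eta)$, $\infty\mapsto\infty$. (i) The polynomials $D_{\boldsymbol a}$ and $B_{\boldsymbol a}$ define isomorphic algebraic two-valued groups $\mathbb{G}_{\mathbb{C}P^1}(D_{\boldsymbol a})\cong\mathbb{G}_{\mathbb{C}P^1}(B_{\boldsymbol a})$ on $\mathbb{C}P^1$. The group $\mathbb{G}_{\mathbb{C}P^1}(D_{\boldsymbol a})$ has neutral element $\infty$ and is an involutive regular coset two-valued group, namely the coset group $\mathcal{E}_{\langle\sigma\rangle}$ of the group of points of $\mathcal{E}$ with respect to $\sigma$. In homogeneous coordinates, the group $\mathbb{G}_{\mathbb{C}P^1}(B_{\boldsymbol a})$ has neutral element $(0:1)$ and multiplication $\mathbb{C}P^1\times\mathbb{C}P^1\to\mathrm{Sym}^2(\mathbb{C}P^1)\cong\mathbb{C}P^2$, $(x_1:x_0)\ast(y_1:y_0)=(u_2:u_1:u_0)$, where $$u_2=(x_1y_0-x_0y_1)^2,$$ $$-\tfrac12u_1=x_1x_0(2a_1y_1y_0+a_2y_1^2+y_0^2)+x_1^2y_1(a_2y_0+2a_3y_1)+x_0^2y_0y_1,$$ $$u_0=x_1^2y_1\bigl(a_2^2y_1-4a_3(a_1y_1+y_0)\bigr)-2x_0x_1y_1(a_2y_0+2a_3y_1)+x_0^2y_0^2.$$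 (ii) The coset-isomorphism class of the coset algebraic two-valued group $\mathbb{G}_{\mathbb{C}P^1}(B_{\boldsymbol a})$ is completely characterized by the $j$-invariant of $\mathcal{E}$, $$j(\boldsymbol a)=6912\,\frac{(3a_2-a_1^2)^3}{4(3a_2-a_1^2)^3+(27a_3-9a_1a_2+2a_1^3)^2};$$ that is, for $\boldsymbol a,\boldsymbol a'$ with $\delta_{\boldsymbol a}\ne0\ne\delta_{\boldsymbol a'}$, the groups $\mathbb{G}_{\mathbb{C}P^1}(B_{\boldsymbol a})$ and $\mathbb{G}_{\mathbb{C}P^1}(B_{\boldsymbol a'})$ are coset-isomorphic if and only if $j(\boldsymbol a)=j(\boldsymbol a')$.
   Context: $\mathbb{C}P^1=\mathbb{C}\cup\{\infty\}$, with $x=x_1/x_0$ for $(x_1:x_0)$ and $\infty=(1:0)$. $\mathrm{Sym}^n(X)=X^n/\Sigma_n$; its elements are multisets $[z_1,\dots,z_n]$. A point $(u_2:u_1:u_0)\in\mathbb{C}P^2$ is identified with the multiset of two zeros $(z_1:z_0)\in\mathbb{C}P^1$ of the form $u_0z_1^2+u_1z_1z_0+u_2z_0^2$. An algebraic $n$-valued monoid is an algebraic variety $X$ with a rational morphism $\ast:X\times X\to\mathrm{Sym}^n(X)$ which is associative (the $n^2$-multisets $[x\ast w\mid w\in y\ast z]$ and $[w\ast z\mid w\in x\ast y]$ coincide) and has a neutral element $e$: $x\ast e$ and $e\ast x$ are defined and equal $[x,\dots,x]$ for every $x\in X$. An algebraic $n$-valued group is such a monoid with a rational morphism $\mathrm{inv}:X\to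 X$ such that, whenever $\mathrm{inv}(x)$ exists, $x\ast\mathrm{inv}(x)$ and $\mathrm{inv}(x)\ast x$ exist and contain $e$. It is regular if $\ast$ is defined on all of $X\times X$ and $\mathrm{inv}$ on all of $X$. It is involutive if $\mathrm{inv}$ is uniquely determined and $\mathrm{inv}(x)=x$ for all $x$. Two algebraic $n$-valued groups are isomorphic if there is an isomorphism of varieties carrying one multiplication to the other. The multiplication on $\mathbb{C}P^1$ defined by a polynomial $P(z;x,y)$ of degree at most $n$ in each variable: $(x_1:x_0)\ast(y_1:y_0)$ is the multiset of $n$ zeros (with multiplicity) in $(z_1:z_0)$ of the form $(x_0y_0z_0)^nP(z_1/z_0;x_1/x_0,y_1/y_0)$. Here $n=2$ and $$B_{\boldsymbol a}(z;x,y)=(x+y+z-a_2xyz)^2-4(1+a_3xyz)(xy+yz+xz+a_1xyz),$$ $$D_{\boldsymbol a}(z;x,y)=\mathrm{disc}_t\bigl(t^3+a_1t^2+a_2t+a_3-(t-x)(t-y)(t-z)\bigr)$$ (discriminant of a polynomial of formal degree 2 in $t$), and $\mathbb{G}_{\mathbb{C}P^1}(B_{\boldsymbol a})$, $\mathbb{G}_{\mathbb{C}P^1}(D_{\boldsymbol a})$ denote $\mathbb{C}P^1$ with the multiplications defined by these polynomials. They satisfy $(xyz)^2B_{\boldsymbol a}(1/z;1/x,1/y)=D_{\boldsymbol a}(z;x,y)$. Coset construction: for a (1-valued) group or monoid $M$ and a subgroup $H\subset\mathrm{Aut}(M)$ of order $n$, with projection $\pi:M\to M/H$, the coset $n$-valued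 group (monoid) $M_H$ is $M/H$ with $\pi(u)\ast\pi(v)=[\pi(u\cdot h(v))\mid h\in H]$ and neutral element $\pi(e)$ (and $\mathrm{inv}(\pi(u))=\pi(u^{-1})$ for groups). For $\mathcal{E}_{\langle\sigma\rangle}$, the orbit space is identified with $\mathbb{C}P^1$ by $(\zeta,\eta)\mapsto\zeta$, $\infty\mapsto\infty$; $\mathbb{G}_{\mathbb{C}P^1}(B_{\boldsymbol a})$ is regarded as a coset group of $(\mathcal{E},\langle\sigma\rangle)$ through the further map $x\mapsto1/x$. Coset monoids (groups) $M_A$ and $N_B$ (with $A\subset\mathrm{Aut}(M)$, $B\subset\mathrm{Aut}(N)$ of order $n$) are coset-isomorphic if there exist isomorphisms $\widetilde\varphi:M\to N$ (of algebraic monoids/groups) and $\varphi:M/A\to N/B$ compatible with the projections $M\to M/A$, $N\to N/B$, with the maps $M\times M\to\mathrm{Sym}^n(M)$, $(m_1,m_2)\mapsto[m_1\cdot a(m_2)\mid a\in A]$ (and likewise for $N$), and with the $n$-valued multiplications on $M/A$, $N/B$. *)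

theory Defs
  imports
    "HOL-Analysis.Analysis"
    "HOL-Computational_Algebra.Fundamental_Theorem_Algebra"
    "HOL-Algebra.Bij"
    "HOL-Algebra.Generated_Groups"
begin

section \<open>Complex projective space\<close>

definition proj_rel :: "complex ^ 'k \<Rightarrow> complex ^ 'k \<Rightarrow> bool" where
  "proj_rel v w \<longleftrightarrow> v \<noteq> 0 \<and> w \<noteq> 0 \<and> (\<exists>c. c \<noteq> 0 \<and> w = c *s v)"

lemma part_equivp_proj_rel: "part_equivp (proj_rel :: complex ^ 'k \<Rightarrow> complex ^ 'k \<Rightarrow> bool)"
proof (rule part_equivpI)
  have "proj_rel (axis undefined 1 :: complex ^ 'k) (axis undefined 1)"
    unfolding proj_rel_def by (auto simp: axis_eq_0_iff intro!: exI[of _ 1])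
  then show "\<exists>v :: complex ^ 'k. proj_rel v v" by blast
  show "symp (proj_rel :: complex ^ 'k \<Rightarrow> _)"
  proof (rule sympI)
    fix v w :: "complex ^ 'k"
    assume "proj_rel v w"
    then obtain c where "v \<noteq> 0" "w \<noteq> 0" "c \<noteq> 0" "w = c *s v" unfolding proj_rel_def by blast
    then have "v = inverse c *s w" by (simp add: vector_smult_assoc)
    with \<open>v \<noteq> 0\<close> \<open>w \<noteq> 0\<close> \<open>c \<noteq> 0\<close> show "proj_rel w v"
      unfolding proj_rel_def by (metis nonzero_imp_inverse_nonzero)
  qed
  show "transp (proj_rel :: complex ^ 'k \<Rightarrow> _)"
  proof (rule transpI)
    fix u v w :: "complex ^ 'k"
    assume "proj_rel u v" "proj_rel v w"
    then show "proj_rel u w"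
      unfolding proj_rel_def by (metis mult_eq_0_iff vector_smult_assoc)
  qed
qed

text \<open>\<^term>\<open>abs_proj v\<close> is the point with homogeneous coordinates \<^term>\<open>v\<close>; it is
  meaningful only for \<^prop>\<open>v \<noteq> 0\<close>. \<^term>\<open>rep_proj p\<close> is some vector of homogeneous
  coordinates of \<^term>\<open>p\<close>.\<close>

quotient_type 'k proj = "complex ^ ('k :: finite)" / partial: proj_rel
  by (rule part_equivp_proj_rel)

text \<open>The point \<open>(x\<^sub>1 : x\<^sub>0)\<close> of the line and the point \<open>(x : y : z)\<close> of the plane.\<close>

definition cp1 :: "complex \<Rightarrow> complex \<Rightarrow> 2 proj" where
  "cp1 x1 x0 = abs_proj (vector [x1, x0])"

definition cp2 :: "complex \<Rightarrow> complex \<Rightarrow> complex \<Rightarrow> 3 proj" where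
  "cp2 x y z = abs_proj (vector [x, y, z])"

definition infty :: "2 proj" where
  "infty = cp1 1 0"

definition recip :: "2 proj \<Rightarrow> 2 proj" where
  "recip p = cp1 (rep_proj p $ 2) (rep_proj p $ 1)"


section \<open>Quasi-projective varieties and their maps\<close>

inductive_set poly_funs :: "('v \<Rightarrow> complex) set \<Rightarrow> ('v \<Rightarrow> complex) set"
  for C :: "('v \<Rightarrow> complex) set" where
  const: "(\<lambda>_. c) \<in> poly_funs C"
| coord: "f \<in> C \<Longrightarrow> f \<in> poly_funs C"
| add: "f \<in> poly_funs C \<Longrightarrow> g \<in> poly_funs C \<Longrightarrow> (\<lambda>v. f v + g v) \<in> poly_funs C"
| mult: "f \<in> poly_funs C \<Longrightarrow> g \<in> poly_funs C \<Longrightarrow> (\<lambda>v. f v * g v) \<in> poly_funs C"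

definition homogeneous :: "nat \<Rightarrow> (complex ^ 'k \<Rightarrow> complex) \<Rightarrow> bool" where
  "homogeneous d f \<longleftrightarrow> f \<in> poly_funs (range (\<lambda>i v. v $ i)) \<and> (\<forall>c v. f (c *s v) = c ^ d * f v)"

definition zariski_closed :: "('k :: finite) proj set \<Rightarrow> bool" where
  "zariski_closed Z \<longleftrightarrow>
     (\<exists>S. (\<forall>f\<in>S. \<exists>d. homogeneous d f) \<and> Z = {p. \<forall>f\<in>S. f (rep_proj p) = 0})"

definition quasi_projective :: "('k :: finite) proj set \<Rightarrow> bool" where
  "quasi_projective X \<longleftrightarrow> (\<exists>Z W. zariski_closed Z \<and> zariski_closed W \<and> X = Z - W)"

definition dense_open_in :: "('k :: finite) proj set \<Rightarrow> 'k proj set \<Rightarrow> bool" where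
  "dense_open_in X U \<longleftrightarrow>
     (\<exists>Z. zariski_closed Z \<and> U = X - Z) \<and> (\<forall>Z. zariski_closed Z \<and> U \<subseteq> Z \<longrightarrow> X \<subseteq> Z)"

definition regular_map ::
  "('k :: finite) proj set \<Rightarrow> ('m :: finite) proj set \<Rightarrow> ('k proj \<Rightarrow> 'm proj) \<Rightarrow> bool" where
  "regular_map X Y f \<longleftrightarrow> f ` X \<subseteq> Y \<and>
     (\<forall>p\<in>X. \<exists>Z d (G :: complex ^ 'k \<Rightarrow> complex ^ 'm).
        zariski_closed Z \<and> p \<notin> Z \<and> (\<forall>j. homogeneous d (\<lambda>v. G v $ j)) \<and>
        (\<forall>v. v \<noteq> 0 \<and> abs_proj v \<in> X - Z \<longrightarrow> G v \<noteq> 0 \<and> f (abs_proj v) = abs_proj (G v)))"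

definition rational_map ::
  "('k :: finite) proj set \<Rightarrow> ('m :: finite) proj set \<Rightarrow> ('k proj \<Rightarrow> 'm proj option) \<Rightarrow> bool" where
  "rational_map X Y f \<longleftrightarrow>
     dense_open_in X {p\<in>X. f p \<noteq> None} \<and> regular_map {p\<in>X. f p \<noteq> None} Y (\<lambda>p. the (f p))"

definition variety_iso ::
  "('k :: finite) proj set \<Rightarrow> ('m :: finite) proj set \<Rightarrow> ('k proj \<Rightarrow> 'm proj) \<Rightarrow> bool" where
  "variety_iso X Y f \<longleftrightarrow> regular_map X Y f \<and>
     (\<exists>g. regular_map Y X g \<and> (\<forall>x\<in>X. g (f x) = x) \<and> (\<forall>y\<in>Y. f (g y) = y))"

text \<open>Products of varieties are formed by the Segre embedding.\<close>

definition segre :: "('k :: finite) proj \<Rightarrow> ('m :: finite) proj \<Rightarrow> ('k \<times> 'm) proj" where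
  "segre p q = abs_proj (\<chi> ij. rep_proj p $ fst ij * rep_proj q $ snd ij)"

definition variety_prod ::
  "('k :: finite) proj set \<Rightarrow> ('m :: finite) proj set \<Rightarrow> ('k \<times> 'm) proj set" where
  "variety_prod X Y = {segre x y | x y. x \<in> X \<and> y \<in> Y}"

text \<open>\<open>Sym\<^sup>n\<close> of a quasi-projective variety is embedded into the projective space of forms of
  degree \<open>n\<close> by sending a multiset of points to its Chow form, the product of the
  linear forms defined by the points. Over the complex numbers this gives the variety
  structure of the quotient by the symmetric group. For the line and
  \<open>n = 2\<close> the substitution \<open>t = (z\<^sub>0, -z\<^sub>1)\<close> turns the Chow form of a multiset into the
  binary quadratic form in \<open>z\<close> with these zeros, so the coordinates are those of
  \<open>zeros_of_cp2\<close> below up to signs. The Chow form depends on the chosen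
  representatives only by a nonzero factor, which is absorbed by \<open>\<kappa>\<close>.\<close>

definition chow_form :: "('k :: finite) proj multiset \<Rightarrow> complex ^ 'k \<Rightarrow> complex" where
  "chow_form M t = (\<Prod>p\<in>#M. \<Sum>i\<in>UNIV. rep_proj p $ i * t $ i)"

definition regular_map_sym ::
  "nat \<Rightarrow> ('k :: finite) proj set \<Rightarrow> ('m :: finite) proj set \<Rightarrow>
     ('k proj \<Rightarrow> 'm proj multiset) \<Rightarrow> bool" where
  "regular_map_sym n X Y F \<longleftrightarrow>
     (\<forall>p\<in>X. size (F p) = n \<and> set_mset (F p) \<subseteq> Y) \<and>
     (\<forall>p\<in>X. \<exists>Z d (c :: (complex ^ 'k) \<times> (complex ^ 'm) \<Rightarrow> complex).
        zariski_closed Z \<and> p \<notin> Z \<and>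
        c \<in> poly_funs (range (\<lambda>i (v, t). v $ i) \<union> range (\<lambda>j (v, t). t $ j)) \<and>
        (\<forall>s v t. c (s *s v, t) = s ^ d * c (v, t)) \<and>
        (\<forall>v. v \<noteq> 0 \<and> abs_proj v \<in> X - Z \<longrightarrow>
           (\<exists>\<kappa>. \<kappa> \<noteq> 0 \<and> (\<forall>t. c (v, t) = \<kappa> * chow_form (F (abs_proj v)) t))))"

definition rational_map_sym ::
  "nat \<Rightarrow> ('k :: finite) proj set \<Rightarrow> ('m :: finite) proj set \<Rightarrow>
     ('k proj \<Rightarrow> 'm proj multiset option) \<Rightarrow> bool" where
  "rational_map_sym n X Y F \<longleftrightarrow>
     dense_open_in X {p\<in>X. F p \<noteq> None} \<and>
     regular_map_sym n {p\<in>X. F p \<noteq> None} Y (\<lambda>p. the (F p))"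


section \<open>Algebraic n-valued monoids and groups\<close>

text \<open>Rational maps are represented by partial functions; \<^term>\<open>None\<close> means undefined.\<close>

definition nv_assoc :: "'a set \<Rightarrow> ('a \<Rightarrow> 'a \<Rightarrow> 'a multiset option) \<Rightarrow> bool" where
  "nv_assoc X \<mu> \<longleftrightarrow>
     (\<forall>x\<in>X. \<forall>y\<in>X. \<forall>z\<in>X. \<forall>L R.
        \<mu> y z = Some R \<and> (\<forall>w\<in>#R. \<mu> x w \<noteq> None) \<and>
        \<mu> x y = Some L \<and> (\<forall>w\<in>#L. \<mu> w z \<noteq> None) \<longrightarrow>
        (\<Sum>w\<in>#R. the (\<mu> x w)) = (\<Sum>w\<in>#L. the (\<mu> w z)))"

definition algebraic_nv_monoid ::
  "nat \<Rightarrow> ('k :: finite) proj set \<Rightarrow> ('k proj \<Rightarrow> 'k proj \<Rightarrow> 'k proj multiset option) \<Rightarrow>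
     'k proj \<Rightarrow> bool" where
  "algebraic_nv_monoid n X \<mu> e \<longleftrightarrow>
     quasi_projective X \<and>
     (\<exists>F. rational_map_sym n (variety_prod X X) X F \<and> (\<forall>x\<in>X. \<forall>y\<in>X. F (segre x y) = \<mu> x y)) \<and>
     nv_assoc X \<mu> \<and>
     e \<in> X \<and> (\<forall>x\<in>X. \<mu> x e = Some (replicate_mset n x) \<and> \<mu> e x = Some (replicate_mset n x))"

definition algebraic_nv_group ::
  "nat \<Rightarrow> ('k :: finite) proj set \<Rightarrow> ('k proj \<Rightarrow> 'k proj \<Rightarrow> 'k proj multiset option) \<Rightarrow>
     'k proj \<Rightarrow> ('k proj \<Rightarrow> 'k proj option) \<Rightarrow> bool" where
  "algebraic_nv_group n X \<mu> e \<iota> \<longleftrightarrow>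
     algebraic_nv_monoid n X \<mu> e \<and> rational_map X X \<iota> \<and>
     (\<forall>x\<in>X. \<forall>y. \<iota> x = Some y \<longrightarrow>
        (\<exists>L R. \<mu> x y = Some L \<and> e \<in># L \<and> \<mu> y x = Some R \<and> e \<in># R))"

definition nv_regular ::
  "'a set \<Rightarrow> ('a \<Rightarrow> 'a \<Rightarrow> 'a multiset option) \<Rightarrow> ('a \<Rightarrow> 'a option) \<Rightarrow> bool" where
  "nv_regular X \<mu> \<iota> \<longleftrightarrow> (\<forall>x\<in>X. \<forall>y\<in>X. \<mu> x y \<noteq> None) \<and> (\<forall>x\<in>X. \<iota> x \<noteq> None)"

text \<open>Uniqueness of the inverse is uniqueness as a rational map, i.e. any two
  choices agree wherever both are defined.\<close>

definition nv_involutive ::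
  "nat \<Rightarrow> ('k :: finite) proj set \<Rightarrow> ('k proj \<Rightarrow> 'k proj \<Rightarrow> 'k proj multiset option) \<Rightarrow>
     'k proj \<Rightarrow> ('k proj \<Rightarrow> 'k proj option) \<Rightarrow> bool" where
  "nv_involutive n X \<mu> e \<iota> \<longleftrightarrow>
     (\<forall>x\<in>X. \<iota> x = Some x) \<and>
     (\<forall>\<iota>'. algebraic_nv_group n X \<mu> e \<iota>' \<longrightarrow> (\<forall>x\<in>X. \<iota>' x \<noteq> None \<longrightarrow> \<iota>' x = \<iota> x))"

definition nv_isomorphic ::
  "('k :: finite) proj set \<Rightarrow> ('k proj \<Rightarrow> 'k proj \<Rightarrow> 'k proj multiset option) \<Rightarrow>
   ('m :: finite) proj set \<Rightarrow> ('m proj \<Rightarrow> 'm proj \<Rightarrow> 'm proj multiset option) \<Rightarrow> bool" where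
  "nv_isomorphic X \<mu> Y \<nu> \<longleftrightarrow>
     (\<exists>f. variety_iso X Y f \<and>
       (\<forall>x\<in>X. \<forall>y\<in>X. map_option (image_mset f) (\<mu> x y) = \<nu> (f x) (f y)))"


section \<open>Coset groups\<close>

definition algebraic_group :: "('k :: finite) proj monoid \<Rightarrow> bool" where
  "algebraic_group G \<longleftrightarrow>
     group G \<and> quasi_projective (carrier G) \<and>
     (\<exists>m. regular_map (variety_prod (carrier G) (carrier G)) (carrier G) m \<and>
       (\<forall>x\<in>carrier G. \<forall>y\<in>carrier G. m (segre x y) = x \<otimes>\<^bsub>G\<^esub> y)) \<and>
     regular_map (carrier G) (carrier G) (\<lambda>x. inv\<^bsub>G\<^esub> x)"

text \<open>A group together with a finite group of automorphisms, a variety playing the role of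
  the orbit space by means of a projection, and the multivalued multiplication on it.\<close>

record ('k, 'm) coset_data =
  cover :: "('k :: finite) proj monoid"
  autos :: "('k proj \<Rightarrow> 'k proj) set"
  orbits :: "('m :: finite) proj set"
  orbit_map :: "'k proj \<Rightarrow> 'm proj"
  orbit_mult :: "'m proj \<Rightarrow> 'm proj \<Rightarrow> 'm proj multiset option"

definition coset_nv_group ::
  "nat \<Rightarrow> ('k :: finite, 'm :: finite) coset_data \<Rightarrow> 'm proj \<Rightarrow> ('m proj \<Rightarrow> 'm proj option) \<Rightarrow> bool"
  where
  "coset_nv_group n C e \<iota> \<longleftrightarrow>
     (let M = cover C; H = autos C; \<pi> = orbit_map C in
       algebraic_group M \<and>
       subgroup H (AutoGroup M) \<and> finite H \<and> card H = n \<and>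
       (\<forall>h\<in>H. regular_map (carrier M) (carrier M) h) \<and>
       regular_map (carrier M) (orbits C) \<pi> \<and> \<pi> ` carrier M = orbits C \<and>
       (\<forall>u\<in>carrier M. \<forall>v\<in>carrier M. \<pi> u = \<pi> v \<longleftrightarrow> (\<exists>h\<in>H. v = h u)) \<and>
       (\<forall>u\<in>carrier M. \<forall>v\<in>carrier M.
          orbit_mult C (\<pi> u) (\<pi> v) = Some {# \<pi> (u \<otimes>\<^bsub>M\<^esub> h v). h \<in># mset_set H #}) \<and>
       e = \<pi> \<one>\<^bsub>M\<^esub> \<and>
       (\<forall>u\<in>carrier M. \<iota> (\<pi> u) = Some (\<pi> (inv\<^bsub>M\<^esub> u))))"

definition coset_isomorphic ::
  "('k :: finite, 'm :: finite) coset_data \<Rightarrow> ('l :: finite, 'p :: finite) coset_data \<Rightarrow> bool"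
  where
  "coset_isomorphic C D \<longleftrightarrow>
     (\<exists>\<phi>' \<phi>.
       \<phi>' \<in> iso (cover C) (cover D) \<and>
       variety_iso (carrier (cover C)) (carrier (cover D)) \<phi>' \<and>
       variety_iso (orbits C) (orbits D) \<phi> \<and>
       (\<forall>m\<in>carrier (cover C). \<phi> (orbit_map C m) = orbit_map D (\<phi>' m)) \<and>
       (\<forall>m1\<in>carrier (cover C). \<forall>m2\<in>carrier (cover C).
          image_mset \<phi>' {# m1 \<otimes>\<^bsub>cover C\<^esub> h m2. h \<in># mset_set (autos C) #} =
          {# \<phi>' m1 \<otimes>\<^bsub>cover D\<^esub> h (\<phi>' m2). h \<in># mset_set (autos D) #}) \<and>
       (\<forall>x\<in>orbits C. \<forall>y\<in>orbits C.
          map_option (image_mset \<phi>) (orbit_mult C x y) = orbit_mult D (\<phi> x) (\<phi> y)))"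


section \<open>Multiplications on the line defined by polynomials\<close>

text \<open>Zeros in \<open>(z\<^sub>1 : z\<^sub>0)\<close> of the nonzero binary form \<open>z\<^sub>0\<^sup>n q(z\<^sub>1 / z\<^sub>0)\<close>, where \<open>q\<close> has
  degree at most \<open>n\<close>.\<close>

definition binary_form_zeros :: "nat \<Rightarrow> complex poly \<Rightarrow> 2 proj multiset" where
  "binary_form_zeros n q =
     image_mset (\<lambda>z. cp1 z 1) (proots q) + replicate_mset (n - degree q) infty"

text \<open>The identification of the plane with \<open>Sym\<^sup>2\<close> of the line: \<open>(u\<^sub>2 : u\<^sub>1 : u\<^sub>0)\<close> goes to
  the zeros of \<open>u\<^sub>0 z\<^sub>1\<^sup>2 + u\<^sub>1 z\<^sub>1 z\<^sub>0 + u\<^sub>2 z\<^sub>0\<^sup>2\<close>.\<close>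

definition zeros_of_cp2 :: "3 proj \<Rightarrow> 2 proj multiset" where
  "zeros_of_cp2 u = (let r = rep_proj u in binary_form_zeros 2 [: r $ 1, r $ 2, r $ 3 :])"

text \<open>A polynomial \<open>P(z; x, y)\<close> is an element of \<open>\<complex>[y][x][z]\<close>: the outermost variable is \<open>z\<close>,
  the innermost one \<open>y\<close>. \<open>form_at n P (x\<^sub>1,x\<^sub>0) (y\<^sub>1,y\<^sub>0)\<close> is
  \<open>(x\<^sub>0 y\<^sub>0 z\<^sub>0)\<^sup>n P(z\<^sub>1/z\<^sub>0; x\<^sub>1/x\<^sub>0, y\<^sub>1/y\<^sub>0)\<close> at \<open>z\<^sub>0 = 1\<close>, as a polynomial in \<open>z\<^sub>1\<close>, for \<open>P\<close> of
  degree at most \<open>n\<close> in each variable.\<close>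

definition form_at ::
  "nat \<Rightarrow> complex poly poly poly \<Rightarrow> complex ^ 2 \<Rightarrow> complex ^ 2 \<Rightarrow> complex poly" where
  "form_at n P x y =
     (\<Sum>i\<le>n. Polynomial.monom
        (\<Sum>j\<le>n. \<Sum>k\<le>n. poly.coeff (poly.coeff (poly.coeff P i) j) k *
           x $ 1 ^ j * x $ 2 ^ (n - j) * y $ 1 ^ k * y $ 2 ^ (n - k)) i)"

definition mult_by ::
  "nat \<Rightarrow> complex poly poly poly \<Rightarrow> 2 proj \<Rightarrow> 2 proj \<Rightarrow> 2 proj multiset option" where
  "mult_by n P x y =
     (let q = form_at n P (rep_proj x) (rep_proj y)
      in if q = 0 then None else Some (binary_form_zeros n q))"

definition const3 :: "complex \<Rightarrow> complex poly poly poly" where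
  "const3 c = [:[:[:c:]:]:]"

definition varZ :: "complex poly poly poly" where "varZ = [:0, 1:]"
definition varX :: "complex poly poly poly" where "varX = [:[:0, 1:]:]"
definition varY :: "complex poly poly poly" where "varY = [:[:[:0, 1:]:]:]"

definition polyB :: "complex ^ 3 \<Rightarrow> complex poly poly poly" where
  "polyB a =
     (let x = varX; y = varY; z = varZ; a1 = const3 (a $ 1); a2 = const3 (a $ 2); a3 = const3 (a $ 3)
      in (x + y + z - a2 * x * y * z)^2
         - 4 * (1 + a3 * x * y * z) * (x * y + y * z + x * z + a1 * x * y * z))"

text \<open>Discriminants of polynomials of formal degree 2 and 3.\<close>

definition disc2 :: "'a :: comm_ring_1 poly \<Rightarrow> 'a" where
  "disc2 p = (let a = poly.coeff p 2; b = poly.coeff p 1; c = poly.coeff p 0 in b^2 - 4 * a * c)"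

definition disc3 :: "'a :: comm_ring_1 poly \<Rightarrow> 'a" where
  "disc3 p =
     (let a = poly.coeff p 3; b = poly.coeff p 2; c = poly.coeff p 1; d = poly.coeff p 0
      in b^2 * c^2 - 4 * a * c^3 - 4 * b^3 * d - 27 * a^2 * d^2 + 18 * a * b * c * d)"

definition polyD :: "complex ^ 3 \<Rightarrow> complex poly poly poly" where
  "polyD a =
     disc2 ([: const3 (a $ 3), const3 (a $ 2), const3 (a $ 1), 1 :]
            - [: - varX, 1 :] * [: - varY, 1 :] * [: - varZ, 1 :])"

definition delta :: "complex ^ 3 \<Rightarrow> complex" where
  "delta a = disc3 [: a $ 3, a $ 2, a $ 1, 1 :]"

definition j_invariant :: "complex ^ 3 \<Rightarrow> complex" where
  "j_invariant a =
     6912 * (3 * a $ 2 - (a $ 1)^2)^3 /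
       (4 * (3 * a $ 2 - (a $ 1)^2)^3 + (27 * a $ 3 - 9 * a $ 1 * a $ 2 + 2 * (a $ 1)^3)^2)"


section \<open>The elliptic curve\<close>

definition curve_infty :: "3 proj" where
  "curve_infty = cp2 0 1 0"

definition zeta :: "3 proj \<Rightarrow> complex" where
  "zeta p = rep_proj p $ 1 / rep_proj p $ 3"

definition eta :: "3 proj \<Rightarrow> complex" where
  "eta p = rep_proj p $ 2 / rep_proj p $ 3"

definition curve_points :: "complex ^ 3 \<Rightarrow> 3 proj set" where
  "curve_points a =
     insert curve_infty {cp2 \<zeta> \<eta> 1 | \<zeta> \<eta>. \<eta>^2 = \<zeta>^3 + a $ 1 * \<zeta>^2 + a $ 2 * \<zeta> + a $ 3}"

text \<open>The chord-tangent law: \<open>l\<close> is the slope of the chord or tangent.\<close>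

definition curve_add :: "complex ^ 3 \<Rightarrow> 3 proj \<Rightarrow> 3 proj \<Rightarrow> 3 proj" where
  "curve_add a p q =
     (if p = curve_infty then q
      else if q = curve_infty then p
      else if zeta p = zeta q \<and> eta p = - eta q then curve_infty
      else
        let l = (if zeta p = zeta q
                 then (3 * (zeta p)^2 + 2 * a $ 1 * zeta p + a $ 2) / (2 * eta p)
                 else (eta q - eta p) / (zeta q - zeta p));
            x = l^2 - a $ 1 - zeta p - zeta q
        in cp2 x (l * (zeta p - x) - eta p) 1)"

definition curve_group :: "complex ^ 3 \<Rightarrow> 3 proj monoid" where
  "curve_group a = \<lparr>carrier = curve_points a, monoid.mult = curve_add a, one = curve_infty\<rparr>"

text \<open>Automorphisms in the sense of \<^const>\<open>AutoGroup\<close> are extensional functions on the carrier.\<close>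

definition sigma :: "complex ^ 3 \<Rightarrow> 3 proj \<Rightarrow> 3 proj" where
  "sigma a = (\<lambda>p\<in>curve_points a. if p = curve_infty then curve_infty else cp2 (zeta p) (- eta p) 1)"

definition zeta_map :: "3 proj \<Rightarrow> 2 proj" where
  "zeta_map p = (if p = curve_infty then infty else cp1 (zeta p) 1)"

definition coset_D :: "complex ^ 3 \<Rightarrow> (3, 2) coset_data" where
  "coset_D a =
     \<lparr>cover = curve_group a, autos = generate (AutoGroup (curve_group a)) {sigma a},
      orbits = UNIV, orbit_map = zeta_map, orbit_mult = mult_by 2 (polyD a)\<rparr>"

definition coset_B :: "complex ^ 3 \<Rightarrow> (3, 2) coset_data" where
  "coset_B a =
     \<lparr>cover = curve_group a, autos = generate (AutoGroup (curve_group a)) {sigma a},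
      orbits = UNIV, orbit_map = recip \<circ> zeta_map, orbit_mult = mult_by 2 (polyB a)\<rparr>"

end

theory Submission
  imports
    Defs
    "HOL-Computational_Algebra.Field_as_Ring"
    "HOL-Computational_Algebra.Polynomial_Factorial"
begin

text \<open>The two-valued multiplication defined by \<open>D\<close> is the quotient by inversion of the group of
  points of the curve. For points \<open>u\<close>, \<open>v\<close> with different abscissae \<open>x\<close>, \<open>y\<close>, the abscissae of
  \<open>u + v\<close> and \<open>u - v\<close> come from the chords through \<open>u, v\<close> and through \<open>u, -v\<close>. Their sum and product
  are even in the ordinates, hence rational in \<open>x\<close> and \<open>y\<close>, and cleared of the denominator
  \<open>(x - y)\<^sup>2\<close> they are the coefficients of \<open>D(z; x, y)\<close> (\<open>abscissae_sum_product\<close>,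
  \<open>product_form_exists\<close>). Associativity, the neutral element and the inverse of the two-valued group are
  then inherited from the curve (locale \<open>inversion_quotient\<close>). Everything about \<open>B\<close> follows from \<open>D\<close> by
  exchanging the two homogeneous coordinates, which reverses the coefficients of the binary forms.

  The group law is obtained from a notion of collinearity that treats chords and tangents uniformly:
  a line \<open>\<eta> = l \<zeta> + m\<close> cuts the curve in three points when
  \<open>f(t) - (l t + m)\<^sup>2 = (t - x1) (t - x2) (t - x3)\<close>. In this form associativity is the statement that the
  slopes of four lines satisfy \<open>l1 + l2 = l3 + l4\<close>; the fourth line can be written down from the other
  three (\<open>line_cuts_assoc\<close>). The same parametrisation turns the verification of the
  addition laws of Bosma and Lenstra, which make addition a regular map, into identities between
  polynomials in five independent variables (\<open>law_line\<close>).

  For the classification, equality of the \<open>j\<close>-invariants provides a substitution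
  \<open>(\<zeta>, \<eta>) \<mapsto> (c\<^sup>2 \<zeta> + r, c\<^sup>3 \<eta>)\<close> between the curves, which preserves lines and therefore sums. Conversely a
  coset isomorphism induces an injective regular map of the projective line. Such a map is a
  fractional linear transformation (\<open>injective_regular_map_linear\<close>), and as it fixes the neutral
  element it is affine in the abscissa. Since group isomorphisms preserve points of order two, it maps
  the roots of one cubic to those of the other, and \<open>j\<close> is invariant under affine
  substitutions.\<close>

section \<open>Homogeneous coordinates and regular maps\<close>

lemma proj_rel_refl_iff: "proj_rel v v \<longleftrightarrow> v \<noteq> 0"
  unfolding proj_rel_def by (auto intro: exI[of _ 1])

lemma abs_proj_eq_iff:
  assumes "v \<noteq> 0" "w \<noteq> 0"
  shows "abs_proj v = abs_proj w \<longleftrightarrow> (\<exists>c. c \<noteq> 0 \<and> w = c *s v)"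
  using Quotient3_rel[OF Quotient3_proj, of v w] assms
  unfolding proj_rel_refl_iff by (simp add: proj_rel_def)

lemma abs_proj_scale:
  assumes "v \<noteq> 0" "c \<noteq> 0"
  shows "abs_proj (c *s v) = abs_proj v"
  using abs_proj_eq_iff[of v "c *s v"] assms by auto

lemma rep_proj_nonzero [simp]: "rep_proj p \<noteq> 0"
  using Quotient3_rep_reflp[OF Quotient3_proj, of p] by (simp add: proj_rel_refl_iff)

lemma abs_rep_proj [simp]: "abs_proj (rep_proj p) = p"
  by (rule Quotient3_abs_rep[OF Quotient3_proj])

lemma rep_abs_proj:
  assumes "v \<noteq> 0"
  obtains c where "c \<noteq> 0" "rep_proj (abs_proj v) = c *s v"
  using abs_proj_eq_iff[OF assms rep_proj_nonzero, of "abs_proj v"] by auto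

lemma vec2_eq_iff: "(v :: complex ^ 2) = w \<longleftrightarrow> v $ 1 = w $ 1 \<and> v $ 2 = w $ 2"
  by (simp add: vec_eq_iff forall_2)

lemma vec3_eq_iff: "(v :: complex ^ 3) = w \<longleftrightarrow> v $ 1 = w $ 1 \<and> v $ 2 = w $ 2 \<and> v $ 3 = w $ 3"
  by (simp add: vec_eq_iff forall_3)

lemma cp1_eq_iff:
  assumes "(x, y) \<noteq> (0, 0)" "(x', y') \<noteq> (0, 0)"
  shows "cp1 x y = cp1 x' y' \<longleftrightarrow> x * y' = x' * y"
proof
  assume "cp1 x y = cp1 x' y'"
  then show "x * y' = x' * y"
    using abs_proj_eq_iff[of "vector [x, y] :: complex ^ 2" "vector [x', y']"] assms
    by (auto simp: cp1_def vec2_eq_iff)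
next
  assume e: "x * y' = x' * y"
  have "\<exists>c. c \<noteq> 0 \<and> x' = c * x \<and> y' = c * y"
  proof (cases "x = 0")
    case True
    then show ?thesis using e assms by (intro exI[of _ "y' / y"]) auto
  next
    case False
    then show ?thesis using e assms by (intro exI[of _ "x' / x"]) (auto simp: field_simps)
  qed
  then show "cp1 x y = cp1 x' y'"
    using abs_proj_eq_iff[of "vector [x, y] :: complex ^ 2" "vector [x', y']"] assms
    by (auto simp: cp1_def vec2_eq_iff)
qed

lemma cp1_scale: "c \<noteq> 0 \<Longrightarrow> (x, y) \<noteq> (0, 0) \<Longrightarrow> cp1 (c * x) (c * y) = cp1 x y"
  by (subst cp1_eq_iff) auto

lemma abs_proj_cp1: "abs_proj v = cp1 (v $ 1) (v $ 2)"
proof -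
  have "v = vector [v $ 1, v $ 2]" by (simp add: vec2_eq_iff)
  then show ?thesis unfolding cp1_def by simp
qed

lemma cp1_rep [simp]: "cp1 (rep_proj p $ 1) (rep_proj p $ 2) = p"
  using abs_proj_cp1[of "rep_proj p"] by simp

lemma rep2_nonzero: "(rep_proj (p :: 2 proj) $ 1, rep_proj p $ 2) \<noteq> (0, 0)"
  using rep_proj_nonzero[of p] by (auto simp: vec2_eq_iff)

lemma cp1_cases:
  obtains x y where "(x, y) \<noteq> (0, 0)" "p = cp1 x y"
  using rep2_nonzero[of p] cp1_rep[of p] by metis

lemma rep_cp1:
  assumes "(x, y) \<noteq> (0, 0)"
  obtains c where "c \<noteq> 0" "rep_proj (cp1 x y) $ 1 = c * x" "rep_proj (cp1 x y) $ 2 = c * y"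
proof -
  have "(vector [x, y] :: complex ^ 2) \<noteq> 0" using assms by (auto simp: vec2_eq_iff)
  then obtain c where "c \<noteq> 0" "rep_proj (cp1 x y) = c *s vector [x, y]"
    unfolding cp1_def by (rule rep_abs_proj)
  then show thesis by (intro that[of c]) auto
qed

lemma recip_cp1:
  assumes "(x, y) \<noteq> (0, 0)"
  shows "recip (cp1 x y) = cp1 y x"
proof -
  obtain c where "c \<noteq> 0" "rep_proj (cp1 x y) $ 1 = c * x" "rep_proj (cp1 x y) $ 2 = c * y"
    using rep_cp1[OF assms] .
  then show ?thesis using assms cp1_scale[of c y x] by (auto simp: recip_def)
qed

lemma recip_recip [simp]: "recip (recip p) = p"
proof -
  obtain x y where "(x, y) \<noteq> (0, 0)" "p = cp1 x y" by (rule cp1_cases)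
  then show ?thesis using recip_cp1[of x y] recip_cp1[of y x] by auto
qed

lemma cp1_affine_or_infty: "p = infty \<or> (\<exists>z. p = cp1 z 1)"
proof -
  obtain x y where xy: "(x, y) \<noteq> (0, 0)" "p = cp1 x y" by (rule cp1_cases)
  show ?thesis
  proof (cases "y = 0")
    case True
    then have "p = infty" using xy by (simp add: infty_def cp1_eq_iff)
    then show ?thesis by simp
  next
    case False
    then have "p = cp1 (x / y) 1" using xy by (simp add: cp1_eq_iff)
    then show ?thesis by blast
  qed
qed

lemma cp1_affine_eq_iff [simp]: "cp1 z 1 = cp1 w 1 \<longleftrightarrow> z = w"
  by (simp add: cp1_eq_iff)

lemma cp1_affine_neq_infty [simp]: "cp1 z 1 \<noteq> infty" "infty \<noteq> cp1 z 1"
  by (simp_all add: cp1_eq_iff infty_def)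

lemma abs_proj_cp2: "abs_proj v = cp2 (v $ 1) (v $ 2) (v $ 3)"
proof -
  have "v = vector [v $ 1, v $ 2, v $ 3]" by (simp add: vec3_eq_iff)
  then show ?thesis unfolding cp2_def by simp
qed

lemma cp2_rep [simp]: "cp2 (rep_proj p $ 1) (rep_proj p $ 2) (rep_proj p $ 3) = p"
  using abs_proj_cp2[of "rep_proj p"] by simp

lemma rep_cp2:
  assumes "(x, y, z) \<noteq> (0, 0, 0)"
  obtains c where "c \<noteq> 0" "rep_proj (cp2 x y z) = c *s vector [x, y, z]"
proof -
  have "(vector [x, y, z] :: complex ^ 3) \<noteq> 0" using assms by (auto simp: vec3_eq_iff)
  then show thesis using that unfolding cp2_def by (rule rep_abs_proj)
qed

lemma cp2_scale:
  assumes "c \<noteq> 0" "(x, y, z) \<noteq> (0, 0, 0)"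
  shows "cp2 (c * x) (c * y) (c * z) = cp2 x y z"
proof -
  have "(vector [x, y, z] :: complex ^ 3) \<noteq> 0" using assms by (auto simp: vec3_eq_iff)
  moreover have "vector [c * x, c * y, c * z] = c *s (vector [x, y, z] :: complex ^ 3)"
    by (simp add: vec3_eq_iff)
  ultimately show ?thesis using assms(1) by (simp add: cp2_def abs_proj_scale)
qed

lemma homogeneous_coord: "homogeneous 1 (\<lambda>v. v $ i)"
  unfolding homogeneous_def by (auto intro: poly_funs.coord)

lemma homogeneous_const: "homogeneous 0 (\<lambda>v. c)"
  unfolding homogeneous_def by (auto intro: poly_funs.const)

lemma homogeneous_add:
  "homogeneous d f \<Longrightarrow> homogeneous d g \<Longrightarrow> homogeneous d (\<lambda>v. f v + g v)"
  unfolding homogeneous_def by (auto intro: poly_funs.add simp: algebra_simps)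

lemma homogeneous_mult:
  "homogeneous d f \<Longrightarrow> homogeneous e g \<Longrightarrow> homogeneous (d + e) (\<lambda>v. f v * g v)"
  unfolding homogeneous_def by (auto intro: poly_funs.mult simp: power_add algebra_simps)

lemma homogeneous_cmult: "homogeneous d f \<Longrightarrow> homogeneous d (\<lambda>v. c * f v)"
  using homogeneous_mult[OF homogeneous_const, of d f c] by simp

lemma homogeneous_uminus: "homogeneous d f \<Longrightarrow> homogeneous d (\<lambda>v. - f v)"
  using homogeneous_cmult[of d f "-1"] by simp

lemma homogeneous_diff:
  "homogeneous d f \<Longrightarrow> homogeneous d g \<Longrightarrow> homogeneous d (\<lambda>v. f v - g v)"
  using homogeneous_add[OF _ homogeneous_uminus, of d f g] by simp

lemma homogeneous_mult1:
  "homogeneous 1 f \<Longrightarrow> homogeneous 1 g \<Longrightarrow> homogeneous 2 (\<lambda>v. f v * g v)"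
  using homogeneous_mult[of 1 f 1 g] by (simp add: numeral_2_eq_2)

lemma homogeneous_scale: "homogeneous d f \<Longrightarrow> f (c *s v) = c ^ d * f v"
  by (simp add: homogeneous_def)

lemma homogeneous_zero_iff:
  assumes "homogeneous d f" "v \<noteq> 0"
  shows "f (rep_proj (abs_proj v)) = 0 \<longleftrightarrow> f v = 0"
  using rep_abs_proj[OF assms(2)] homogeneous_scale[OF assms(1)]
  by (metis mult_eq_0_iff power_not_zero)

lemma zariski_closed_empty: "zariski_closed {}"
  unfolding zariski_closed_def
  by (rule exI[of _ "{\<lambda>_. 1}"]) (auto intro: homogeneous_const)

lemma zariski_closed_UNIV: "zariski_closed UNIV"
  unfolding zariski_closed_def by (rule exI[of _ "{}"]) auto

lemma dense_open_in_refl: "dense_open_in X X"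
  unfolding dense_open_in_def using zariski_closed_empty by (metis Diff_empty)

text \<open>Charts may be cut out by the common zeros of the chosen coordinate functions
  themselves, so a map is regular as soon as every point has homogeneous polynomials of equal degree
  that do not all vanish there and that compute the map wherever they do not all vanish.\<close>

lemma regular_mapI:
  fixes f :: "('k :: finite) proj \<Rightarrow> ('m :: finite) proj"
  assumes "f ` X \<subseteq> Y"
    and "\<And>p. p \<in> X \<Longrightarrow> \<exists>d (G :: complex ^ 'k \<Rightarrow> complex ^ 'm).
           (\<forall>j. homogeneous d (\<lambda>v. G v $ j)) \<and> G (rep_proj p) \<noteq> 0 \<and>
           (\<forall>v. v \<noteq> 0 \<and> abs_proj v \<in> X \<and> G v \<noteq> 0 \<longrightarrow> f (abs_proj v) = abs_proj (G v))"
  shows "regular_map X Y f"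
  unfolding regular_map_def
proof (intro conjI ballI assms(1))
  fix p assume "p \<in> X"
  then obtain d and G :: "complex ^ 'k \<Rightarrow> complex ^ 'm" where
    h: "\<forall>j. homogeneous d (\<lambda>v. G v $ j)" and nz: "G (rep_proj p) \<noteq> 0"
    and e: "\<forall>v. v \<noteq> 0 \<and> abs_proj v \<in> X \<and> G v \<noteq> 0 \<longrightarrow> f (abs_proj v) = abs_proj (G v)"
    using assms(2) by blast
  define Z where "Z = {q. \<forall>g\<in>range (\<lambda>j v. G v $ j). g (rep_proj q) = 0}"
  have "zariski_closed Z"
    unfolding zariski_closed_def Z_def
    by (rule exI[of _ "range (\<lambda>j v. G v $ j)"]) (use h in auto)
  moreover have "p \<notin> Z" using nz by (auto simp: Z_def vec_eq_iff)
  moreover have "G v \<noteq> 0 \<and> f (abs_proj v) = abs_proj (G v)" if "v \<noteq> 0" "abs_proj v \<in> X - Z" for v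
  proof -
    have "\<exists>j. G (rep_proj (abs_proj v)) $ j \<noteq> 0" using that unfolding Z_def by blast
    then obtain j where "G (rep_proj (abs_proj v)) $ j \<noteq> 0" ..
    then have "G v $ j \<noteq> 0" using homogeneous_zero_iff[of d "\<lambda>v. G v $ j" v] h that by blast
    then have "G v \<noteq> 0" by auto
    then show ?thesis using e that by blast
  qed
  ultimately show "\<exists>Z d (G :: complex ^ 'k \<Rightarrow> complex ^ 'm).
        zariski_closed Z \<and> p \<notin> Z \<and> (\<forall>j. homogeneous d (\<lambda>v. G v $ j)) \<and>
        (\<forall>v. v \<noteq> 0 \<and> abs_proj v \<in> X - Z \<longrightarrow> G v \<noteq> 0 \<and> f (abs_proj v) = abs_proj (G v))"
    using h by blast
qed

lemma regular_map_linear: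
  fixes G :: "complex ^ 'k \<Rightarrow> complex ^ ('m :: finite)"
  assumes "f ` X \<subseteq> Y"
    and "\<And>j. homogeneous 1 (\<lambda>v. G v $ j)"
    and "\<And>v. v \<noteq> 0 \<Longrightarrow> abs_proj v \<in> X \<Longrightarrow> G v \<noteq> 0 \<and> f (abs_proj v) = abs_proj (G v)"
  shows "regular_map X Y f"
proof (rule regular_mapI[OF assms(1)])
  fix p assume "p \<in> X"
  then show "\<exists>d (G :: complex ^ 'k \<Rightarrow> complex ^ 'm).
           (\<forall>j. homogeneous d (\<lambda>v. G v $ j)) \<and> G (rep_proj p) \<noteq> 0 \<and>
           (\<forall>v. v \<noteq> 0 \<and> abs_proj v \<in> X \<and> G v \<noteq> 0 \<longrightarrow> f (abs_proj v) = abs_proj (G v))"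
    using assms(2,3) by (intro exI[of _ 1] exI[of _ G]) auto
qed

lemma regular_map_cp1_linear:
  assumes "\<And>x y. (x, y) \<noteq> (0, 0) \<Longrightarrow>
      (\<alpha> * x + \<beta> * y, \<gamma> * x + \<delta> * y) \<noteq> (0, 0) \<and> f (cp1 x y) = cp1 (\<alpha> * x + \<beta> * y) (\<gamma> * x + \<delta> * y)"
  shows "regular_map UNIV UNIV f"
proof (rule regular_map_linear[where
      G = "\<lambda>v. vector [\<alpha> * v $ 1 + \<beta> * v $ 2, \<gamma> * v $ 1 + \<delta> * v $ 2]"])
  show "homogeneous 1 (\<lambda>v::complex^2. (vector [\<alpha> * v $ 1 + \<beta> * v $ 2, \<gamma> * v $ 1 + \<delta> * v $ 2] :: complex ^ 2) $ j)"
    for j :: 2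
    using exhaust_2[of j]
    by (elim disjE; simp; intro homogeneous_add homogeneous_cmult homogeneous_coord[simplified])
next
  fix v :: "complex ^ 2" assume "v \<noteq> 0"
  then have "(v $ 1, v $ 2) \<noteq> (0, 0)" by (auto simp: vec2_eq_iff)
  from assms[OF this] show "vector [\<alpha> * v $ 1 + \<beta> * v $ 2, \<gamma> * v $ 1 + \<delta> * v $ 2] \<noteq> (0 :: complex ^ 2) \<and>
      f (abs_proj v) = abs_proj (vector [\<alpha> * v $ 1 + \<beta> * v $ 2, \<gamma> * v $ 1 + \<delta> * v $ 2])"
    unfolding abs_proj_cp1[of v] by (auto simp: cp1_def vec2_eq_iff)
qed simp

lemma regular_map_recip: "regular_map UNIV UNIV recip"
  by (rule regular_map_cp1_linear[of 0 1 1 0]) (auto simp: recip_cp1)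

subsection \<open>Segre coordinates\<close>

lemma outer_nonzero:
  fixes v :: "complex ^ ('k :: finite)" and w :: "complex ^ ('m :: finite)"
  assumes "v \<noteq> 0" "w \<noteq> 0"
  shows "(\<chi> ij. v $ fst ij * w $ snd ij) \<noteq> (0 :: complex ^ ('k \<times> 'm))"
proof -
  obtain i j where "v $ i \<noteq> 0" "w $ j \<noteq> 0" using assms by (auto simp: vec_eq_iff)
  then have "(\<chi> ij. v $ fst ij * w $ snd ij) $ (i, j) \<noteq> (0 :: complex)" by simp
  then show ?thesis by (metis zero_index)
qed

text \<open>Points of a product are handled through arbitrary coordinate vectors of both factors, up to one common
  factor.\<close>

lemma segre_abs:
  fixes v :: "complex ^ ('k :: finite)" and w :: "complex ^ ('m :: finite)"
  assumes "u \<noteq> 0" "abs_proj u = segre (abs_proj v) (abs_proj w)" "v \<noteq> 0" "w \<noteq> 0"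
  obtains c where "c \<noteq> 0" "\<And>i j. u $ (i, j) = c * (v $ i * w $ j)"
proof -
  obtain a where a: "a \<noteq> 0" "rep_proj (abs_proj v) = a *s v" using rep_abs_proj[OF assms(3)] .
  obtain b where b: "b \<noteq> 0" "rep_proj (abs_proj w) = b *s w" using rep_abs_proj[OF assms(4)] .
  have "abs_proj (\<chi> ij. (a *s v) $ fst ij * (b *s w) $ snd ij) = abs_proj u"
    using assms(2) a b by (simp add: segre_def)
  moreover have "(\<chi> ij. (a *s v) $ fst ij * (b *s w) $ snd ij) \<noteq> 0"
    by (rule outer_nonzero) (use a b assms in auto)
  ultimately obtain c where "c \<noteq> 0" "u = c *s (\<chi> ij. (a *s v) $ fst ij * (b *s w) $ snd ij)"
    using abs_proj_eq_iff assms(1) by blast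
  then show thesis using a b by (intro that[of "c * a * b"]) auto
qed

lemma segre_inj:
  assumes "segre p q = segre p' q'"
  shows "p = p' \<and> q = q'"
proof -
  let ?v = "rep_proj p" and ?w = "rep_proj q" and ?v' = "rep_proj p'" and ?w' = "rep_proj q'"
  have "(\<chi> ij. ?v $ fst ij * ?w $ snd ij) \<noteq> 0" by (rule outer_nonzero) auto
  moreover have "abs_proj (\<chi> ij. ?v $ fst ij * ?w $ snd ij) = segre (abs_proj ?v') (abs_proj ?w')"
    using assms by (simp add: segre_def)
  ultimately obtain c where c: "c \<noteq> 0"
    and e: "\<And>i j. (\<chi> ij. ?v $ fst ij * ?w $ snd ij) $ (i, j) = c * (?v' $ i * ?w' $ j)"
    by (rule segre_abs) auto
  have e: "?v $ i * ?w $ j = c * (?v' $ i * ?w' $ j)" for i j using e[of i j] by simp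
  obtain i0 j0 where nz: "?v $ i0 \<noteq> 0" "?w $ j0 \<noteq> 0"
    using rep_proj_nonzero[of p] rep_proj_nonzero[of q] by (auto simp: vec_eq_iff)
  have nz': "?v' $ i0 \<noteq> 0" "?w' $ j0 \<noteq> 0" using e[of i0 j0] nz c by auto
  have "?v = (c * ?w' $ j0 / ?w $ j0) *s ?v'"
    using e[of _ j0] nz by (auto simp: vec_eq_iff field_simps)
  then have "p = p'" using abs_proj_scale[of ?v' "c * ?w' $ j0 / ?w $ j0"] nz nz' c
    by (metis abs_rep_proj divide_eq_0_iff mult_eq_0_iff rep_proj_nonzero)
  moreover have "?w = (c * ?v' $ i0 / ?v $ i0) *s ?w'"
    using e[of i0] nz by (auto simp: vec_eq_iff field_simps)
  then have "q = q'" using abs_proj_scale[of ?w' "c * ?v' $ i0 / ?v $ i0"] nz nz' c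
    by (metis abs_rep_proj divide_eq_0_iff mult_eq_0_iff rep_proj_nonzero)
  ultimately show ?thesis by simp
qed

section \<open>The chord-tangent group law\<close>

definition cubic :: "complex ^ 3 \<Rightarrow> complex \<Rightarrow> complex" where
  "cubic a x = x^3 + a $ 1 * x^2 + a $ 2 * x + a $ 3"

text \<open>Inversion does not depend on the coefficients of the cubic, and unlike \<^const>\<open>sigma\<close> it need not be
  extensional.\<close>

definition cneg :: "3 proj \<Rightarrow> 3 proj" where
  "cneg p = (if p = curve_infty then curve_infty else cp2 (zeta p) (- eta p) 1)"

lemma curve_infty_rep: obtains c where "c \<noteq> 0" "rep_proj curve_infty = c *s vector [0, 1, 0]"
  unfolding curve_infty_def by (rule rep_cp2[of 0 1 0]) auto

lemma zeta_affine [simp]: "zeta (cp2 x y 1) = x" and eta_affine [simp]: "eta (cp2 x y 1) = y"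
  by (rule rep_cp2[of x y 1]; simp add: zeta_def eta_def)+

lemma affine_neq_curve_infty [simp]: "cp2 x y 1 \<noteq> curve_infty" "curve_infty \<noteq> cp2 x y 1"
proof -
  have "rep_proj (cp2 x y 1) $ 3 \<noteq> 0" by (rule rep_cp2[of x y 1]) auto
  moreover have "rep_proj curve_infty $ 3 = 0" by (rule curve_infty_rep) auto
  ultimately show "cp2 x y 1 \<noteq> curve_infty" "curve_infty \<noteq> cp2 x y 1" by auto
qed

lemma affine_eq_iff [simp]: "cp2 x y 1 = cp2 x' y' 1 \<longleftrightarrow> x = x' \<and> y = y'"
  by (metis zeta_affine eta_affine)

lemma cneg_simps [simp]: "cneg curve_infty = curve_infty" "cneg (cp2 x y 1) = cp2 x (- y) 1"
  by (simp_all add: cneg_def)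

lemma curve_points_eq:
  "curve_points a = insert curve_infty {cp2 x y 1 | x y. y^2 = cubic a x}"
  by (simp add: curve_points_def cubic_def)

lemma affine_in_curve [simp]: "cp2 x y 1 \<in> curve_points a \<longleftrightarrow> y^2 = cubic a x"
  by (auto simp: curve_points_eq)

lemma infty_in_curve [simp]: "curve_infty \<in> curve_points a"
  by (simp add: curve_points_eq)

lemma curve_points_cases [consumes 1, case_names infty affine]:
  assumes "p \<in> curve_points a"
  obtains "p = curve_infty" | x y where "p = cp2 x y 1" "y^2 = cubic a x"
  using assms by (auto simp: curve_points_eq)

lemma cneg_in_curve [simp]: "p \<in> curve_points a \<Longrightarrow> cneg p \<in> curve_points a"
  by (erule curve_points_cases) auto

lemma cneg_cneg: "p \<in> curve_points a \<Longrightarrow> cneg (cneg p) = p"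
  by (erule curve_points_cases) auto

text \<open>The line \<open>\<eta> = l \<zeta> + m\<close> cuts the curve in points with abscissae \<open>x1\<close>, \<open>x2\<close>, \<open>x3\<close>, counted
  with multiplicity: the equations compare the coefficients of \<open>f(t) - (l t + m)\<^sup>2\<close> and
  \<open>(t - x1) (t - x2) (t - x3)\<close>. Chords and tangents are treated alike in this form.\<close>

definition line_cuts ::
  "complex ^ 3 \<Rightarrow> complex \<Rightarrow> complex \<Rightarrow> complex \<Rightarrow> complex \<Rightarrow> complex \<Rightarrow> bool" where
  "line_cuts a l m x1 x2 x3 \<longleftrightarrow>
     a $ 1 = l^2 - (x1 + x2 + x3) \<and>
     a $ 2 = 2 * l * m + (x1 * x2 + x1 * x3 + x2 * x3) \<and>
     a $ 3 = m^2 - x1 * x2 * x3"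

text \<open>Three points with sum zero are the intersection of the curve with a line. The line at infinity
  and the vertical lines give the cases with a point at infinity.\<close>

definition zero_sum :: "complex ^ 3 \<Rightarrow> 3 proj \<Rightarrow> 3 proj \<Rightarrow> 3 proj \<Rightarrow> bool" where
  "zero_sum a P Q R \<longleftrightarrow>
     (P = curve_infty \<and> R = cneg Q) \<or> (Q = curve_infty \<and> P = cneg R) \<or>
     (R = curve_infty \<and> Q = cneg P) \<or>
     (\<exists>l m x1 x2 x3. line_cuts a l m x1 x2 x3 \<and>
        P = cp2 x1 (l * x1 + m) 1 \<and> Q = cp2 x2 (l * x2 + m) 1 \<and> R = cp2 x3 (l * x3 + m) 1)"

lemma line_cuts_swap:
  "line_cuts a l m x1 x2 x3 \<Longrightarrow> line_cuts a l m x2 x1 x3"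
  "line_cuts a l m x1 x2 x3 \<Longrightarrow> line_cuts a l m x1 x3 x2"
  "line_cuts a l m x1 x2 x3 \<Longrightarrow> line_cuts a (- l) (- m) x1 x2 x3"
  by (auto simp: line_cuts_def algebra_simps)

lemma zero_sum_swap12:
  assumes "zero_sum a P Q R" "P \<in> curve_points a" "Q \<in> curve_points a" "R \<in> curve_points a"
  shows "zero_sum a Q P R"
proof -
  consider "P = curve_infty \<and> R = cneg Q" | "Q = curve_infty \<and> P = cneg R"
    | "R = curve_infty \<and> Q = cneg P"
    | l m x1 x2 x3 where "line_cuts a l m x1 x2 x3" "P = cp2 x1 (l * x1 + m) 1"
        "Q = cp2 x2 (l * x2 + m) 1" "R = cp2 x3 (l * x3 + m) 1"
    using assms(1) unfolding zero_sum_def by blast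
  then show ?thesis
  proof cases
    case 4
    then show ?thesis using line_cuts_swap(1) unfolding zero_sum_def by blast
  qed (use assms(2-4) in \<open>auto simp: zero_sum_def cneg_cneg\<close>)
qed

lemma zero_sum_swap23:
  assumes "zero_sum a P Q R" "P \<in> curve_points a" "Q \<in> curve_points a" "R \<in> curve_points a"
  shows "zero_sum a P R Q"
proof -
  consider "P = curve_infty \<and> R = cneg Q" | "Q = curve_infty \<and> P = cneg R"
    | "R = curve_infty \<and> Q = cneg P"
    | l m x1 x2 x3 where "line_cuts a l m x1 x2 x3" "P = cp2 x1 (l * x1 + m) 1"
        "Q = cp2 x2 (l * x2 + m) 1" "R = cp2 x3 (l * x3 + m) 1"
    using assms(1) unfolding zero_sum_def by blast
  then show ?thesis
  proof cases
    case 4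
    then show ?thesis using line_cuts_swap(2) unfolding zero_sum_def by blast
  qed (use assms(2-4) in \<open>auto simp: zero_sum_def cneg_cneg\<close>)
qed

lemma zero_sum_cneg:
  assumes "zero_sum a P Q R"
  shows "zero_sum a (cneg P) (cneg Q) (cneg R)"
proof -
  consider "P = curve_infty \<and> R = cneg Q" | "Q = curve_infty \<and> P = cneg R"
    | "R = curve_infty \<and> Q = cneg P"
    | l m x1 x2 x3 where "line_cuts a l m x1 x2 x3" "P = cp2 x1 (l * x1 + m) 1"
        "Q = cp2 x2 (l * x2 + m) 1" "R = cp2 x3 (l * x3 + m) 1"
    using assms unfolding zero_sum_def by blast
  then show ?thesis
  proof cases
    case 4
    then have "line_cuts a (- l) (- m) x1 x2 x3" by (blast intro: line_cuts_swap(3))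
    then show ?thesis using 4 unfolding zero_sum_def
      by (intro disjI2 exI[of _ "- l"] exI[of _ "- m"] exI[of _ x1] exI[of _ x2] exI[of _ x3]) auto
  qed (auto simp: zero_sum_def)
qed

text \<open>Comparing the lines through \<open>P, Q, -(P + Q)\<close> and through \<open>P + Q, R, -(P + Q + R)\<close>, which have
  the slopes \<open>l1\<close> and \<open>l2\<close>: the product of their equations divided by the vertical line at \<open>P + Q\<close>
  is a function \<open>A(\<zeta>) - c \<eta>\<close> with \<open>c = l1 + l2\<close> and a monic quadratic \<open>A\<close>. Its zeros are
  \<open>P, Q, R, -(P + Q + R)\<close>, and dividing it by the line through \<open>Q, R, -(Q + R)\<close>, of slope \<open>l3\<close>,
  leaves a line of slope \<open>c - l3\<close> through \<open>P\<close>, \<open>Q + R\<close> and \<open>-(P + Q + R)\<close>. For \<open>R = -P\<close> and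
  \<open>R = -Q\<close> the second line is the mirror image of the first one, and \<open>c = 0\<close>.\<close>

lemma line_cuts_assoc:
  assumes L1: "line_cuts a l1 m1 p q s"
    and L2: "line_cuts a l2 m2 s r t"
    and L3: "line_cuts a l3 m3 q r u"
    and s: "l2 * s + m2 = - (l1 * s + m1)"
    and q: "l3 * q + m3 = l1 * q + m1"
    and r: "l3 * r + m3 = l2 * r + m2"
    and RP: "\<not> (r = p \<and> l2 * r + m2 = - (l1 * p + m1))"
    and RQ: "\<not> (r = q \<and> l2 * r + m2 = - (l1 * q + m1))"
  obtains l m where "line_cuts a l m p u t" "l * p + m = l1 * p + m1"
    "l * u + m = - (l3 * u + m3)" "l * t + m = l2 * t + m2"
proof -
  define c where "c = l1 + l2"
  have a1: "l1^2 - (p + q + s) = l2^2 - (s + r + t)"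
    using L1 L2 unfolding line_cuts_def by metis
  have a2: "2 * l1 * m1 + (p * q + p * s + q * s) = 2 * l2 * m2 + (s * r + s * t + r * t)"
    using L1 L2 unfolding line_cuts_def by metis
  have b1: "l1^2 - (p + q + s) = l3^2 - (q + r + u)"
    using L1 L3 unfolding line_cuts_def by metis
  have cs: "c * s = - (m1 + m2)"
    using s unfolding c_def by (simp add: algebra_simps add_eq_0_iff)
  \<comment> \<open>the quadratic \<open>A = x\<^sup>2 + \<alpha> x + \<beta>\<close>, which equals both
    \<open>c (l1 x + m1) + (x - p) (x - q)\<close> and \<open>c (l2 x + m2) + (x - r) (x - t)\<close>\<close>
  define \<alpha> \<beta> where "\<alpha> = c * l1 - (p + q)" and "\<beta> = c * m1 + p * q"
  have d12: "p + q - (r + t) = c * (l1 - l2)"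
    using a1 unfolding c_def by (simp add: algebra_simps power2_eq_square)
  have \<alpha>2: "\<alpha> = c * l2 - (r + t)" using d12 unfolding \<alpha>_def by (simp add: algebra_simps)
  have "s * (p + q - (r + t)) = - (m1 + m2) * (l1 - l2)"
    unfolding d12 using cs by (metis mult.assoc mult.commute)
  then have h: "s * (p + q - (r + t)) + (m1 + m2) * (l1 - l2) = 0"
    by (simp add: algebra_simps)
  have "\<beta> - (c * m2 + r * t) =
     2 * l1 * m1 + (p * q + p * s + q * s) - (2 * l2 * m2 + (s * r + s * t + r * t))
     - (s * (p + q - (r + t)) + (m1 + m2) * (l1 - l2))"
    unfolding \<beta>_def c_def by (simp add: algebra_simps)
  then have \<beta>2: "\<beta> = c * m2 + r * t" unfolding h a2 by simp
  have c0: "c \<noteq> 0"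
  proof
    assume "c = 0"
    then have l: "l2 = - l1" "m2 = - m1" using cs unfolding c_def by algebra+
    have "(r - p) * (r - q) = 0" using \<alpha>2 \<beta>2 \<open>c = 0\<close> unfolding \<alpha>_def \<beta>_def by algebra
    then have "r = p \<or> r = q" by auto
    then show False using RP RQ l by auto
  qed
  have Aq: "q^2 + \<alpha> * q + \<beta> = c * (l3 * q + m3)"
    unfolding q \<alpha>_def \<beta>_def by (simp add: algebra_simps power2_eq_square)
  have Ar: "r^2 + \<alpha> * r + \<beta> = c * (l3 * r + m3)"
    unfolding r \<alpha>2 \<beta>2 by (simp add: algebra_simps power2_eq_square)
  \<comment> \<open>\<open>A - c (l3 x + m3)\<close> vanishes at \<open>q\<close> and \<open>r\<close>, so it is \<open>(x - q) (x - r)\<close>; only a double zero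
    \<open>q = r\<close> needs derivatives\<close>
  have E1: "\<alpha> = c * l3 - (q + r)"
  proof (cases "q = r")
    case False
    have "(q - r) * (\<alpha> - (c * l3 - (q + r))) = (q^2 + \<alpha> * q + \<beta> - c * (l3 * q + m3)) - (r^2 + \<alpha> * r + \<beta> - c * (l3 * r + m3))"
      by (simp add: algebra_simps power2_eq_square)
    then have "(q - r) * (\<alpha> - (c * l3 - (q + r))) = 0" unfolding Aq Ar by simp
    then show ?thesis using False by simp
  next
    case True
    define y where "y = l3 * q + m3"
    have y: "y = l1 * q + m1" "y = l2 * q + m2" using q r True by (auto simp: y_def)
    have y0: "y \<noteq> 0"
    proof
      assume "y = 0"
      then have "l1 * q + m1 = 0" "l2 * r + m2 = 0" using y True by auto
      then show False using RQ True by simp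
    qed
    define d where "d = 3 * q^2 + 2 * a $ 1 * q + a $ 2"
    have d3: "d = 2 * l3 * y"
      using L3 True unfolding line_cuts_def d_def y_def by algebra
    have d1: "d = 2 * l1 * y + (q - p) * (q - s)"
      using L1 unfolding line_cuts_def d_def y by algebra
    \<comment> \<open>the derivative of \<open>A\<^sup>2 - c\<^sup>2 f\<close> vanishes at the double zero \<open>q\<close>\<close>
    have yc: "2 * y = c * (q - s)"
    proof -
      have "2 * y = (l1 * q + m1) + (l2 * q + m2)" using y by simp
      also have "\<dots> = c * q - - (m1 + m2)" by (simp add: c_def algebra_simps)
      also have "\<dots> = c * q - c * s" by (simp only: cs)
      finally show ?thesis by (simp add: algebra_simps)
    qed
    have "2 * (2 * q + \<alpha>) * y = c * (2 * l1 * y) + (q - p) * (2 * y)"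
      unfolding \<alpha>_def by (simp add: algebra_simps)
    also have "\<dots> = c * d" unfolding d1 yc by (simp add: algebra_simps)
    finally have "2 * (2 * q + \<alpha>) * y = c * d" .
    then have "2 * (y * (\<alpha> - (c * l3 - (q + r)))) = 0"
      unfolding d3 using True by (simp add: algebra_simps)
    then have "y * (\<alpha> - (c * l3 - (q + r))) = 0" by simp
    then show ?thesis using y0 by simp
  qed
  have E2: "\<beta> = c * m3 + q * r"
    using Aq unfolding E1 by (simp add: algebra_simps power2_eq_square)
  have cc: "c * c = 2 * \<alpha> + (p + q + r + t)"
  proof -
    have "c * c = c * l1 + c * l2" by (simp add: c_def algebra_simps)
    moreover have "c * l1 = \<alpha> + (p + q)" by (simp add: \<alpha>_def)
    moreover have "c * l2 = \<alpha> + (r + t)" using \<alpha>2 by simp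
    ultimately show ?thesis by (simp add: algebra_simps)
  qed
  have cl3: "c * l3 = \<alpha> + q + r" and cm3: "c * m3 = \<beta> - q * r"
    using E1 E2 by (simp_all add: algebra_simps)
  have B: "2 * \<beta> = p * q + r * t - c * c * s"
  proof -
    have "c * c * s = - (c * m1 + c * m2)"
      unfolding mult.assoc cs by (simp add: algebra_simps)
    moreover have "c * m1 = \<beta> - p * q" by (simp add: \<beta>_def)
    moreover have "c * m2 = \<beta> - r * t" using \<beta>2 by simp
    ultimately show ?thesis by (simp add: algebra_simps)
  qed
  have us: "c * c * s - c * c * u = p * q + r * t - p * t - q * r"
  proof -
    have "c * c * s - c * c * u = (c * l1)^2 - (c * l3)^2 - c * c * (p - r)"
      using b1 by algebra
    also have "\<dots> = (\<alpha> + p + q)^2 - (\<alpha> + q + r)^2 - (2 * \<alpha> + (p + q + r + t)) * (p - r)"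
      unfolding cc cl3 by (simp add: \<alpha>_def)
    finally show ?thesis by (simp add: algebra_simps power2_eq_square)
  qed
  \<comment> \<open>the line \<open>c (x - u) - (l3 x + m3)\<close>; the equations \<open>pt\<close> and \<open>pt2\<close> say that
    \<open>A - c (l x + m) = (x - p) (x - t)\<close>\<close>
  define l m where "l = c - l3" and "m = - c * u - m3"
  have pt: "p + t = c * l - \<alpha>"
    unfolding l_def right_diff_distrib cc cl3 by simp
  have cm: "c * m = - (c * c * u) - (\<beta> - q * r)"
    unfolding m_def right_diff_distrib cm3 by simp
  have pt2: "p * t = \<beta> - c * m"
  proof -
    have "p * t = (p * q + r * t - c * c * s) + c * c * u - q * r" using us by algebra
    then show ?thesis unfolding cm B[symmetric] by simp
  qed
  have e1: "l^2 - (p + u + t) = l3^2 - (q + r + u)"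
  proof -
    have "l^2 = c * c - 2 * (c * l3) + l3^2" by (simp add: l_def power2_eq_square algebra_simps)
    then show ?thesis unfolding cc cl3 by simp
  qed
  have e2: "2 * l * m + (p * u + p * t + u * t) = 2 * l3 * m3 + (q * r + q * u + r * u)"
  proof -
    have "2 * l * m = 2 * (c * m) + 2 * (c * l3) * u + 2 * l3 * m3"
      by (simp add: l_def m_def algebra_simps)
    then have i1: "2 * l * m = 2 * (- (c * c * u) - (\<beta> - q * r)) + 2 * (\<alpha> + q + r) * u + 2 * l3 * m3"
      unfolding cm cl3 .
    have "p * u + p * t + u * t = p * t + (c * c - c * l3 - \<alpha>) * u"
      unfolding cc cl3 by (simp add: algebra_simps)
    then have i2: "p * u + p * t + u * t =
        \<beta> - (- (c * c * u) - (\<beta> - q * r)) + (c * c - (\<alpha> + q + r) - \<alpha>) * u"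
      unfolding pt2 cm cl3 .
    show ?thesis unfolding i1 i2 by (simp add: algebra_simps)
  qed
  have e3: "m^2 - p * u * t = m3^2 - q * r * u"
  proof -
    have "m^2 = c * c * u * u + 2 * (c * m3) * u + m3^2"
      by (simp add: m_def power2_eq_square algebra_simps)
    then have i1: "m^2 = c * c * u * u + 2 * (\<beta> - q * r) * u + m3^2" unfolding cm3 .
    have "p * u * t = u * (p * t)" by simp
    then have i2: "p * u * t = u * (\<beta> - (- (c * c * u) - (\<beta> - q * r)))" unfolding pt2 cm .
    show ?thesis unfolding i1 i2 by (simp add: algebra_simps)
  qed
  have lc: "line_cuts a l m p u t"
    using e1 e2 e3 L3 unfolding line_cuts_def by metis
  have cl: "c * l = p + t + \<alpha>" and cm': "c * m = \<beta> - p * t"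
    using pt pt2 by (simp_all add: algebra_simps)
  have "c * (l * p + m) = c * l * p + c * m" by (simp add: algebra_simps)
  also have "\<dots> = c * (l1 * p + m1)"
    unfolding cl cm' \<alpha>_def \<beta>_def by (simp add: algebra_simps)
  finally have p: "l * p + m = l1 * p + m1" using c0 by simp
  have "c * (l * t + m) = c * l * t + c * m" by (simp add: algebra_simps)
  also have "\<dots> = c * (l2 * t + m2)"
    unfolding cl cm' \<alpha>2 \<beta>2 by (simp add: algebra_simps)
  finally have t: "l * t + m = l2 * t + m2" using c0 by simp
  have "l * u + m = - (l3 * u + m3)" unfolding l_def m_def by (simp add: algebra_simps)
  then show thesis using that lc p t by blast
qed

lemma delta_eq: "delta a = (a $ 1)^2 * (a $ 2)^2 - 4 * (a $ 2)^3 - 4 * (a $ 1)^3 * a $ 3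
    - 27 * (a $ 3)^2 + 18 * a $ 1 * a $ 2 * a $ 3"
  by (simp add: delta_def disc3_def numeral_eq_Suc Let_def)

locale elliptic_curve =
  fixes a :: "complex ^ 3"
  assumes nonsingular: "delta a \<noteq> 0"
begin

abbreviation "E \<equiv> curve_points a"

text \<open>Eliminating \<open>a\<^sub>2\<close> and \<open>a\<^sub>3\<close> by means of a common zero of \<open>f\<close> and \<open>f'\<close> turns the discriminant into 0.\<close>

lemma no_double_root:
  assumes "cubic a x = 0" "3 * x^2 + 2 * a $ 1 * x + a $ 2 = 0"
  shows False
proof -
  have "a $ 2 = - (3 * x^2 + 2 * a $ 1 * x)" using assms(2) by algebra
  moreover from this have "a $ 3 = 2 * x^3 + a $ 1 * x^2" using assms(1) unfolding cubic_def by algebra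
  ultimately have "delta a = 0" unfolding delta_eq by algebra
  then show False using nonsingular by simp
qed

lemma line_cuts_on_curve:
  assumes "line_cuts a l m x1 x2 x3"
  shows "(l * x1 + m)^2 = cubic a x1" "(l * x2 + m)^2 = cubic a x2" "(l * x3 + m)^2 = cubic a x3"
  using assms unfolding line_cuts_def cubic_def by algebra+

text \<open>A point and its negative on a line that is not vertical have ordinate 0, and their abscissa would
  be a double root of the cubic.\<close>

lemma line_cuts_not_opposite:
  assumes "line_cuts a l m x1 x2 x3"
  shows "\<not> (x1 = x2 \<and> l * x1 + m = - (l * x2 + m))"
proof
  assume o: "x1 = x2 \<and> l * x1 + m = - (l * x2 + m)"
  then have "l * x1 + m = - (l * x1 + m)" by metis
  then have "2 * (l * x1 + m) = 0" by algebra
  then have y: "l * x1 + m = 0" by (simp only: mult_eq_0_iff) simp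
  then have "cubic a x1 = 0" using line_cuts_on_curve(1)[OF assms] by simp
  moreover have "3 * x1^2 + 2 * a $ 1 * x1 + a $ 2 = 0"
    using assms o y unfolding line_cuts_def by algebra
  ultimately show False by (rule no_double_root)
qed

lemma curve_add_line_cuts:
  assumes L: "line_cuts a l m x1 x2 x3"
  shows "curve_add a (cp2 x1 (l * x1 + m) 1) (cp2 x2 (l * x2 + m) 1) = cp2 x3 (- (l * x3 + m)) 1"
proof -
  define k where "k = (if x1 = x2
      then (3 * x1^2 + 2 * a $ 1 * x1 + a $ 2) / (2 * (l * x1 + m))
      else ((l * x2 + m) - (l * x1 + m)) / (x2 - x1))"
  have "k = l"
  proof (cases "x1 = x2")
    case True
    have nz: "l * x1 + m \<noteq> 0"
    proof
      assume "l * x1 + m = 0"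
      moreover from this have "l * x2 + m = 0" using True by simp
      ultimately show False using line_cuts_not_opposite[OF L] True by simp
    qed
    have "3 * x1^2 + 2 * a $ 1 * x1 + a $ 2 = l * (2 * (l * x1 + m))"
      using L True unfolding line_cuts_def by algebra
    then have "k = l * (2 * (l * x1 + m)) / (2 * (l * x1 + m))"
      using True unfolding k_def by (simp only: if_True simp_thms)
    moreover have "2 * (l * x1 + m) \<noteq> 0" using nz by (simp only: mult_eq_0_iff) simp
    ultimately show ?thesis by (metis nonzero_mult_div_cancel_right)
  next
    case False
    then show ?thesis unfolding k_def by (simp add: field_simps)
  qed
  moreover have "l^2 - a $ 1 - x1 - x2 = x3" using L by (simp add: line_cuts_def)
  moreover have "curve_add a (cp2 x1 (l * x1 + m) 1) (cp2 x2 (l * x2 + m) 1) =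
     cp2 (k^2 - a $ 1 - x1 - x2) (k * (x1 - (k^2 - a $ 1 - x1 - x2)) - (l * x1 + m)) 1"
    using line_cuts_not_opposite[OF L] unfolding curve_add_def Let_def k_def by simp
  moreover have "l * (x1 - x3) - (l * x1 + m) = - (l * x3 + m)" by (simp add: algebra_simps)
  ultimately show ?thesis by metis
qed

lemma line_cuts_exists:
  assumes "y1^2 = cubic a x1" "y2^2 = cubic a x2" "\<not> (x1 = x2 \<and> y1 = - y2)"
  obtains l m x3 where "line_cuts a l m x1 x2 x3" "y1 = l * x1 + m" "y2 = l * x2 + m"
proof (cases "x1 = x2")
  case False
  define l where "l = (y2 - y1) / (x2 - x1)"
  define m where "m = y1 - l * x1"
  define x3 where "x3 = l^2 - a $ 1 - x1 - x2"
  have y1: "y1 = l * x1 + m" by (simp add: m_def)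
  have "l * (x2 - x1) = y2 - y1" using False by (simp add: l_def)
  then have y2: "y2 = l * x2 + m" unfolding m_def by algebra
  define \<gamma> where "\<gamma> = a $ 2 - (2 * l * m + (x1 * x2 + x1 * x3 + x2 * x3))"
  define \<epsilon> where "\<epsilon> = a $ 3 - (m^2 - x1 * x2 * x3)"
  have e: "\<gamma> * x1 + \<epsilon> = 0" "\<gamma> * x2 + \<epsilon> = 0"
    using assms y1 y2 x3_def unfolding \<gamma>_def \<epsilon>_def cubic_def by algebra+
  then have "\<gamma> * (x1 - x2) = 0" by algebra
  then have "\<gamma> = 0" "\<epsilon> = 0" using False e by auto
  then have "line_cuts a l m x1 x2 x3"
    unfolding line_cuts_def \<gamma>_def \<epsilon>_def x3_def by auto
  then show ?thesis using that y1 y2 by blast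
next
  case True
  have "y1^2 = y2^2" using assms(1,2) True by simp
  then have "(y1 - y2) * (y1 + y2) = 0" by algebra
  moreover have "y1 + y2 \<noteq> 0" using assms(3) True by (auto simp: add_eq_0_iff)
  ultimately have y12: "y1 = y2" by simp
  then have y0: "y1 \<noteq> 0" using \<open>y1 + y2 \<noteq> 0\<close> by auto
  define l where "l = (3 * x1^2 + 2 * a $ 1 * x1 + a $ 2) / (2 * y1)"
  define m where "m = y1 - l * x1"
  define x3 where "x3 = l^2 - a $ 1 - x1 - x2"
  have y1: "y1 = l * x1 + m" by (simp add: m_def)
  have d: "l * (2 * y1) = 3 * x1^2 + 2 * a $ 1 * x1 + a $ 2" using y0 by (simp add: l_def)
  have "a $ 2 = 2 * l * m + (x1 * x2 + x1 * x3 + x2 * x3)"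
    using d y1 x3_def True by algebra
  moreover from this have "a $ 3 = m^2 - x1 * x2 * x3"
    using assms(1) y1 x3_def True unfolding cubic_def by algebra
  ultimately have "line_cuts a l m x1 x2 x3"
    unfolding line_cuts_def x3_def by auto
  then show ?thesis using that y1 y12 True by blast
qed

lemma curve_add_infty [simp]: "curve_add a curve_infty q = q" "curve_add a p curve_infty = p"
  by (auto simp: curve_add_def)

lemma curve_add_cneg: "p \<in> E \<Longrightarrow> curve_add a p (cneg p) = curve_infty"
  by (erule curve_points_cases) (auto simp: curve_add_def)

lemma curve_add_eq_if_zero_sum:
  assumes "zero_sum a P Q R" "P \<in> E" "Q \<in> E" "R \<in> E"
  shows "curve_add a P Q = cneg R"
  using assms curve_add_line_cuts curve_add_cneg unfolding zero_sum_def
  by (auto simp: cneg_cneg)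

lemma zero_sum_exists:
  assumes "P \<in> E" "Q \<in> E"
  obtains R where "R \<in> E" "zero_sum a P Q R"
proof -
  consider "P = curve_infty" | "Q = curve_infty" | "Q = cneg P"
    | x1 y1 x2 y2 where "P = cp2 x1 y1 1" "Q = cp2 x2 y2 1" "y1^2 = cubic a x1" "y2^2 = cubic a x2"
        "\<not> (x1 = x2 \<and> y1 = - y2)"
    using assms(1)
  proof (cases rule: curve_points_cases)
    case infty
    then show ?thesis using that by blast
  next
    case P: (affine x1 y1)
    show ?thesis
      using assms(2)
    proof (cases rule: curve_points_cases)
      case infty
      then show ?thesis using that by blast
    next
      case (affine x2 y2)
      then show ?thesis using P that(3) that(4)[of x1 y1 x2 y2] by (cases "x1 = x2 \<and> y1 = - y2") auto
    qed
  qed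
  then show thesis
  proof cases
    case 1
    then show ?thesis using assms by (intro that[of "cneg Q"]) (auto simp: zero_sum_def)
  next
    case 2
    then show ?thesis using assms by (intro that[of "cneg P"]) (auto simp: zero_sum_def cneg_cneg)
  next
    case 3
    then show ?thesis by (intro that[of curve_infty]) (auto simp: zero_sum_def)
  next
    case 4
    obtain l m x3 where "line_cuts a l m x1 x2 x3" "y1 = l * x1 + m" "y2 = l * x2 + m"
      using line_cuts_exists[OF 4(3-5)] .
    then show ?thesis using 4(1,2) line_cuts_on_curve(3)
      by (intro that[of "cp2 x3 (l * x3 + m) 1"]) (auto simp: zero_sum_def)
  qed
qed

lemma curve_add_closed: "P \<in> E \<Longrightarrow> Q \<in> E \<Longrightarrow> curve_add a P Q \<in> E"
  by (metis zero_sum_exists curve_add_eq_if_zero_sum cneg_in_curve)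

lemma zero_sum_curve_add:
  assumes "P \<in> E" "Q \<in> E"
  shows "zero_sum a P Q (cneg (curve_add a P Q))"
  using assms by (metis zero_sum_exists curve_add_eq_if_zero_sum cneg_cneg)

lemma zero_sum_unique:
  assumes "zero_sum a P Q R" "zero_sum a P Q R'" "P \<in> E" "Q \<in> E" "R \<in> E" "R' \<in> E"
  shows "R = R'"
  using assms by (metis curve_add_eq_if_zero_sum cneg_cneg)

text \<open>If some point is at infinity or \<open>R\<close> is the negative of \<open>P\<close> or \<open>Q\<close>, the claim follows from the symmetry of
  \<^const>\<open>zero_sum\<close> under permutations and negation and from the uniqueness of the third point.\<close>

lemma zero_sum_assoc:
  assumes E: "P \<in> E" "Q \<in> E" "R \<in> E" "S \<in> E" "T \<in> E" "U \<in> E"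
    and S: "zero_sum a P Q S" and T: "zero_sum a (cneg S) R T" and U: "zero_sum a Q R U"
  shows "zero_sum a P (cneg U) T"
proof -
  note sw = zero_sum_swap12 zero_sum_swap23 zero_sum_cneg zero_sum_unique cneg_cneg
  have neg: "cneg P \<in> E" "cneg Q \<in> E" "cneg R \<in> E" "cneg S \<in> E" "cneg T \<in> E" "cneg U \<in> E"
    using E by auto
  have inf: "zero_sum a curve_infty X Y \<longleftrightarrow> Y = cneg X" if "X \<in> E" "Y \<in> E" for X Y
  proof
    assume "zero_sum a curve_infty X Y"
    then have "X = cneg Y" using curve_add_eq_if_zero_sum[of curve_infty X Y] that by simp
    then show "Y = cneg X" using that by (simp add: cneg_cneg)
  qed (simp add: zero_sum_def)
  consider "P = curve_infty" | "Q = curve_infty" | "R = curve_infty" | "S = curve_infty"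
    | "T = curve_infty" | "U = curve_infty" | "R = cneg P" | "R = cneg Q"
    | "P \<noteq> curve_infty" "Q \<noteq> curve_infty" "R \<noteq> curve_infty" "S \<noteq> curve_infty"
      "T \<noteq> curve_infty" "U \<noteq> curve_infty" "R \<noteq> cneg P" "R \<noteq> cneg Q" by blast
  then show ?thesis
  proof cases
    case 1
    then have "S = cneg Q" using S inf E by simp
    then have "T = U" using T U E by (metis sw(4,5))
    then show ?thesis using 1 inf E by (simp add: cneg_cneg)
  next
    case 2
    then have "zero_sum a curve_infty P S" using S E sw(1) by blast
    then have "S = cneg P" using inf E by simp
    moreover have "U = cneg R" using U 2 inf E by simp
    ultimately show ?thesis using T E by (simp add: cneg_cneg)
  next
    case 3
    then have "zero_sum a curve_infty (cneg S) T" using T E neg sw(1) by blast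
    then have "T = S" using inf E neg by (simp add: cneg_cneg)
    moreover have "zero_sum a curve_infty Q U" using U 3 E sw(1) by blast
    then have "U = cneg Q" using inf E by simp
    ultimately show ?thesis using S E by (simp add: cneg_cneg)
  next
    case 4
    then have "T = cneg R" using T inf E by simp
    moreover have "zero_sum a curve_infty P Q" using S 4 E sw(1,2) by metis
    then have "Q = cneg P" using inf E by simp
    then have "zero_sum a P (cneg R) (cneg U)" using U sw(3)[OF U] E by (simp add: cneg_cneg)
    ultimately show ?thesis using sw(2) E neg by blast
  next
    case 5
    then have "zero_sum a curve_infty (cneg S) R" using T E neg sw(1,2) by metis
    then have "R = S" using inf E neg by (simp add: cneg_cneg)
    then have "zero_sum a Q R P" using S E sw(1,2) by metis
    then have "U = P" using U E sw(4) by blast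
    moreover have "zero_sum a curve_infty P (cneg P)" using inf E neg by simp
    ultimately show ?thesis using 5 E neg sw(1,2) by (metis infty_in_curve)
  next
    case 6
    then have "zero_sum a curve_infty Q R" using U E sw(1,2) by metis
    then have "R = cneg Q" using inf E by simp
    moreover have "zero_sum a (cneg S) (cneg Q) (cneg P)" using sw(3)[OF S] neg sw(1,2) by metis
    ultimately have "T = cneg P" using T E neg sw(4) by metis
    then have "zero_sum a curve_infty P T" using inf E neg by simp
    then show ?thesis using 6 E sw(1) by (metis infty_in_curve cneg_simps(1))
  next
    case 7
    then have "zero_sum a (cneg S) R (cneg Q)" using sw(3)[OF S] neg sw(1,2) by metis
    then have "T = cneg Q" using T E neg sw(4) by metis
    moreover have "zero_sum a (cneg Q) P (cneg U)" using sw(3)[OF U] 7 E by (simp add: cneg_cneg)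
    ultimately show ?thesis using E neg sw(1,2) by metis
  next
    case 8
    then have "zero_sum a Q R curve_infty" by (simp add: zero_sum_def)
    then have "U = curve_infty" using zero_sum_unique[OF U _ E(2,3,6) infty_in_curve] by blast
    moreover have "zero_sum a (cneg S) R (cneg P)" using sw(3)[OF S] 8 neg sw(1,2) by metis
    then have "T = cneg P" using T E neg sw(4) by metis
    then have "zero_sum a curve_infty P T" using inf E neg by simp
    ultimately show ?thesis using E sw(1) by (metis infty_in_curve cneg_simps(1))
  next
    case 9
    then have neg': "cneg S \<noteq> curve_infty" "cneg U \<noteq> curve_infty" using E
      by (metis cneg_cneg cneg_simps(1))+
    obtain l1 m1 p q s where 1: "line_cuts a l1 m1 p q s" "P = cp2 p (l1 * p + m1) 1"
      "Q = cp2 q (l1 * q + m1) 1" "S = cp2 s (l1 * s + m1) 1"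
      using S 9 unfolding zero_sum_def by blast
    obtain l2 m2 s' r t where 2: "line_cuts a l2 m2 s' r t" "cneg S = cp2 s' (l2 * s' + m2) 1"
      "R = cp2 r (l2 * r + m2) 1" "T = cp2 t (l2 * t + m2) 1"
      using T 9 neg' unfolding zero_sum_def by blast
    obtain l3 m3 q' r' u where 3: "line_cuts a l3 m3 q' r' u" "Q = cp2 q' (l3 * q' + m3) 1"
      "R = cp2 r' (l3 * r' + m3) 1" "U = cp2 u (l3 * u + m3) 1"
      using U 9 unfolding zero_sum_def by blast
    have s: "s' = s" "l2 * s + m2 = - (l1 * s + m1)" using 1(4) 2(2) by auto
    have q: "q' = q" "l3 * q + m3 = l1 * q + m1" using 1(3) 3(2) by auto
    have r: "r' = r" "l3 * r + m3 = l2 * r + m2" using 2(3) 3(3) by auto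
    have n: "\<not> (r = p \<and> l2 * r + m2 = - (l1 * p + m1))" "\<not> (r = q \<and> l2 * r + m2 = - (l1 * q + m1))"
      using 9(7,8) 1 2 by auto
    obtain l m where "line_cuts a l m p u t" "l * p + m = l1 * p + m1"
      "l * u + m = - (l3 * u + m3)" "l * t + m = l2 * t + m2"
      using line_cuts_assoc[OF 1(1) _ _ s(2) q(2) r(2) n] 2(1) 3(1) s(1) q(1) r(1) by metis
    then have "line_cuts a l m p u t" "P = cp2 p (l * p + m) 1" "cneg U = cp2 u (l * u + m) 1"
      "T = cp2 t (l * t + m) 1" using 1 2 3 by simp_all
    then show ?thesis unfolding zero_sum_def by blast
  qed
qed

lemma curve_add_commute:
  assumes "P \<in> E" "Q \<in> E"
  shows "curve_add a P Q = curve_add a Q P"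
proof -
  have "curve_add a Q P \<in> E" using assms by (intro curve_add_closed)
  moreover from this have "zero_sum a P Q (cneg (curve_add a Q P))"
    using assms by (intro zero_sum_swap12[OF zero_sum_curve_add]) auto
  ultimately show ?thesis using curve_add_eq_if_zero_sum[of P Q "cneg (curve_add a Q P)"] assms
    by (simp add: cneg_cneg)
qed

lemma curve_add_assoc:
  assumes "P \<in> E" "Q \<in> E" "R \<in> E"
  shows "curve_add a (curve_add a P Q) R = curve_add a P (curve_add a Q R)"
proof -
  let ?S = "curve_add a P Q" and ?U = "curve_add a Q R"
  have c: "?S \<in> E" "?U \<in> E" "curve_add a ?S R \<in> E" using assms by (auto intro: curve_add_closed)
  have "zero_sum a (cneg (cneg ?S)) R (cneg (curve_add a ?S R))"
    using zero_sum_curve_add c assms by (simp add: cneg_cneg)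
  then have "zero_sum a P (cneg (cneg ?U)) (cneg (curve_add a ?S R))"
    using c assms by (intro zero_sum_assoc[where Q = Q and R = R and S = "cneg ?S"])
      (auto intro: zero_sum_curve_add)
  then have "zero_sum a P ?U (cneg (curve_add a ?S R))" using c by (simp add: cneg_cneg)
  then show ?thesis using c assms curve_add_eq_if_zero_sum[of P ?U "cneg (curve_add a ?S R)"]
    by (simp add: cneg_cneg)
qed

lemma carrier_curve_group [simp]: "carrier (curve_group a) = E"
  and mult_curve_group [simp]: "P \<otimes>\<^bsub>curve_group a\<^esub> Q = curve_add a P Q"
  and one_curve_group [simp]: "\<one>\<^bsub>curve_group a\<^esub> = curve_infty"
  by (simp_all add: curve_group_def)

lemma comm_group_curve: "comm_group (curve_group a)"
proof (rule comm_groupI; simp)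
  show "curve_add a x y \<in> E" if "x \<in> E" "y \<in> E" for x y using that by (rule curve_add_closed)
  show "curve_add a (curve_add a x y) z = curve_add a x (curve_add a y z)"
    if "x \<in> E" "y \<in> E" "z \<in> E" for x y z using that by (rule curve_add_assoc)
  show "curve_add a x y = curve_add a y x" if "x \<in> E" "y \<in> E" for x y
    using that by (rule curve_add_commute)
  show "\<exists>y\<in>E. curve_add a y x = curve_infty" if "x \<in> E" for x
    using that curve_add_cneg curve_add_commute by (metis cneg_in_curve)
qed

lemma inv_curve_group [simp]: "P \<in> E \<Longrightarrow> inv\<^bsub>curve_group a\<^esub> P = cneg P"
proof -
  interpret comm_group "curve_group a" by (rule comm_group_curve)
  assume "P \<in> E"
  then show ?thesis using curve_add_cneg curve_add_commute
    by (intro inv_equality) (auto intro: curve_add_cneg simp: curve_add_commute[of "cneg P" P])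
qed

end

section \<open>Addition on the curve is regular\<close>

text \<open>The bihomogeneous addition laws of Bosma and Lenstra for \<open>\<eta>\<^sup>2 = \<zeta>\<^sup>3 + A \<zeta> + B\<close>, written in the
  Segre coordinates of a pair of points whose abscissae have been shifted by \<open>h\<close>; with
  \<open>h = a\<^sub>1 / 3\<close> the shift removes the quadratic term of the cubic. The first law vanishes exactly on
  the diagonal, the second exactly on pairs whose difference has order two, so together they cover
  all pairs.\<close>

definition shXX :: "complex \<Rightarrow> complex ^ (3 \<times> 3) \<Rightarrow> complex" where
  "shXX h v = v $ (1, 1) + h * v $ (1, 3) + h * v $ (3, 1) + h * h * v $ (3, 3)"
definition shXY :: "complex \<Rightarrow> complex ^ (3 \<times> 3) \<Rightarrow> complex" where
  "shXY h v = v $ (1, 2) + h * v $ (3, 2)"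
definition shYX :: "complex \<Rightarrow> complex ^ (3 \<times> 3) \<Rightarrow> complex" where
  "shYX h v = v $ (2, 1) + h * v $ (2, 3)"
definition shXZ :: "complex \<Rightarrow> complex ^ (3 \<times> 3) \<Rightarrow> complex" where
  "shXZ h v = v $ (1, 3) + h * v $ (3, 3)"
definition shZX :: "complex \<Rightarrow> complex ^ (3 \<times> 3) \<Rightarrow> complex" where
  "shZX h v = v $ (3, 1) + h * v $ (3, 3)"

definition law1X where
  "law1X h A B v = (shXY h v - shYX h v) * (v $ (2, 3) + v $ (3, 2)) + (shXZ h v - shZX h v) * v $ (2, 2)
     - (A * (shXZ h v + shZX h v)) * (shXZ h v - shZX h v)
     - (3 * B * (shXZ h v - shZX h v)) * v $ (3, 3)"
definition law1Y where
  "law1Y h A B v = (A * (shXZ h v + shZX h v)) * (v $ (2, 3) - v $ (3, 2))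
     + (3 * B * (v $ (2, 3) - v $ (3, 2))) * v $ (3, 3)
     - (3 * shXX h v) * (shXY h v - shYX h v) - v $ (2, 2) * (v $ (2, 3) - v $ (3, 2))
     - (A * (shXY h v - shYX h v)) * v $ (3, 3)"
definition law1Z where
  "law1Z h A B v = (3 * shXX h v) * (shXZ h v - shZX h v)
     - (v $ (2, 3) + v $ (3, 2)) * (v $ (2, 3) - v $ (3, 2))
     + (A * (shXZ h v - shZX h v)) * v $ (3, 3)"

definition law2X where
  "law2X h A B v =
     (shXY h v + shYX h v) * (v $ (2, 2) - A * (shXZ h v + shZX h v) - 3 * B * v $ (3, 3))
     - (v $ (2, 3) + v $ (3, 2)) * (A * shXX h v + 3 * B * (shXZ h v + shZX h v) - A * A * v $ (3, 3))"
definition law2Y where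
  "law2Y h A B v =
     (3 * shXX h v + A * v $ (3, 3)) * (A * shXX h v + 3 * B * (shXZ h v + shZX h v) - A * A * v $ (3, 3))
     + (v $ (2, 2) + A * (shXZ h v + shZX h v) + 3 * B * v $ (3, 3)) *
       (v $ (2, 2) - A * (shXZ h v + shZX h v) - 3 * B * v $ (3, 3))"
definition law2Z where
  "law2Z h A B v =
     (v $ (2, 3) + v $ (3, 2)) * (v $ (2, 2) + A * (shXZ h v + shZX h v) + 3 * B * v $ (3, 3))
     + (shXY h v + shYX h v) * (3 * shXX h v + A * v $ (3, 3))"

definition law1 :: "complex \<Rightarrow> complex \<Rightarrow> complex \<Rightarrow> complex ^ (3 \<times> 3) \<Rightarrow> complex ^ 3" where
  "law1 h A B v = vector [law1X h A B v - h * law1Z h A B v, law1Y h A B v, law1Z h A B v]"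
definition law2 :: "complex \<Rightarrow> complex \<Rightarrow> complex \<Rightarrow> complex ^ (3 \<times> 3) \<Rightarrow> complex ^ 3" where
  "law2 h A B v = vector [law2X h A B v - h * law2Z h A B v, law2Y h A B v, law2Z h A B v]"

lemmas sh_defs = shXX_def shXY_def shYX_def shXZ_def shZX_def
lemmas law_defs = law1X_def law1Y_def law1Z_def law2X_def law2Y_def law2Z_def

lemma homogeneous_sh: "homogeneous 1 (shXX h)" "homogeneous 1 (shXY h)" "homogeneous 1 (shYX h)"
  "homogeneous 1 (shXZ h)" "homogeneous 1 (shZX h)"
  unfolding sh_defs[abs_def] by (intro homogeneous_add homogeneous_cmult homogeneous_coord)+

lemma homogeneous_law_coords:
  "homogeneous 2 (law1X h A B)" "homogeneous 2 (law1Y h A B)" "homogeneous 2 (law1Z h A B)"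
  "homogeneous 2 (law2X h A B)" "homogeneous 2 (law2Y h A B)" "homogeneous 2 (law2Z h A B)"
  unfolding law_defs[abs_def]
  by (intro homogeneous_mult1 homogeneous_add homogeneous_diff homogeneous_cmult homogeneous_coord homogeneous_sh)+

lemma homogeneous_law: "homogeneous 2 (\<lambda>v. law1 h A B v $ j)" "homogeneous 2 (\<lambda>v. law2 h A B v $ j)"
  using exhaust_3[of j] unfolding law1_def law2_def
  by (elim disjE; simp; intro homogeneous_diff homogeneous_cmult homogeneous_law_coords)+

definition outer :: "complex ^ 3 \<Rightarrow> complex ^ 3 \<Rightarrow> complex ^ (3 \<times> 3)" where
  "outer v w = (\<chi> ij. v $ fst ij * w $ snd ij)"

lemma outer_nth [simp]: "outer v w $ (i, j) = v $ i * w $ j"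
  by (simp add: outer_def)

definition shortA :: "complex ^ 3 \<Rightarrow> complex" where "shortA a = a $ 2 - (a $ 1)^2 / 3"
definition shortB :: "complex ^ 3 \<Rightarrow> complex" where
  "shortB a = a $ 3 - a $ 1 * a $ 2 / 3 + 2 * (a $ 1)^3 / 27"

lemma law_infty_left:
  "law1 h A B (outer (vector [0, 1, 0]) w) = (- w $ 3) *s w"
  "law2 h A B (outer (vector [0, 1, 0]) w) = w $ 2 *s w"
  by (simp_all add: law1_def law2_def law_defs sh_defs vec3_eq_iff algebra_simps)

lemma law_infty_right:
  "law1 h A B (outer w (vector [0, 1, 0])) = w $ 3 *s w"
  "law2 h A B (outer w (vector [0, 1, 0])) = w $ 2 *s w"
  by (simp_all add: law1_def law2_def law_defs sh_defs vec3_eq_iff algebra_simps)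

text \<open>On a line \<open>\<eta> = l \<zeta> + m\<close> the coefficients of the cubic are polynomials in \<open>l\<close>, \<open>m\<close> and the
  three abscissae, so these are identities of polynomials in five independent variables.\<close>

lemma law_line:
  assumes "line_cuts a l m x1 x2 x3" and h: "h = a $ 1 / 3"
  defines "v \<equiv> outer (vector [x1, l * x1 + m, 1]) (vector [x2, l * x2 + m, 1])"
  shows "law1 h (shortA a) (shortB a) v =
      law1Z h (shortA a) (shortB a) v *s vector [x3, - (l * x3 + m), 1]" (is ?t1)
    and "law2 h (shortA a) (shortB a) v =
      law2Z h (shortA a) (shortB a) v *s vector [x3, - (l * x3 + m), 1]" (is ?t2)
    and "law1Z h (shortA a) (shortB a) v = (x2 - x1)^3" (is ?t3)
    and "x1 = x2 \<Longrightarrow> law2Z h (shortA a) (shortB a) v = 8 * (l * x1 + m)^3" (is "_ \<Longrightarrow> ?t4")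
proof -
  define p q n where "p = x1 + h" and "q = x2 + h" and "n = m - l * h"
  have a1: "a $ 1 = 3 * h" unfolding h by simp
  have x3: "x3 = l^2 - p - q - h"
    using assms(1) a1 unfolding line_cuts_def p_def q_def by algebra
  define s where "s = l^2 - p - q"
  have A: "shortA a = 2 * l * n + p * q + s * (p + q)"
  proof -
    have "shortA a = a $ 2 - 3 * h^2" by (simp add: shortA_def a1 power2_eq_square)
    also have "\<dots> = 2 * l * n + p * q + s * (p + q)"
      using assms(1) a1 unfolding line_cuts_def x3 p_def q_def n_def s_def by algebra
    finally show ?thesis .
  qed
  have B: "shortB a = n^2 - p * q * s"
  proof -
    have "shortB a = a $ 3 - h * a $ 2 + 2 * h^3" by (simp add: shortB_def a1 power3_eq_cube)
    also have "\<dots> = n^2 - p * q * s"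
      using assms(1) a1 unfolding line_cuts_def x3 p_def q_def n_def s_def by algebra
    finally show ?thesis .
  qed
  have v: "shXX h v = p * q" "shXY h v = p * (l * q + n)" "shYX h v = (l * p + n) * q"
     "shXZ h v = p" "shZX h v = q" "v $ (2, 2) = (l * p + n) * (l * q + n)" "v $ (2, 3) = l * p + n"
     "v $ (3, 2) = l * q + n" "v $ (3, 3) = 1"
    unfolding v_def sh_defs p_def q_def n_def by (simp_all add: algebra_simps)
  have y3: "l * x3 + m = l * s + n" unfolding x3 n_def s_def by (simp add: algebra_simps)
  have x3s: "x3 = s - h" unfolding x3 s_def by simp
  have "law1X h (shortA a) (shortB a) v = s * law1Z h (shortA a) (shortB a) v"
    unfolding law_defs v A B s_def by algebra
  moreover have "law1Y h (shortA a) (shortB a) v = - (l * s + n) * law1Z h (shortA a) (shortB a) v"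
    unfolding law_defs v A B s_def by algebra
  ultimately show ?t1 unfolding law1_def vec3_eq_iff y3 unfolding x3s by (simp add: algebra_simps)
  have "law2X h (shortA a) (shortB a) v = s * law2Z h (shortA a) (shortB a) v"
    unfolding law_defs v A B s_def by algebra
  moreover have "law2Y h (shortA a) (shortB a) v = - (l * s + n) * law2Z h (shortA a) (shortB a) v"
    unfolding law_defs v A B s_def by algebra
  ultimately show ?t2 unfolding law2_def vec3_eq_iff y3 unfolding x3s by (simp add: algebra_simps)
  have "law1Z h (shortA a) (shortB a) v = (q - p)^3"
    unfolding law_defs v A B s_def by algebra
  then show ?t3 by (simp add: p_def q_def)
  show ?t4 if "x1 = x2"
  proof -
    have "p = q" using that by (simp add: p_def q_def)
    have "law2Z h (shortA a) (shortB a) v = 8 * (l * p + n)^3"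
      unfolding law_defs v A B s_def \<open>p = q\<close> by algebra
    then show ?thesis by (simp add: p_def n_def algebra_simps)
  qed
qed

text \<open>For opposite points the equation of the curve is used to eliminate the constant term.\<close>

lemma law_opposite:
  assumes "y^2 = cubic a x" and h: "h = a $ 1 / 3"
  defines "v \<equiv> outer (vector [x, y, 1]) (vector [x, - y, 1])"
  shows "law1 h (shortA a) (shortB a) v = vector [0, 8 * y^3, 0]" (is ?t1)
    and "law2 h (shortA a) (shortB a) v = law2Y h (shortA a) (shortB a) v *s vector [0, 1, 0]" (is ?t2)
    and "y = 0 \<Longrightarrow> law2Y h (shortA a) (shortB a) v = - ((3 * x^2 + 2 * a $ 1 * x + a $ 2)^3)"
      (is "_ \<Longrightarrow> ?t3")
proof -
  define p A where "p = x + h" and "A = shortA a"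
  have a1: "a $ 1 = 3 * h" unfolding h by simp
  have A': "A = a $ 2 - 3 * h^2" by (simp add: A_def shortA_def a1 power2_eq_square)
  have "shortB a = a $ 3 - h * a $ 2 + 2 * h^3" by (simp add: shortB_def a1 power3_eq_cube)
  also have "\<dots> = y^2 - p^3 - A * p"
    using assms(1) a1 unfolding cubic_def A' p_def by algebra
  finally have B: "shortB a = y^2 - p^3 - A * p" .
  have v: "shXX h v = p * p" "shXY h v = - p * y" "shYX h v = y * p"
     "shXZ h v = p" "shZX h v = p" "v $ (2, 2) = - (y^2)" "v $ (2, 3) = y"
     "v $ (3, 2) = - y" "v $ (3, 3) = 1"
    unfolding v_def sh_defs p_def by (simp_all add: algebra_simps power2_eq_square)
  have "law1Y h A (shortB a) v = 8 * y^3"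
    unfolding law_defs v B by (simp add: algebra_simps power2_eq_square power3_eq_cube)
  then show ?t1
    unfolding law1_def vec3_eq_iff A_def[symmetric] by (simp add: law1X_def law1Z_def v)
  show ?t2 unfolding law2_def vec3_eq_iff by (simp add: law2X_def law2Z_def v)
  show ?t3 if "y = 0"
  proof -
    have "law2Y h A (shortB a) v = - ((3 * p^2 + A)^3)"
      unfolding law_defs v B \<open>y = 0\<close>
      by (simp add: algebra_simps power2_eq_square power3_eq_cube)
    moreover have "3 * p^2 + A = 3 * x^2 + 2 * a $ 1 * x + a $ 2"
      unfolding A' p_def a1 by algebra
    ultimately show ?thesis unfolding A_def by metis
  qed
qed

context elliptic_curve
begin

text \<open>The cases in which the sum of two points is computed differently. A point that may or may not be at
  infinity is given by its coordinate vector, normalised as \<open>(0, 1, 0)\<close> or \<open>(x, y, 1)\<close>.\<close>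

lemma pair_cases:
  assumes "P \<in> E" "Q \<in> E"
  obtains (left) w where "P = curve_infty" "Q = abs_proj w" "w \<noteq> 0" "w = vector [0, 1, 0] \<or> w $ 3 = 1"
  | (right) w where "Q = curve_infty" "P = abs_proj w" "w \<noteq> 0" "w = vector [0, 1, 0] \<or> w $ 3 = 1"
  | (opposite) x y where "P = cp2 x y 1" "Q = cp2 x (- y) 1" "y^2 = cubic a x"
  | (line) l m x1 x2 x3 where "line_cuts a l m x1 x2 x3" "P = cp2 x1 (l * x1 + m) 1"
      "Q = cp2 x2 (l * x2 + m) 1"
proof -
  have w: "\<exists>w. R = abs_proj w \<and> w \<noteq> 0 \<and> (w = vector [0, 1, 0] \<or> w $ 3 = 1)" if "R \<in> E" for R
    using that
  proof (cases rule: curve_points_cases)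
    case infty
    then show ?thesis
      by (intro exI[of _ "vector [0, 1, 0]"]) (auto simp: curve_infty_def cp2_def vec3_eq_iff)
  next
    case (affine x y)
    then show ?thesis
      by (intro exI[of _ "vector [x, y, 1]"]) (auto simp: cp2_def vec3_eq_iff)
  qed
  show thesis
    using assms(1)
  proof (cases rule: curve_points_cases)
    case infty
    then show ?thesis using left w[OF assms(2)] by blast
  next
    case P: (affine x1 y1)
    show ?thesis
      using assms(2)
    proof (cases rule: curve_points_cases)
      case infty
      then show ?thesis using right w[OF assms(1)] by blast
    next
      case Q: (affine x2 y2)
      show ?thesis
      proof (cases "x1 = x2 \<and> y1 = - y2")
        case True
        then show ?thesis using P Q opposite[of x1 y1] by simp
      next
        case False
        then obtain l m x3 where "line_cuts a l m x1 x2 x3" "y1 = l * x1 + m" "y2 = l * x2 + m"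
          using line_cuts_exists P Q by metis
        then show ?thesis using P Q line by metis
      qed
    qed
  qed
qed

definition "sA = shortA a"
definition "sB = shortB a"
definition "sh = a $ 1 / 3"

text \<open>A coordinate vector of a point of the product is a multiple of an outer product, and the laws are
  homogeneous, so it suffices to evaluate them on normalised coordinate vectors.\<close>

lemma addition_law_correct:
  assumes G: "G = law1 sh sA sB \<or> G = law2 sh sA sB"
    and "P \<in> E" "Q \<in> E"
    and v: "v \<noteq> 0" "abs_proj v = segre P Q" and "G v \<noteq> 0"
  shows "curve_add a P Q = abs_proj (G v)"
proof -
  have scale: "G (c *s u) = c^2 *s G u" for c u
    using G homogeneous_scale[OF homogeneous_law(1)] homogeneous_scale[OF homogeneous_law(2)]
    by (auto simp: vec_eq_iff)
  have *: "curve_add a P Q = abs_proj (G v)"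
    if "P = abs_proj v1" "Q = abs_proj v2" "v1 \<noteq> 0" "v2 \<noteq> 0"
      "G (outer v1 v2) = k *s w" "w \<noteq> 0" "curve_add a P Q = abs_proj w" for v1 v2 k w
  proof -
    have "abs_proj v = segre (abs_proj v1) (abs_proj v2)" using v(2) that(1,2) by simp
    from segre_abs[OF v(1) this that(3,4)]
    obtain c where c: "c \<noteq> 0" "\<And>i j. v $ (i, j) = c * (v1 $ i * v2 $ j)" by blast
    have "v = c *s outer v1 v2" using c by (auto simp: vec_eq_iff outer_def)
    then have Gv: "G v = (c^2 * k) *s w" using scale that(5) by (simp add: vector_smult_assoc)
    then have "c^2 * k \<noteq> 0" using assms(6) by auto
    then show ?thesis using Gv that(6,7) by (simp add: abs_proj_scale)
  qed
  have inf: "curve_infty = abs_proj (vector [0, 1, 0])" "(vector [0, 1, 0] :: complex ^ 3) \<noteq> 0"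
    by (simp_all add: curve_infty_def cp2_def vec3_eq_iff)
  have aff: "cp2 x y 1 = abs_proj (vector [x, y, 1])" "(vector [x, y, 1] :: complex ^ 3) \<noteq> 0" for x y
    by (simp_all add: cp2_def vec3_eq_iff)
  show ?thesis
    using assms(2,3)
  proof (cases rule: pair_cases)
    case (left w)
    have "\<exists>k. G (outer (vector [0, 1, 0]) w) = k *s w" using G law_infty_left by metis
    then show ?thesis using * left inf curve_add_infty(1) by metis
  next
    case (right w)
    have "\<exists>k. G (outer w (vector [0, 1, 0])) = k *s w" using G law_infty_right by metis
    then show ?thesis using * right inf curve_add_infty(2) by metis
  next
    case (opposite x y)
    have "vector [0, 8 * y^3, 0] = (8 * y^3) *s (vector [0, 1, 0] :: complex ^ 3)"
      by (simp add: vec3_eq_iff)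
    then have "\<exists>k. G (outer (vector [x, y, 1]) (vector [x, - y, 1])) = k *s vector [0, 1, 0]"
      using G law_opposite(1,2)[OF opposite(3) sh_def] unfolding sA_def sB_def by metis
    moreover have "curve_add a P Q = curve_infty"
      using curve_add_cneg[of P] assms(2) opposite by simp
    ultimately show ?thesis using * opposite aff inf by metis
  next
    case (line l m x1 x2 x3)
    have "\<exists>k. G (outer (vector [x1, l * x1 + m, 1]) (vector [x2, l * x2 + m, 1]))
        = k *s vector [x3, - (l * x3 + m), 1]"
      using G law_line(1,2)[OF line(1) sh_def] unfolding sA_def sB_def by metis
    then show ?thesis using * line aff curve_add_line_cuts[OF line(1)] by metis
  qed
qed

text \<open>The first law takes care of all pairs with different points. At the affine points of the
  diagonal the second law has the last coordinate \<open>8 \<eta>\<^sup>3\<close>, and at points with \<open>\<eta> = 0\<close> its middle coordinate is \<open>- f'(\<zeta>)\<^sup>3\<close>.\<close>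

lemma addition_laws_complete:
  assumes "P \<in> E" "Q \<in> E" and v: "v \<noteq> 0" "abs_proj v = segre P Q"
  shows "law1 sh sA sB v \<noteq> 0 \<or> law2 sh sA sB v \<noteq> 0"
proof -
  have *: "law1 sh sA sB v \<noteq> 0 \<or> law2 sh sA sB v \<noteq> 0"
    if "P = abs_proj v1" "Q = abs_proj v2" "v1 \<noteq> 0" "v2 \<noteq> 0"
      "law1 sh sA sB (outer v1 v2) \<noteq> 0 \<or> law2 sh sA sB (outer v1 v2) \<noteq> 0" for v1 v2
  proof -
    have "abs_proj v = segre (abs_proj v1) (abs_proj v2)" using v(2) that(1,2) by simp
    from segre_abs[OF v(1) this that(3,4)]
    obtain c where c: "c \<noteq> 0" "\<And>i j. v $ (i, j) = c * (v1 $ i * v2 $ j)" by blast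
    have ve: "v = c *s outer v1 v2" using c by (auto simp: vec_eq_iff outer_def)
    then have "law1 sh sA sB v = c^2 *s law1 sh sA sB (outer v1 v2)"
      "law2 sh sA sB v = c^2 *s law2 sh sA sB (outer v1 v2)"
      unfolding ve using homogeneous_scale[OF homogeneous_law(1)] homogeneous_scale[OF homogeneous_law(2)]
      by (auto simp: vec_eq_iff)
    then show ?thesis using that(5) c by auto
  qed
  have inf: "curve_infty = abs_proj (vector [0, 1, 0])" "(vector [0, 1, 0] :: complex ^ 3) \<noteq> 0"
    by (simp_all add: curve_infty_def cp2_def vec3_eq_iff)
  have aff: "cp2 x y 1 = abs_proj (vector [x, y, 1])" "(vector [x, y, 1] :: complex ^ 3) \<noteq> 0" for x y
    by (simp_all add: cp2_def vec3_eq_iff)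
  show ?thesis
    using assms(1,2)
  proof (cases rule: pair_cases)
    case (left w)
    have "law1 sh sA sB (outer (vector [0, 1, 0]) w) \<noteq> 0 \<or> law2 sh sA sB (outer (vector [0, 1, 0]) w) \<noteq> 0"
      unfolding law_infty_left using left(3,4) by auto
    then show ?thesis using * left inf by metis
  next
    case (right w)
    have "law1 sh sA sB (outer w (vector [0, 1, 0])) \<noteq> 0 \<or> law2 sh sA sB (outer w (vector [0, 1, 0])) \<noteq> 0"
      unfolding law_infty_right using right(3,4) by auto
    then show ?thesis using * right inf by metis
  next
    case (opposite x y)
    let ?v = "outer (vector [x, y, 1]) (vector [x, - y, 1])"
    have "law1 sh sA sB ?v \<noteq> 0 \<or> law2 sh sA sB ?v \<noteq> 0"
    proof (cases "y = 0")
      case False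
      then have "law1 sh sA sB ?v \<noteq> 0"
        unfolding sA_def sB_def law_opposite(1)[OF opposite(3) sh_def] by (simp add: vec3_eq_iff)
      then show ?thesis ..
    next
      case True
      then have "3 * x^2 + 2 * a $ 1 * x + a $ 2 \<noteq> 0" using no_double_root[of x] opposite(3) by auto
      then have "law2Y sh sA sB ?v \<noteq> 0"
        using law_opposite(3)[OF opposite(3) sh_def True] unfolding sA_def sB_def by simp
      then have "law2 sh sA sB ?v \<noteq> 0"
        unfolding sA_def sB_def law_opposite(2)[OF opposite(3) sh_def] by (simp add: vec3_eq_iff)
      then show ?thesis ..
    qed
    then show ?thesis using * opposite aff by metis
  next
    case (line l m x1 x2 x3)
    let ?v = "outer (vector [x1, l * x1 + m, 1]) (vector [x2, l * x2 + m, 1])"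
    have "law1 sh sA sB ?v \<noteq> 0 \<or> law2 sh sA sB ?v \<noteq> 0"
    proof (cases "x1 = x2")
      case False
      then have "law1Z sh sA sB ?v \<noteq> 0" using law_line(3)[OF line(1) sh_def] unfolding sA_def sB_def by simp
      then have "law1 sh sA sB ?v \<noteq> 0" by (auto simp: law1_def vec3_eq_iff)
      then show ?thesis ..
    next
      case True
      have "l * x1 + m \<noteq> 0"
      proof
        assume "l * x1 + m = 0"
        moreover from this have "l * x2 + m = 0" using True by simp
        ultimately show False using line_cuts_not_opposite[OF line(1)] True by simp
      qed
      then have "law2Z sh sA sB ?v \<noteq> 0"
        using law_line(4)[OF line(1) sh_def True] unfolding sA_def sB_def by simp
      then have "law2 sh sA sB ?v \<noteq> 0" by (auto simp: law2_def vec3_eq_iff)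
      then show ?thesis ..
    qed
    then show ?thesis using * line aff by metis
  qed
qed

lemma regular_curve_add:
  "\<exists>m. regular_map (variety_prod E E) E m \<and> (\<forall>x\<in>E. \<forall>y\<in>E. m (segre x y) = curve_add a x y)"
proof -
  define m where "m p = (let (x, y) = SOME (x, y). p = segre x y in curve_add a x y)"
    for p :: "(3 \<times> 3) proj"
  have m: "m (segre x y) = curve_add a x y" for x y
  proof -
    have "(SOME (x', y'). segre x y = segre x' y') = (x, y)"
      by (rule some_equality) (use segre_inj in auto)
    then show ?thesis by (simp add: m_def)
  qed
  have "regular_map (variety_prod E E) E m"
  proof (rule regular_mapI)
    show "m ` variety_prod E E \<subseteq> E" using m curve_add_closed by (auto simp: variety_prod_def)
  next
    fix p assume "p \<in> variety_prod E E"
    then obtain x y where p: "p = segre x y" "x \<in> E" "y \<in> E" by (auto simp: variety_prod_def)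
    then have "law1 sh sA sB (rep_proj p) \<noteq> 0 \<or> law2 sh sA sB (rep_proj p) \<noteq> 0"
      using addition_laws_complete[of x y "rep_proj p"] by simp
    then obtain G where G: "G = law1 sh sA sB \<or> G = law2 sh sA sB" "G (rep_proj p) \<noteq> 0" by blast
    have "\<forall>j. homogeneous 2 (\<lambda>v. G v $ j)" using G(1) homogeneous_law by blast
    moreover have "m (abs_proj v) = abs_proj (G v)"
      if "v \<noteq> 0" "abs_proj v \<in> variety_prod E E" "G v \<noteq> 0" for v
      using that m addition_law_correct[OF G(1)] by (auto simp: variety_prod_def)
    ultimately show "\<exists>d (G :: complex ^ (3 \<times> 3) \<Rightarrow> complex ^ 3).
           (\<forall>j. homogeneous d (\<lambda>v. G v $ j)) \<and> G (rep_proj p) \<noteq> 0 \<and>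
           (\<forall>v. v \<noteq> 0 \<and> abs_proj v \<in> variety_prod E E \<and> G v \<noteq> 0 \<longrightarrow> m (abs_proj v) = abs_proj (G v))"
      using G(2) by (intro exI[of _ 2] exI[of _ G]) auto
  qed
  then show ?thesis using m by blast
qed

end

section \<open>The curve modulo the involution\<close>

context elliptic_curve
begin

lemma curve_cone:
  assumes "v \<noteq> 0" "abs_proj v \<in> E"
  obtains (infty) "v $ 1 = 0" "v $ 3 = 0" "v $ 2 \<noteq> 0" "abs_proj v = curve_infty"
  | (affine) "v $ 3 \<noteq> 0" "abs_proj v = cp2 (v $ 1 / v $ 3) (v $ 2 / v $ 3) 1"
      "(v $ 2 / v $ 3)^2 = cubic a (v $ 1 / v $ 3)"
proof -
  show thesis
    using assms(2)
  proof (cases rule: curve_points_cases)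
    case infty
    have "(vector [0, 1, 0] :: complex ^ 3) \<noteq> 0" by (simp add: vec3_eq_iff)
    then obtain c where c: "c \<noteq> 0" "v = c *s vector [0, 1, 0]"
      using abs_proj_eq_iff[of "vector [0, 1, 0]" v] assms(1) infty by (auto simp: curve_infty_def cp2_def)
    show ?thesis by (rule that(1)) (use c infty in auto)
  next
    case (affine x y)
    have "(vector [x, y, 1] :: complex ^ 3) \<noteq> 0" by (simp add: vec3_eq_iff)
    then obtain c where c: "c \<noteq> 0" "v = c *s vector [x, y, 1]"
      using abs_proj_eq_iff[of "vector [x, y, 1]" v] assms(1) affine by (auto simp: cp2_def)
    show ?thesis by (rule that(2)) (use c affine in auto)
  qed
qed

lemma cneg_abs_proj:
  assumes "v \<noteq> 0" "abs_proj v \<in> E"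
  shows "cneg (abs_proj v) = abs_proj (vector [v $ 1, - v $ 2, v $ 3])"
  using assms
proof (cases rule: curve_cone)
  case infty
  then have "abs_proj (vector [v $ 1, - v $ 2, v $ 3]) = cp2 (- v $ 2 * 0) (- v $ 2 * 1) (- v $ 2 * 0)"
    by (simp add: cp2_def)
  also have "\<dots> = curve_infty"
    unfolding curve_infty_def by (rule cp2_scale) (use infty in auto)
  finally show ?thesis using infty by simp
next
  case affine
  have "abs_proj (vector [v $ 1, - v $ 2, v $ 3]) =
      cp2 (v $ 3 * (v $ 1 / v $ 3)) (v $ 3 * (- (v $ 2 / v $ 3))) (v $ 3 * 1)"
    using affine by (simp add: cp2_def)
  also have "\<dots> = cp2 (v $ 1 / v $ 3) (- (v $ 2 / v $ 3)) 1"
    by (rule cp2_scale) (use affine in auto)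
  finally show ?thesis using affine by simp
qed

lemma regular_cneg: "regular_map E E cneg"
proof (rule regular_map_linear[where G = "\<lambda>v. vector [v $ 1, - v $ 2, v $ 3]"])
  show "homogeneous 1 (\<lambda>v::complex^3. (vector [v $ 1, - v $ 2, v $ 3] :: complex ^ 3) $ j)" for j :: 3
    using exhaust_3[of j]
    by (elim disjE; simp; intro homogeneous_uminus homogeneous_coord[simplified])
  show "vector [v $ 1, - v $ 2, v $ 3] \<noteq> (0 :: complex ^ 3) \<and>
      cneg (abs_proj v) = abs_proj (vector [v $ 1, - v $ 2, v $ 3])"
    if "v \<noteq> 0" "abs_proj v \<in> E" for v
    using that by (simp add: cneg_abs_proj vec3_eq_iff)
qed auto

lemma regular_map_cong:
  fixes f g :: "('a :: finite) proj \<Rightarrow> ('b :: finite) proj"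
  assumes "regular_map X Y f" "\<And>x. x \<in> X \<Longrightarrow> f x = g x"
  shows "regular_map X Y g"
proof -
  have e: "(\<forall>v. v \<noteq> 0 \<and> abs_proj v \<in> X - Z \<longrightarrow> G v \<noteq> 0 \<and> g (abs_proj v) = abs_proj (G v)) \<longleftrightarrow>
      (\<forall>v. v \<noteq> 0 \<and> abs_proj v \<in> X - Z \<longrightarrow> G v \<noteq> 0 \<and> f (abs_proj v) = abs_proj (G v))"
    for Z and G :: "complex ^ 'a \<Rightarrow> complex ^ 'b"
    using assms(2) by auto
  have "g ` X = f ` X" using assms(2) by auto
  then show ?thesis using assms(1) unfolding regular_map_def e by simp
qed

lemma quasi_projective_curve: "quasi_projective E"
proof -
  define F where "F v = v $ 2 * v $ 2 * v $ 3 - v $ 1 * v $ 1 * v $ 1 - a $ 1 * (v $ 1 * v $ 1 * v $ 3)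
     - a $ 2 * (v $ 1 * v $ 3 * v $ 3) - a $ 3 * (v $ 3 * v $ 3 * v $ 3)" for v :: "complex ^ 3"
  have m3: "homogeneous 3 (\<lambda>v :: complex ^ 3. v $ i * v $ j * v $ k)" for i j k
  proof -
    have "homogeneous (2 + 1) (\<lambda>v :: complex ^ 3. v $ i * v $ j * v $ k)"
      by (intro homogeneous_mult homogeneous_mult1 homogeneous_coord)
    then show ?thesis by simp
  qed
  have hF: "homogeneous 3 F"
    unfolding F_def[abs_def] by (intro homogeneous_diff homogeneous_cmult m3)
  have "E = {p. F (rep_proj p) = 0}"
  proof (intro equalityI subsetI CollectI)
    fix p assume "p \<in> E"
    then have pE: "abs_proj (rep_proj p) \<in> E" by simp
    have "F (rep_proj p) = 0"
      using rep_proj_nonzero[of p] pE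
    proof (cases rule: curve_cone)
      case affine
      let ?v = "rep_proj p"
      have "F ?v = (?v $ 3)^3 * ((?v $ 2 / ?v $ 3)^2 - cubic a (?v $ 1 / ?v $ 3))"
        using affine(1) by (simp add: F_def cubic_def field_simps power2_eq_square power3_eq_cube)
      then show ?thesis using affine by simp
    qed (auto simp: F_def)
    then show "F (rep_proj p) = 0" .
  next
    fix p assume "p \<in> {p. F (rep_proj p) = 0}"
    then have F: "F (rep_proj p) = 0" by simp
    let ?v = "rep_proj p"
    show "p \<in> E"
    proof (cases "?v $ 3 = 0")
      case True
      then have "?v $ 1 = 0" using F by (simp add: F_def)
      moreover from this have "?v $ 2 \<noteq> 0" using True rep_proj_nonzero[of p] by (auto simp: vec3_eq_iff)
      ultimately have "p = curve_infty"
        using cp2_rep[of p] cp2_scale[of "?v $ 2" 0 1 0] True by (simp add: curve_infty_def)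
      then show ?thesis by simp
    next
      case False
      have "F ?v = (?v $ 3)^3 * ((?v $ 2 / ?v $ 3)^2 - cubic a (?v $ 1 / ?v $ 3))"
        using False by (simp add: F_def cubic_def field_simps power2_eq_square power3_eq_cube)
      then have "(?v $ 2 / ?v $ 3)^2 = cubic a (?v $ 1 / ?v $ 3)" using F False by simp
      moreover have "p = cp2 (?v $ 1 / ?v $ 3) (?v $ 2 / ?v $ 3) 1"
        using cp2_rep[of p] cp2_scale[of "?v $ 3" "?v $ 1 / ?v $ 3" "?v $ 2 / ?v $ 3" 1] False by simp
      ultimately show ?thesis by (metis affine_in_curve)
    qed
  qed
  then have "zariski_closed E"
    unfolding zariski_closed_def using hF by (intro exI[of _ "{F}"]) auto
  then show ?thesis unfolding quasi_projective_def
    using zariski_closed_empty by (intro exI[of _ E] exI[of _ "{}"]) simp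
qed

lemma algebraic_group_curve: "algebraic_group (curve_group a)"
proof -
  interpret comm_group "curve_group a" by (rule comm_group_curve)
  have "regular_map E E (\<lambda>x. inv\<^bsub>curve_group a\<^esub> x)"
    by (rule regular_map_cong[OF regular_cneg]) simp
  then show ?thesis
    unfolding algebraic_group_def using regular_curve_add quasi_projective_curve is_group by simp
qed

lemma sigma_eq: "sigma a = restrict cneg E"
  by (auto simp: sigma_def cneg_def)

lemma cneg_curve_add:
  assumes "P \<in> E" "Q \<in> E"
  shows "cneg (curve_add a P Q) = curve_add a (cneg P) (cneg Q)"
proof -
  interpret comm_group "curve_group a" by (rule comm_group_curve)
  show ?thesis using inv_mult[of P Q] assms by (simp add: curve_add_closed)
qed

definition "H = generate (AutoGroup (curve_group a)) {sigma a}"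

lemma sigma_in_AutoGroup: "sigma a \<in> carrier (AutoGroup (curve_group a))"
proof -
  have "bij_betw cneg E E"
    by (rule bij_betw_byWitness[where f' = cneg]) (auto simp: cneg_cneg)
  then have "bij_betw (sigma a) E E" unfolding sigma_eq by (simp cong: bij_betw_cong)
  then show ?thesis
    unfolding AutoGroup_def auto_def Bij_def hom_def
    by (auto simp: sigma_eq cneg_curve_add curve_add_closed)
qed

lemma H_eq: "H = {restrict id E, sigma a}"
proof -
  interpret comm_group "curve_group a" by (rule comm_group_curve)
  interpret A: group "AutoGroup (curve_group a)" by (rule AutoGroup)
  have one: "\<one>\<^bsub>AutoGroup (curve_group a)\<^esub> = restrict id E"
    by (simp add: AutoGroup_def BijGroup_def id_def)
  have Bij: "f \<in> Bij E" if "f \<in> carrier (AutoGroup (curve_group a))" for f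
    using that by (simp add: AutoGroup_def auto_def)
  have ss: "sigma a \<otimes>\<^bsub>AutoGroup (curve_group a)\<^esub> sigma a = \<one>\<^bsub>AutoGroup (curve_group a)\<^esub>"
    unfolding one using Bij[OF sigma_in_AutoGroup]
    by (auto simp: AutoGroup_def BijGroup_def compose_def sigma_eq cneg_cneg fun_eq_iff)
  then have inv: "inv\<^bsub>AutoGroup (curve_group a)\<^esub> sigma a = sigma a"
    using sigma_in_AutoGroup by (intro A.inv_equality)
  have "x \<in> {\<one>\<^bsub>AutoGroup (curve_group a)\<^esub>, sigma a}" if "x \<in> H" for x
    using that unfolding H_def
  proof (induction rule: generate.induct)
    case (eng h1 h2)
    then show ?case using ss sigma_in_AutoGroup by auto
  qed (use inv in auto)
  moreover have "{\<one>\<^bsub>AutoGroup (curve_group a)\<^esub>, sigma a} \<subseteq> H"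
    unfolding H_def by (auto intro: generate.one generate.incl)
  ultimately show ?thesis unfolding one by blast
qed

lemma subgroup_H: "subgroup H (AutoGroup (curve_group a))"
proof -
  interpret comm_group "curve_group a" by (rule comm_group_curve)
  interpret A: group "AutoGroup (curve_group a)" by (rule AutoGroup)
  show ?thesis unfolding H_def
    by (rule A.generate_is_subgroup) (use sigma_in_AutoGroup in simp)
qed

text \<open>A cubic vanishing at \<open>0, 1, -1\<close> is \<open>x\<^sup>3 - x\<close>, which does not vanish at \<open>2\<close>.\<close>

lemma id_neq_sigma: "restrict id E \<noteq> sigma a"
proof -
  have "\<exists>x. cubic a x \<noteq> 0"
  proof (rule ccontr)
    assume "\<nexists>x. cubic a x \<noteq> 0"
    then have "cubic a 0 = 0" "cubic a 1 = 0" "cubic a (- 1) = 0" "cubic a 2 = 0" by auto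
    moreover have "6 = cubic a 2 - 3 * cubic a 1 - cubic a (- 1) + 3 * cubic a 0"
      by (simp add: cubic_def)
    ultimately have "(6 :: complex) = 0" by simp
    then show False by simp
  qed
  then obtain x where x: "cubic a x \<noteq> 0" ..
  define y where "y = csqrt (cubic a x)"
  have y: "y^2 = cubic a x" "y \<noteq> 0" using x by (auto simp: y_def)
  then have "sigma a (cp2 x y 1) \<noteq> cp2 x y 1" by (simp add: sigma_eq)
  moreover have "restrict id E (cp2 x y 1) = cp2 x y 1" using y by simp
  ultimately show ?thesis by metis
qed

lemma card_H: "finite H" "card H = 2"
  using id_neq_sigma by (auto simp: H_eq)

lemma mset_set_H: "mset_set H = {#restrict id E, sigma a#}"
  unfolding H_eq using id_neq_sigma by (simp add: add_mset_commute)

lemma regular_H: "h \<in> H \<Longrightarrow> regular_map E E h"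
proof -
  assume "h \<in> H"
  moreover have "regular_map E E (restrict id E)"
    by (rule regular_map_linear[where G = id]) (auto intro!: homogeneous_coord[simplified])
  moreover have "regular_map E E (sigma a)"
    by (rule regular_map_cong[OF regular_cneg]) (simp add: sigma_eq)
  ultimately show ?thesis unfolding H_eq by blast
qed

lemma zeta_map_simps [simp]: "zeta_map curve_infty = infty" "zeta_map (cp2 x y 1) = cp1 x 1"
  by (simp_all add: zeta_map_def)

lemma zeta_map_cneg: "P \<in> E \<Longrightarrow> zeta_map (cneg P) = zeta_map P"
  by (erule curve_points_cases) auto

lemma zeta_map_eq_iff:
  assumes "P \<in> E" "Q \<in> E"
  shows "zeta_map P = zeta_map Q \<longleftrightarrow> Q = P \<or> Q = cneg P"
  using assms by (elim curve_points_cases) (auto, metis power2_eq_iff)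

lemma zeta_map_surj: "zeta_map ` E = UNIV"
proof -
  have "x \<in> zeta_map ` E" for x
    using cp1_affine_or_infty[of x]
  proof
    assume "x = infty"
    then show ?thesis by (intro image_eqI[of _ _ curve_infty]) auto
  next
    assume "\<exists>z. x = cp1 z 1"
    then obtain z where "x = cp1 z 1" ..
    then show ?thesis by (intro image_eqI[of _ _ "cp2 z (csqrt (cubic a z)) 1"]) auto
  qed
  then show ?thesis by auto
qed

text \<open>Near the point at infinity, the equation of the curve allows \<open>X / Z\<close> to be replaced by
  \<open>(Y\<^sup>2 - a\<^sub>1 X\<^sup>2 - a\<^sub>2 X Z - a\<^sub>3 Z\<^sup>2) / X\<^sup>2\<close>.\<close>

lemma regular_zeta_map: "regular_map E UNIV zeta_map"
proof (rule regular_mapI)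
  fix p assume "p \<in> E"
  define G1 :: "complex ^ 3 \<Rightarrow> complex ^ 2" where "G1 v = vector [v $ 1, v $ 3]" for v
  define G2 :: "complex ^ 3 \<Rightarrow> complex ^ 2" where
    "G2 v = vector [v $ 2 * v $ 2 - a $ 1 * (v $ 1 * v $ 1) - a $ 2 * (v $ 1 * v $ 3) - a $ 3 * (v $ 3 * v $ 3),
       v $ 1 * v $ 1]" for v
  show "\<exists>d (G :: complex ^ 3 \<Rightarrow> complex ^ 2).
           (\<forall>j. homogeneous d (\<lambda>v. G v $ j)) \<and> G (rep_proj p) \<noteq> 0 \<and>
           (\<forall>v. v \<noteq> 0 \<and> abs_proj v \<in> E \<and> G v \<noteq> 0 \<longrightarrow> zeta_map (abs_proj v) = abs_proj (G v))"
  proof (cases "p = curve_infty")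
    case False
    have "homogeneous 1 (\<lambda>v. G1 v $ j)" for j
      using exhaust_2[of j] unfolding G1_def
      by (elim disjE; simp; intro homogeneous_coord[simplified])
    moreover have "zeta_map (abs_proj v) = abs_proj (G1 v)"
      if "v \<noteq> 0" "abs_proj v \<in> E" "G1 v \<noteq> 0" for v
      using that(1,2)
    proof (cases rule: curve_cone)
      case infty
      then show ?thesis using that(3) by (simp add: G1_def vec2_eq_iff)
    next
      case affine
      then show ?thesis by (simp add: abs_proj_cp1 G1_def cp1_eq_iff)
    qed
    moreover have "G1 (rep_proj p) \<noteq> 0"
      using rep_proj_nonzero[of p]
      by (cases rule: curve_cone) (use \<open>p \<in> E\<close> False in \<open>auto simp: G1_def vec2_eq_iff\<close>)
    ultimately show ?thesis by blast
  next
    case True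
    have "homogeneous 2 (\<lambda>v. G2 v $ j)" for j
      using exhaust_2[of j] unfolding G2_def
      by (elim disjE; simp; intro homogeneous_diff homogeneous_cmult homogeneous_mult1[simplified] homogeneous_coord[simplified])
    moreover have "zeta_map (abs_proj v) = abs_proj (G2 v)"
      if "v \<noteq> 0" "abs_proj v \<in> E" "G2 v \<noteq> 0" for v
      using that(1,2)
    proof (cases rule: curve_cone)
      case infty
      then show ?thesis by (simp add: abs_proj_cp1 G2_def infty_def cp1_eq_iff)
    next
      case affine
      let ?x = "v $ 1" and ?y = "v $ 2" and ?z = "v $ 3"
      have "?x * (?x * ?x) = ?z * (?y * ?y - a $ 1 * (?x * ?x) - a $ 2 * (?x * ?z) - a $ 3 * (?z * ?z))"
        using affine(1,3) by (simp add: cubic_def field_simps power2_eq_square power3_eq_cube)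
      then have "?x / ?z * (?x * ?x) = ?y * ?y - a $ 1 * (?x * ?x) - a $ 2 * (?x * ?z) - a $ 3 * (?z * ?z)"
        using affine(1) by (simp add: field_simps)
      moreover have "(?y * ?y - a $ 1 * (?x * ?x) - a $ 2 * (?x * ?z) - a $ 3 * (?z * ?z), ?x * ?x) \<noteq> (0, 0)"
        using that(3) by (auto simp: G2_def vec2_eq_iff)
      ultimately show ?thesis using affine unfolding abs_proj_cp1[of "G2 v"]
        by (simp add: G2_def cp1_eq_iff)
    qed
    moreover have "G2 (rep_proj p) \<noteq> 0"
      using rep_proj_nonzero[of p]
      by (cases rule: curve_cone) (use \<open>p \<in> E\<close> True in \<open>auto simp: G2_def vec2_eq_iff\<close>)
    ultimately show ?thesis by blast
  qed
qed simp

end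

section \<open>Binary quadratic forms and the multiplications\<close>

lemma linear_form_zeros:
  assumes "(p1, p2) \<noteq> (0, 0)"
  shows "[:- p1, p2:] \<noteq> (0 :: complex poly)"
    and "image_mset (\<lambda>z. cp1 z 1) (proots [:- p1, p2:]) + replicate_mset (1 - degree [:- p1, p2:]) infty
      = {#cp1 p1 p2#}"
proof -
  show "[:- p1, p2:] \<noteq> (0 :: complex poly)" using assms by auto
  show "image_mset (\<lambda>z. cp1 z 1) (proots [:- p1, p2:]) + replicate_mset (1 - degree [:- p1, p2:]) infty
      = {#cp1 p1 p2#}"
  proof (cases "p2 = 0")
    case True
    then show ?thesis using assms by (simp add: infty_def cp1_eq_iff)
  next
    case False
    then have "[:- p1, p2:] = smult p2 [:- (p1 / p2), 1:]" by simp
    then have "proots [:- p1, p2:] = {#p1 / p2#}"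
      using False by (metis proots_smult proots_linear_factor minus_minus)
    then show ?thesis using False assms by (simp add: cp1_eq_iff)
  qed
qed

lemma binary_form_zeros_split:
  assumes "k \<noteq> 0" "(p1, p2) \<noteq> (0, 0)" "(q1, q2) \<noteq> (0, 0)"
  shows "binary_form_zeros 2 (smult k ([:- p1, p2:] * [:- q1, q2:])) = {#cp1 p1 p2, cp1 q1 q2#}"
proof -
  let ?p = "[:- p1, p2:]" and ?q = "[:- q1, q2:]"
  have nz: "?p \<noteq> 0" "?q \<noteq> 0" using assms linear_form_zeros(1) by blast+
  then have "degree (smult k (?p * ?q)) = degree ?p + degree ?q"
    using assms(1) by (simp add: degree_mult_eq del: mult_pCons_left mult_pCons_right)
  moreover have "degree ?p \<le> 1" "degree ?q \<le> 1" by auto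
  ultimately have d: "2 - degree (smult k (?p * ?q)) = (1 - degree ?p) + (1 - degree ?q)" by linarith
  have pr: "proots (smult k (?p * ?q)) = proots ?p + proots ?q"
    using nz assms(1) by (simp add: proots_mult del: mult_pCons_left mult_pCons_right)
  have rp: "replicate_mset (m + n) x = replicate_mset m x + replicate_mset n x" for m n and x :: "2 proj"
    by (simp add: multiset_eq_iff)
  have "binary_form_zeros 2 (smult k (?p * ?q)) =
     (image_mset (\<lambda>z. cp1 z 1) (proots ?p) + replicate_mset (1 - degree ?p) infty) +
     (image_mset (\<lambda>z. cp1 z 1) (proots ?q) + replicate_mset (1 - degree ?q) infty)"
    unfolding binary_form_zeros_def d pr rp image_mset_union by (simp only: ac_simps)
  then show ?thesis
    unfolding linear_form_zeros(2)[OF assms(2)] linear_form_zeros(2)[OF assms(3)] by simp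
qed

lemma binary_form_zeros_smult: "c \<noteq> 0 \<Longrightarrow> binary_form_zeros n (smult c q) = binary_form_zeros n q"
  by (simp add: binary_form_zeros_def)

lemma quadratic_form_splits:
  fixes q :: "complex poly"
  assumes "q \<noteq> 0" "degree q \<le> 2"
  obtains k p1 p2 q1 q2 where "k \<noteq> 0" "(p1, p2) \<noteq> (0, 0)" "(q1, q2) \<noteq> (0, 0)"
    "q = smult k ([:- p1, p2:] * [:- q1, q2:])"
proof -
  define c0 c1 c2 where "c0 = coeff q 0" and "c1 = coeff q 1" and "c2 = coeff q 2"
  have q: "q = [:c0, c1, c2:]"
  proof (rule poly_eqI)
    fix n :: nat
    consider "n = 0" | "n = 1" | "n = 2" | "n > 2" by linarith
    then show "coeff q n = coeff [:c0, c1, c2:] n"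
      using assms(2)
      by cases (auto simp: c0_def c1_def c2_def coeff_eq_0 coeff_pCons numeral_2_eq_2 split: nat.split)
  qed
  consider "c2 \<noteq> 0" | "c2 = 0" "c1 \<noteq> 0" | "c2 = 0" "c1 = 0" by blast
  then show thesis
  proof cases
    case 1
    have "\<not> constant (poly q)" using 1 by (simp add: constant_degree q)
    then obtain r where "poly q r = 0" using fundamental_theorem_of_algebra by blast
    then have c0: "c0 = - r * (c1 + c2 * r)" by (simp add: q eq_neg_iff_add_eq_0 algebra_simps)
    show ?thesis using 1 by (intro that[of 1 r 1 "- (c1 + c2 * r)" c2]) (auto simp: q c0 algebra_simps)
  next
    case 2
    then show ?thesis by (intro that[of 1 "-1" 0 "- c0" c1]) (auto simp: q)
  next
    case 3
    then show ?thesis using assms(1) by (intro that[of c0 "-1" 0 "-1" 0]) (auto simp: q)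
  qed
qed

lemma chow_form_pair:
  assumes "(p1, p2) \<noteq> (0, 0)" "(q1, q2) \<noteq> (0, 0)"
  obtains \<kappa> where "\<kappa> \<noteq> 0"
    "\<And>t. (p1 * t $ 1 + p2 * t $ 2) * (q1 * t $ 1 + q2 * t $ 2) = \<kappa> * chow_form {#cp1 p1 p2, cp1 q1 q2#} t"
proof -
  obtain c where c: "c \<noteq> 0" "rep_proj (cp1 p1 p2) $ 1 = c * p1" "rep_proj (cp1 p1 p2) $ 2 = c * p2"
    using rep_cp1[OF assms(1)] .
  obtain d where d: "d \<noteq> 0" "rep_proj (cp1 q1 q2) $ 1 = d * q1" "rep_proj (cp1 q1 q2) $ 2 = d * q2"
    using rep_cp1[OF assms(2)] .
  show thesis
    by (rule that[of "1 / (c * d)"]) (use c d in \<open>auto simp: chow_form_def sum_2 field_simps\<close>)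
qed

lemma form_at_2:
  "form_at 2 P x y = (let q = (\<lambda>i. \<Sum>j\<le>2. \<Sum>k\<le>2. coeff (coeff (coeff P i) j) k *
           x $ 1 ^ j * x $ 2 ^ (2 - j) * y $ 1 ^ k * y $ 2 ^ (2 - k)) in [:q 0, q 1, q 2:])"
proof -
  have m: "[:c0, c1, c2:] = Polynomial.monom c0 0 + Polynomial.monom c1 1 + Polynomial.monom c2 2" for c0 c1 c2 :: complex
    by (simp add: monom_altdef numeral_2_eq_2)
  show ?thesis unfolding form_at_def Let_def m by (simp add: numeral_2_eq_2)
qed

lemma coeff_form_at:
  assumes "i \<le> 2"
  shows "coeff (form_at 2 P x y) i = (\<Sum>j\<le>2. \<Sum>k\<le>2. coeff (coeff (coeff P i) j) k *
           x $ 1 ^ j * x $ 2 ^ (2 - j) * y $ 1 ^ k * y $ 2 ^ (2 - k))"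
  unfolding form_at_def coeff_sum coeff_monom using assms by (subst sum.delta) auto

lemma form_at_scale: "form_at 2 P (c *s x) (d *s y) = smult (c^2 * d^2) (form_at 2 P x y)"
  unfolding form_at_2 Let_def
  by (simp add: numeral_2_eq_2 algebra_simps)

lemma mult_by_cp1:
  fixes P :: "complex poly poly poly"
  assumes "(x1, x0) \<noteq> (0, 0)" "(y1, y0) \<noteq> (0, 0)"
  defines "q \<equiv> form_at 2 P (vector [x1, x0]) (vector [y1, y0])"
  shows "mult_by 2 P (cp1 x1 x0) (cp1 y1 y0) = (if q = 0 then None else Some (binary_form_zeros 2 q))"
proof -
  have nz: "(vector [x1, x0] :: complex ^ 2) \<noteq> 0" "(vector [y1, y0] :: complex ^ 2) \<noteq> 0"
    using assms by (auto simp: vec2_eq_iff)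
  obtain c where c: "c \<noteq> 0" "rep_proj (cp1 x1 x0) = c *s vector [x1, x0]"
    unfolding cp1_def using rep_abs_proj[OF nz(1)] .
  obtain d where d: "d \<noteq> 0" "rep_proj (cp1 y1 y0) = d *s vector [y1, y0]"
    unfolding cp1_def using rep_abs_proj[OF nz(2)] .
  show ?thesis
    using c(1) d(1) unfolding mult_by_def c(2) d(2) form_at_scale q_def[symmetric] Let_def
    by (simp add: binary_form_zeros_smult)
qed

lemma mult_by_split:
  assumes "(x1, x0) \<noteq> (0, 0)" "(y1, y0) \<noteq> (0, 0)" "k \<noteq> 0" "(p1, p2) \<noteq> (0, 0)" "(q1, q2) \<noteq> (0, 0)"
    and "form_at 2 P (vector [x1, x0]) (vector [y1, y0]) = [:k * (p1 * q1), - (k * (p1 * q2 + p2 * q1)), k * (p2 * q2):]"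
  shows "mult_by 2 P (cp1 x1 x0) (cp1 y1 y0) = Some {#cp1 p1 p2, cp1 q1 q2#}"
proof -
  have q: "form_at 2 P (vector [x1, x0]) (vector [y1, y0]) = smult k ([:- p1, p2:] * [:- q1, q2:])"
    unfolding assms(6) by (simp add: algebra_simps)
  have "smult k ([:- p1, p2:] * [:- q1, q2:]) \<noteq> 0"
    using assms(3-5) by (auto simp del: mult_pCons_left mult_pCons_right)
  then show ?thesis unfolding mult_by_cp1[OF assms(1,2)] q
    using binary_form_zeros_split[OF assms(3-5)] by simp
qed

text \<open>The coefficients with respect to \<open>z\<close> are
  \<open>(a\<^sub>2 - x y)\<^sup>2 - 4 a\<^sub>3 (a\<^sub>1 + x + y)\<close>, \<open>- 2 ((x + y) (a\<^sub>2 + x y) + 2 a\<^sub>1 x y + 2 a\<^sub>3)\<close> and \<open>(x - y)\<^sup>2\<close>.\<close>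

lemma polyD_eq:
  "polyD a =
    [: [: [:(a $ 2)^2 - 4 * a $ 1 * a $ 3, - 4 * a $ 3:], [:- 4 * a $ 3, - 2 * a $ 2:], [:0, 0, 1:] :],
       [: [:- 4 * a $ 3, - 2 * a $ 2:], [:- 2 * a $ 2, - 4 * a $ 1, - 2:], [:0, - 2:] :],
       [: [:0, 0, 1:], [:0, - 2:], [:1:] :] :]"
  by (simp add: polyD_def disc2_def const3_def varX_def varY_def varZ_def Let_def numeral_poly
      power2_eq_square coeff_pCons numeral_2_eq_2 algebra_simps)

lemma polyB_eq:
  "polyB a =
    [: [: [:0, 0, 1:], [:0, - 2:], [:1:] :],
       [: [:0, - 2:], [:- 2, - 4 * a $ 1, - 2 * a $ 2:], [:0, - 2 * a $ 2, - 4 * a $ 3:] :],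
       [: [:1:], [:0, - 2 * a $ 2, - 4 * a $ 3:], [:0, - 4 * a $ 3, (a $ 2)^2 - 4 * a $ 1 * a $ 3:] :] :]"
  by (simp add: polyB_def const3_def varX_def varY_def varZ_def Let_def numeral_poly
      power2_eq_square algebra_simps) (simp add: one_pCons)

lemma form_at_polyD:
  "form_at 2 (polyD a) (vector [x1, x0]) (vector [y1, y0]) =
    [:(a $ 2 * x0 * y0 - x1 * y1)^2 - 4 * a $ 3 * x0 * y0 * (a $ 1 * x0 * y0 + x1 * y0 + x0 * y1),
      - 2 * ((x1 * y0 + x0 * y1) * (a $ 2 * x0 * y0 + x1 * y1) + 2 * a $ 1 * x1 * x0 * y1 * y0 + 2 * a $ 3 * x0^2 * y0^2),
      (x1 * y0 - x0 * y1)^2:]"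
  unfolding form_at_2 polyD_eq Let_def
  by (simp add: coeff_pCons numeral_2_eq_2 power2_eq_square algebra_simps)

lemma form_at_polyB:
  "form_at 2 (polyB a) (vector [x1, x0]) (vector [y1, y0]) =
    [:(x1 * y0 - x0 * y1)^2,
      - 2 * (x1 * x0 * (2 * a $ 1 * y1 * y0 + a $ 2 * y1^2 + y0^2)
           + x1^2 * y1 * (a $ 2 * y0 + 2 * a $ 3 * y1) + x0^2 * y0 * y1),
      x1^2 * y1 * ((a $ 2)^2 * y1 - 4 * a $ 3 * (a $ 1 * y1 + y0))
           - 2 * x0 * x1 * y1 * (a $ 2 * y0 + 2 * a $ 3 * y1) + x0^2 * y0^2:]"
  unfolding form_at_2 polyB_eq Let_def
  by (simp add: coeff_pCons numeral_2_eq_2 power2_eq_square algebra_simps)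

text \<open>This is the identity \<open>(x y z)\<^sup>2 B(1/z; 1/x, 1/y) = D(z; x, y)\<close> in homogeneous coordinates.\<close>

lemma form_at_polyB_polyD:
  assumes "form_at 2 (polyD a) (vector [x1, x0]) (vector [y1, y0]) = [:c0, c1, c2:]"
  shows "form_at 2 (polyB a) (vector [x0, x1]) (vector [y0, y1]) = [:c2, c1, c0:]"
  using assms unfolding form_at_polyB form_at_polyD
  by (auto simp: power2_eq_square algebra_simps)

section \<open>Multiplications given by cosets\<close>

lemma poly_funs_sum:
  assumes "\<And>i. i \<in> I \<Longrightarrow> f i \<in> poly_funs C"
  shows "(\<lambda>v. \<Sum>i\<in>I. f i v) \<in> poly_funs C"
  using assms by (induction I rule: infinite_finite_induct) (auto intro: poly_funs.intros)

text \<open>The form \<open>form_at 2 P\<close> is bihomogeneous of bidegree (2, 2), so it is a quadratic form in the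
  Segre coordinates: the monomial \<open>x\<^sub>1\<^sup>j x\<^sub>0\<^sup>2\<^sup>-\<^sup>j y\<^sub>1\<^sup>k y\<^sub>0\<^sup>2\<^sup>-\<^sup>k\<close> splits into two factors of bidegree (1, 1).\<close>

lemma rational_map_sym_mult_by:
  assumes "\<And>x y. mult_by 2 P x y \<noteq> None"
  shows "\<exists>F. rational_map_sym 2 (variety_prod UNIV UNIV) UNIV F \<and> (\<forall>x y. F (segre x y) = mult_by 2 P x y)"
proof -
  define F where "F p = (let (x, y) = SOME (x, y). p = segre x y in mult_by 2 P x y)"
    for p :: "(2 \<times> 2) proj"
  have F: "F (segre x y) = mult_by 2 P x y" for x y
  proof -
    have "(SOME (x', y'). segre x y = segre x' y') = (x, y)"
      by (rule some_equality) (use segre_inj in auto)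
    then show ?thesis by (simp add: F_def)
  qed
  define X where "X = (variety_prod UNIV UNIV :: (2 \<times> 2) proj set)"
  have X: "{p \<in> X. F p \<noteq> None} = X"
    using F assms by (auto simp: X_def variety_prod_def)
  define \<alpha> \<beta> :: "nat \<Rightarrow> 2" where "\<alpha> j = (if j = 0 then 2 else 1)" and "\<beta> j = (if j = 2 then 1 else 2)" for j
  define b :: "nat \<Rightarrow> (complex ^ (2 \<times> 2)) \<times> (complex ^ 2) \<Rightarrow> complex" where
    "b i vt = (\<Sum>j\<le>2. \<Sum>k\<le>2. coeff (coeff (coeff P i) j) k * (fst vt $ (\<alpha> j, \<alpha> k) * fst vt $ (\<beta> j, \<beta> k)))"
    for i vt
  define c :: "(complex ^ (2 \<times> 2)) \<times> (complex ^ 2) \<Rightarrow> complex" where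
    "c vt = b 0 vt * (snd vt $ 1 * snd vt $ 1) + (-1) * b 1 vt * (snd vt $ 1 * snd vt $ 2)
       + b 2 vt * (snd vt $ 2 * snd vt $ 2)" for vt
  let ?C = "range (\<lambda>i (v :: complex ^ (2 \<times> 2), t :: complex ^ 2). v $ i) \<union> range (\<lambda>j (v, t). t $ j)"
  have v: "(\<lambda>vt. fst vt $ i) \<in> poly_funs ?C" for i
  proof -
    have "(\<lambda>vt. fst vt $ i) = (\<lambda>(v, t). v $ i)" by auto
    then show ?thesis by (intro poly_funs.coord) auto
  qed
  have t: "(\<lambda>vt. snd vt $ i) \<in> poly_funs ?C" for i
  proof -
    have "(\<lambda>vt. snd vt $ i) = (\<lambda>(v, t). t $ i)" by auto
    then show ?thesis by (intro poly_funs.coord) auto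
  qed
  have "b i \<in> poly_funs ?C" for i
    unfolding b_def[abs_def] by (intro poly_funs_sum poly_funs.mult poly_funs.const v)
  then have c_poly: "c \<in> poly_funs ?C"
    unfolding c_def[abs_def] by (intro poly_funs.add poly_funs.mult poly_funs.const t)
  have c_hom: "c (s *s v, t) = s ^ 2 * c (v, t)" for s v t
  proof -
    have "b i (s *s v, t) = s^2 * b i (v, t)" for i
      unfolding b_def by (simp add: sum_distrib_left power2_eq_square mult_ac)
    then show ?thesis unfolding c_def by (simp add: algebra_simps)
  qed
  have chart: "\<exists>\<kappa>. \<kappa> \<noteq> 0 \<and> (\<forall>t. c (v, t) = \<kappa> * chow_form (the (F (abs_proj v))) t)"
    and sz: "size (the (F (abs_proj v))) = 2"
    if "v \<noteq> 0" "abs_proj v \<in> X" for v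
  proof -
    note v0 = that(1)
    from that obtain x y where xy: "abs_proj v = segre x y" by (auto simp: X_def variety_prod_def)
    define q where "q = form_at 2 P (rep_proj x) (rep_proj y)"
    have q0: "q \<noteq> 0" and Fv: "F (abs_proj v) = Some (binary_form_zeros 2 q)"
      using assms[of x y] unfolding xy F mult_by_def q_def[symmetric] Let_def by (auto split: if_splits)
    have "degree q \<le> 2" unfolding q_def form_at_2 Let_def by (simp add: degree_pCons_eq_if)
    then obtain k p1 p2 q1 q2 where k: "k \<noteq> 0" "(p1, p2) \<noteq> (0, 0)" "(q1, q2) \<noteq> (0, 0)"
      and q: "q = smult k ([:- p1, p2:] * [:- q1, q2:])" using quadratic_form_splits[OF q0] by blast
    have z: "binary_form_zeros 2 q = {#cp1 p1 p2, cp1 q1 q2#}"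
      unfolding q by (rule binary_form_zeros_split[OF k])
    show "size (the (F (abs_proj v))) = 2" unfolding Fv z by simp
    obtain e where e: "e \<noteq> 0" "\<And>i j. v $ (i, j) = e * (rep_proj x $ i * rep_proj y $ j)"
      using segre_abs[OF v0, of "rep_proj x" "rep_proj y"] xy by auto
    have bq: "b i (v, t) = e^2 * coeff q i" if "i \<le> 2" for i t
    proof -
      have "b i (v, t) = (\<Sum>j\<le>2. \<Sum>k\<le>2. e^2 * (coeff (coeff (coeff P i) j) k * rep_proj x $ 1 ^ j *
           rep_proj x $ 2 ^ (2 - j) * rep_proj y $ 1 ^ k * rep_proj y $ 2 ^ (2 - k)))"
        unfolding b_def
      proof (intro sum.cong refl)
        fix j k :: nat assume "j \<in> {..2}" "k \<in> {..2}"
        then have "j = 0 \<or> j = 1 \<or> j = 2" "k = 0 \<or> k = 1 \<or> k = 2" by auto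
        then show "coeff (coeff (coeff P i) j) k * (fst (v, t) $ (\<alpha> j, \<alpha> k) * fst (v, t) $ (\<beta> j, \<beta> k)) =
           e^2 * (coeff (coeff (coeff P i) j) k * rep_proj x $ 1 ^ j *
           rep_proj x $ 2 ^ (2 - j) * rep_proj y $ 1 ^ k * rep_proj y $ 2 ^ (2 - k))"
          by (elim disjE) (simp_all add: e(2) \<alpha>_def \<beta>_def power2_eq_square mult_ac)
      qed
      also have "\<dots> = e^2 * coeff q i"
        unfolding q_def coeff_form_at[OF that] sum_distrib_left ..
      finally show ?thesis .
    qed
    have qc: "coeff q 0 = k * (p1 * q1)" "coeff q 1 = - (k * (p1 * q2 + p2 * q1))" "coeff q 2 = k * (p2 * q2)"
      unfolding q by (simp_all add: coeff_pCons numeral_2_eq_2 algebra_simps)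
    have cv: "c (v, t) = (e^2 * k) * ((p1 * t $ 1 + p2 * t $ 2) * (q1 * t $ 1 + q2 * t $ 2))" for t
      unfolding c_def by (simp add: bq qc qc(2)[unfolded One_nat_def] algebra_simps)
    obtain \<kappa> where \<kappa>: "\<kappa> \<noteq> 0" "\<And>t. (p1 * t $ 1 + p2 * t $ 2) * (q1 * t $ 1 + q2 * t $ 2)
       = \<kappa> * chow_form {#cp1 p1 p2, cp1 q1 q2#} t" using chow_form_pair[OF k(2,3)] by blast
    show "\<exists>\<kappa>. \<kappa> \<noteq> 0 \<and> (\<forall>t. c (v, t) = \<kappa> * chow_form (the (F (abs_proj v))) t)"
      unfolding Fv z option.sel cv using \<kappa> e k by (intro exI[of _ "e^2 * k * \<kappa>"]) simp
  qed
  have "regular_map_sym 2 X UNIV (\<lambda>p. the (F p))"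
    unfolding regular_map_sym_def
  proof (intro conjI ballI)
    fix p assume p: "p \<in> X"
    show "size (the (F p)) = 2" using sz[of "rep_proj p"] p by simp
    show "\<exists>Z d (c :: (complex ^ (2 \<times> 2)) \<times> (complex ^ 2) \<Rightarrow> complex).
        zariski_closed Z \<and> p \<notin> Z \<and> c \<in> poly_funs ?C \<and>
        (\<forall>s v t. c (s *s v, t) = s ^ d * c (v, t)) \<and>
        (\<forall>v. v \<noteq> 0 \<and> abs_proj v \<in> X - Z \<longrightarrow>
           (\<exists>\<kappa>. \<kappa> \<noteq> 0 \<and> (\<forall>t. c (v, t) = \<kappa> * chow_form (the (F (abs_proj v))) t)))"
      using c_poly c_hom chart zariski_closed_empty
      by (intro exI[of _ "{}"] exI[of _ 2] exI[of _ c]) auto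
  qed simp
  then have "rational_map_sym 2 X UNIV F"
    unfolding rational_map_sym_def X using dense_open_in_refl by blast
  then show ?thesis using F unfolding X_def by blast
qed

lemma quasi_projective_UNIV: "quasi_projective UNIV"
  unfolding quasi_projective_def using zariski_closed_empty zariski_closed_UNIV
  by (metis Diff_empty)

lemma rational_map_Some: "rational_map UNIV UNIV (Some :: 2 proj \<Rightarrow> _)"
proof -
  have "regular_map UNIV UNIV (\<lambda>p :: 2 proj. p)"
    by (rule regular_map_linear[where G = id]) (auto intro!: homogeneous_coord[simplified])
  then show ?thesis unfolding rational_map_def using dense_open_in_refl by simp
qed

text \<open>The multiplication defined by \<open>P\<close> is the coset multiplication of the abelian group \<open>G\<close> with respect to
  inversion.\<close>

locale inversion_quotient = comm_group G for G (structure) +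
  fixes \<pi> :: "'a \<Rightarrow> 2 proj" and P
  assumes surj: "\<pi> ` carrier G = UNIV"
    and eq_iff: "u \<in> carrier G \<Longrightarrow> v \<in> carrier G \<Longrightarrow> \<pi> u = \<pi> v \<longleftrightarrow> v = u \<or> v = inv u"
    and mult_by_eq: "u \<in> carrier G \<Longrightarrow> v \<in> carrier G \<Longrightarrow>
      mult_by 2 P (\<pi> u) (\<pi> v) = Some {#\<pi> (u \<otimes> v), \<pi> (u \<otimes> inv v)#}"
begin

lemma lift: obtains u where "u \<in> carrier G" "x = \<pi> u"
  using surj by blast

lemma mult_by_defined: "mult_by 2 P x y \<noteq> None"
  by (metis lift mult_by_eq option.distinct(1))

lemma \<pi>_inv: "u \<in> carrier G \<Longrightarrow> \<pi> (inv u) = \<pi> u"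
  using eq_iff[of u "inv u"] by simp

text \<open>In an abelian group both ways of bracketing \<open>u, v, w\<close> give the images of the four products
  of \<open>u\<close> with \<open>v\<close> or its inverse and \<open>w\<close> or its inverse, because inversion is invisible
  in the quotient.\<close>

lemma assoc: "nv_assoc UNIV (mult_by 2 P)"
  unfolding nv_assoc_def
proof (intro ballI allI impI)
  fix x y z L R
  assume a: "mult_by 2 P y z = Some R \<and> (\<forall>w\<in>#R. mult_by 2 P x w \<noteq> None) \<and>
        mult_by 2 P x y = Some L \<and> (\<forall>w\<in>#L. mult_by 2 P w z \<noteq> None)"
  obtain u where u: "u \<in> carrier G" "x = \<pi> u" by (rule lift)
  obtain v where v: "v \<in> carrier G" "y = \<pi> v" by (rule lift)
  obtain w where w: "w \<in> carrier G" "z = \<pi> w" by (rule lift)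
  have R: "R = {#\<pi> (v \<otimes> w), \<pi> (v \<otimes> inv w)#}" and L: "L = {#\<pi> (u \<otimes> v), \<pi> (u \<otimes> inv v)#}"
    using a u v w mult_by_eq by auto
  have "u \<otimes> inv (v \<otimes> w) = u \<otimes> inv v \<otimes> inv w" "u \<otimes> inv (v \<otimes> inv w) = u \<otimes> inv v \<otimes> w"
    using u v w by (simp_all add: inv_mult m_assoc)
  then show "(\<Sum>w\<in>#R. the (mult_by 2 P x w)) = (\<Sum>w\<in>#L. the (mult_by 2 P w z))"
    unfolding R L u v w using u(1) v(1) w(1)
    by (simp add: mult_by_eq m_assoc[symmetric] add_mset_commute)
qed

lemma algebraic_nv_group: "algebraic_nv_group 2 UNIV (mult_by 2 P) (\<pi> \<one>) Some"
proof -
  have e: "mult_by 2 P x (\<pi> \<one>) = Some (replicate_mset 2 x) \<and> mult_by 2 P (\<pi> \<one>) x = Some (replicate_mset 2 x)" for x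
  proof -
    obtain u where u: "u \<in> carrier G" "x = \<pi> u" by (rule lift)
    moreover have "replicate_mset 2 x = {#x, x#}" by (simp add: numeral_2_eq_2)
    ultimately show ?thesis by (simp add: mult_by_eq \<pi>_inv)
  qed
  have i: "\<exists>L. mult_by 2 P x x = Some L \<and> \<pi> \<one> \<in># L" for x
  proof -
    obtain u where u: "u \<in> carrier G" "x = \<pi> u" by (rule lift)
    then show ?thesis by (simp add: mult_by_eq)
  qed
  show ?thesis
    unfolding algebraic_nv_group_def algebraic_nv_monoid_def
    using quasi_projective_UNIV rational_map_sym_mult_by[OF mult_by_defined] assoc e i rational_map_Some
    by simp
qed

lemma nv_regular: "nv_regular UNIV (mult_by 2 P) Some"
  unfolding nv_regular_def using mult_by_defined by simp

text \<open>Every inverse of \<open>\<pi> u\<close> is some \<open>\<pi> v\<close> such that \<open>u v\<close> or \<open>u v\<^sup>-\<^sup>1\<close> is neutral, and then \<open>\<pi> v = \<pi> u\<close>.\<close>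

lemma nv_involutive: "nv_involutive 2 UNIV (mult_by 2 P) (\<pi> \<one>) Some"
  unfolding nv_involutive_def
proof (intro conjI ballI allI impI)
  fix \<iota>' x
  assume g: "algebraic_nv_group 2 UNIV (mult_by 2 P) (\<pi> \<one>) \<iota>'" and "\<iota>' x \<noteq> None"
  then obtain y where y: "\<iota>' x = Some y" by auto
  then obtain L where L: "mult_by 2 P x y = Some L" "\<pi> \<one> \<in># L"
    using g unfolding algebraic_nv_group_def by blast
  obtain u where u: "u \<in> carrier G" "x = \<pi> u" by (rule lift)
  obtain v where v: "v \<in> carrier G" "y = \<pi> v" by (rule lift)
  have "\<pi> \<one> = \<pi> (u \<otimes> v) \<or> \<pi> \<one> = \<pi> (u \<otimes> inv v)" using L u v mult_by_eq by auto
  then have "u \<otimes> v = \<one> \<or> u \<otimes> inv v = \<one>" using u v eq_iff[of \<one>] by auto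
  then have "v = inv u \<or> v = u" using u v
    by (metis inv_equality inv_closed inv_inv m_comm)
  then show "\<iota>' x = Some x" using y u v \<pi>_inv by auto
qed simp

end

section \<open>The two-valued groups of an elliptic curve\<close>

lemma regular_map_recip_comp:
  fixes f :: "('a :: finite) proj \<Rightarrow> 2 proj"
  assumes "regular_map X UNIV f"
  shows "regular_map X UNIV (recip \<circ> f)"
  unfolding regular_map_def
proof (intro conjI ballI)
  fix p assume "p \<in> X"
  then obtain Z d and G :: "complex ^ 'a \<Rightarrow> complex ^ 2" where
    Z: "zariski_closed Z" "p \<notin> Z" and h: "\<forall>j. homogeneous d (\<lambda>v. G v $ j)"
    and G: "\<forall>v. v \<noteq> 0 \<and> abs_proj v \<in> X - Z \<longrightarrow> G v \<noteq> 0 \<and> f (abs_proj v) = abs_proj (G v)"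
    using assms unfolding regular_map_def by blast
  define G' :: "complex ^ 'a \<Rightarrow> complex ^ 2" where "G' v = vector [G v $ 2, G v $ 1]" for v
  have "homogeneous d (\<lambda>v. G' v $ j)" for j
    using exhaust_2[of j] h by (auto simp: G'_def)
  moreover have "G' v \<noteq> 0 \<and> (recip \<circ> f) (abs_proj v) = abs_proj (G' v)"
    if v: "v \<noteq> 0 \<and> abs_proj v \<in> X - Z" for v
  proof -
    have g: "(G v $ 1, G v $ 2) \<noteq> (0, 0)" "f (abs_proj v) = cp1 (G v $ 1) (G v $ 2)"
      using G v by (auto simp: vec2_eq_iff abs_proj_cp1)
    then show ?thesis by (auto simp: recip_cp1 abs_proj_cp1 G'_def vec2_eq_iff)
  qed
  ultimately show "\<exists>Z d (G :: complex ^ 'a \<Rightarrow> complex ^ 2).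
        zariski_closed Z \<and> p \<notin> Z \<and> (\<forall>j. homogeneous d (\<lambda>v. G v $ j)) \<and>
        (\<forall>v. v \<noteq> 0 \<and> abs_proj v \<in> X - Z \<longrightarrow> G v \<noteq> 0 \<and> (recip \<circ> f) (abs_proj v) = abs_proj (G v))"
    using Z by blast
qed simp

context elliptic_curve
begin

text \<open>For two points of an elliptic curve with abscissae \<open>x1 \<noteq> x2\<close>, the chords through \<open>u, v\<close>
  and through \<open>u, -v\<close> give the abscissae of \<open>u + v\<close> and \<open>u - v\<close>; their sum and product are
  even in the ordinates and hence rational functions of \<open>x1\<close> and \<open>x2\<close>.\<close>

lemma abscissae_sum_product:
  assumes "line_cuts a l m x1 x2 s" "line_cuts a l' m' x1 x2 d" "x1 \<noteq> x2"
    and "l' * x1 + m' = l * x1 + m" "l' * x2 + m' = - (l * x2 + m)"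
  shows "(x1 - x2)^2 * (s + d) = 2 * ((x1 + x2) * (a $ 2 + x1 * x2) + 2 * a $ 1 * x1 * x2 + 2 * a $ 3)"
    and "(x1 - x2)^2 * (s * d) = (a $ 2 - x1 * x2)^2 - 4 * a $ 3 * (a $ 1 + x1 + x2)"
proof -
  define y1 y2 T D where "y1 = l * x1 + m" and "y2 = l * x2 + m" and "T = (x1 - x2)^2 * (a $ 1 + x1 + x2)"
    and "D = (x1 - x2)^2"
  have y: "y1^2 = cubic a x1" "y2^2 = cubic a x2"
    using line_cuts_on_curve[OF assms(1)] by (simp_all add: y1_def y2_def)
  have l: "(x1 - x2) * l = y1 - y2" by (simp add: y1_def y2_def algebra_simps)
  have l': "(x1 - x2) * l' = y1 + y2"
  proof -
    have "(x1 - x2) * l' = (l' * x1 + m') - (l' * x2 + m')" by (simp add: algebra_simps)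
    then show ?thesis unfolding assms(4,5) y1_def y2_def by simp
  qed
  have s': "s = l^2 - (a $ 1 + x1 + x2)" using assms(1) by (simp add: line_cuts_def)
  have d': "d = l'^2 - (a $ 1 + x1 + x2)" using assms(2) by (simp add: line_cuts_def)
  have "D * s = ((x1 - x2) * l)^2 - T" "D * d = ((x1 - x2) * l')^2 - T"
    unfolding T_def D_def s' d' by (simp_all add: algebra_simps power2_eq_square)
  then have s: "D * s = (y1 - y2)^2 - T" and d: "D * d = (y1 + y2)^2 - T"
    unfolding l l' by simp_all
  have "D * (s + d) = 2 * (y1^2 + y2^2) - 2 * T"
    unfolding distrib_left s d by (simp add: power2_eq_square algebra_simps)
  then show "(x1 - x2)^2 * (s + d) = 2 * ((x1 + x2) * (a $ 2 + x1 * x2) + 2 * a $ 1 * x1 * x2 + 2 * a $ 3)"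
    unfolding y cubic_def T_def D_def by (simp add: power2_eq_square power3_eq_cube algebra_simps)
  have "D * (D * (s * d)) = (D * s) * (D * d)" by (simp add: mult_ac)
  also have "\<dots> = (y1^2 - y2^2)^2 - 2 * T * (y1^2 + y2^2) + T^2"
    unfolding s d by (simp add: power2_eq_square algebra_simps)
  also have "\<dots> = D * ((a $ 2 - x1 * x2)^2 - 4 * a $ 3 * (a $ 1 + x1 + x2))"
    unfolding y cubic_def T_def D_def by (simp add: power2_eq_square power3_eq_cube algebra_simps)
  finally have "D * (D * (s * d)) = D * ((a $ 2 - x1 * x2)^2 - 4 * a $ 3 * (a $ 1 + x1 + x2))" .
  moreover have "D \<noteq> 0" using assms(3) by (simp add: D_def)
  ultimately have "D * (s * d) = (a $ 2 - x1 * x2)^2 - 4 * a $ 3 * (a $ 1 + x1 + x2)"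
    by (metis mult_left_cancel)
  then show "(x1 - x2)^2 * (s * d) = (a $ 2 - x1 * x2)^2 - 4 * a $ 3 * (a $ 1 + x1 + x2)"
    unfolding D_def .
qed

text \<open>The duplication formula, freed of its denominator \<open>4 \<eta>\<^sup>2 = 4 f(x)\<close>.\<close>

lemma abscissa_double:
  assumes "line_cuts a l m x x s"
  shows "4 * cubic a x * s = (a $ 2 - x * x)^2 - 4 * a $ 3 * (a $ 1 + x + x)"
proof -
  define y where "y = l * x + m"
  have y: "y^2 = cubic a x" using line_cuts_on_curve[OF assms(1)] by (simp add: y_def)
  have l: "2 * y * l = 3 * x^2 + 2 * a $ 1 * x + a $ 2"
    using assms unfolding line_cuts_def y_def by algebra
  have s: "s = l^2 - (a $ 1 + x + x)" using assms by (simp add: line_cuts_def)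
  have "4 * cubic a x * s = (2 * y * l)^2 - 4 * cubic a x * (a $ 1 + x + x)"
    unfolding s y[symmetric] by (simp add: power2_eq_square algebra_simps)
  then show ?thesis
    unfolding l cubic_def by (simp add: power2_eq_square power3_eq_cube algebra_simps)
qed

text \<open>The factorisation is recorded, rather than the multiset of zeros, because reversing the
  coefficients turns it into a factorisation of the form belonging to \<^const>\<open>polyB\<close>.\<close>

definition product_form :: "complex ^ 2 \<Rightarrow> complex ^ 2 \<Rightarrow> 2 proj \<Rightarrow> 2 proj \<Rightarrow> bool" where
  "product_form x y s d \<longleftrightarrow> (\<exists>k p1 p2 q1 q2. k \<noteq> 0 \<and> (p1, p2) \<noteq> (0, 0) \<and> (q1, q2) \<noteq> (0, 0) \<and>
     s = cp1 p1 p2 \<and> d = cp1 q1 q2 \<and>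
     form_at 2 (polyD a) x y = [:k * (p1 * q1), - (k * (p1 * q2 + p2 * q1)), k * (p2 * q2):])"

lemma product_formI:
  assumes "k \<noteq> 0" "(p1, p2) \<noteq> (0, 0)" "(q1, q2) \<noteq> (0, 0)" "s = cp1 p1 p2" "d = cp1 q1 q2"
    "form_at 2 (polyD a) x y = [:k * (p1 * q1), - (k * (p1 * q2 + p2 * q1)), k * (p2 * q2):]"
  shows "product_form x y s d"
  unfolding product_form_def using assms by blast

lemma product_form_commute: "product_form x y s d \<Longrightarrow> product_form x y d s"
proof -
  assume "product_form x y s d"
  then obtain k p1 p2 q1 q2 where k: "k \<noteq> 0" "(p1, p2) \<noteq> (0, 0)" "(q1, q2) \<noteq> (0, 0)" "s = cp1 p1 p2" "d = cp1 q1 q2"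
    "form_at 2 (polyD a) x y = [:k * (p1 * q1), - (k * (p1 * q2 + p2 * q1)), k * (p2 * q2):]"
    unfolding product_form_def by blast
  show ?thesis
    by (rule product_formI[OF k(1,3,2,5,4)]) (unfold k(6), simp add: algebra_simps)
qed

text \<open>For \<open>u = v\<close> the leading coefficient \<open>(x - y)\<^sup>2\<close> vanishes, so one zero is at infinity, the abscissa of
  \<open>u - v\<close>. If the ordinate is 0 only the constant term \<open>f'(x)\<^sup>2\<close> is left.\<close>

lemma product_form_double:
  assumes "y^2 = cubic a x"
  shows "product_form (vector [x, 1]) (vector [x, 1])
    (zeta_map (curve_add a (cp2 x y 1) (cp2 x y 1))) infty"
proof (cases "y = 0")
  case True
  let ?d = "3 * x^2 + 2 * a $ 1 * x + a $ 2"
  have f: "cubic a x = 0" using assms True by simp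
  then have d: "?d \<noteq> 0" using no_double_root[of x] by blast
  have "curve_add a (cp2 x y 1) (cp2 x y 1) = curve_infty" using True by (simp add: curve_add_def)
  moreover have a3: "a $ 3 = - (x^3 + a $ 1 * x^2 + a $ 2 * x)" using f unfolding cubic_def by algebra
  have "form_at 2 (polyD a) (vector [x, 1]) (vector [x, 1]) = [:?d^2 * (1 * 1), - (?d^2 * (1 * 0 + 0 * 1)), ?d^2 * (0 * 0):]"
    unfolding form_at_polyD a3 by (simp add: power2_eq_square power3_eq_cube algebra_simps)
  ultimately show ?thesis
    using d by (intro product_formI[of "?d^2" 1 0 1 0]) (auto simp: infty_def)
next
  case False
  have "\<not> (x = x \<and> y = - y)"
  proof
    assume "x = x \<and> y = - y"
    then have "y = - y" ..
    then have "2 * y = 0" by algebra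
    then show False using False by simp
  qed
  then obtain l m s where L: "line_cuts a l m x x s" "y = l * x + m"
    using line_cuts_exists[OF assms assms] by blast
  have "curve_add a (cp2 x y 1) (cp2 x y 1) = cp2 s (- (l * s + m)) 1"
    using curve_add_line_cuts[OF L(1)] L(2) by simp
  moreover have "form_at 2 (polyD a) (vector [x, 1]) (vector [x, 1]) =
      [:4 * cubic a x * (s * 1), - (4 * cubic a x * (s * 0 + 1 * 1)), 4 * cubic a x * (1 * 0):]"
    using abscissa_double[OF L(1)] unfolding form_at_polyD
    by (simp add: cubic_def power2_eq_square power3_eq_cube algebra_simps)
  moreover have "4 * cubic a x \<noteq> 0" using False assms by (auto simp: power2_eq_square)
  ultimately show ?thesis
    by (intro product_formI[of "4 * cubic a x" s 1 1 0]) (auto simp: infty_def)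
qed

lemma product_form_exists:
  assumes "u \<in> E" "v \<in> E"
  obtains x1 x0 y1 y0 where "(x1, x0) \<noteq> (0, 0)" "(y1, y0) \<noteq> (0, 0)" "zeta_map u = cp1 x1 x0" "zeta_map v = cp1 y1 y0"
    "product_form (vector [x1, x0]) (vector [y1, y0])
      (zeta_map (curve_add a u v)) (zeta_map (curve_add a u (cneg v)))"
proof -
  have rep: "\<exists>y1 y0. (y1, y0) \<noteq> (0, 0) \<and> zeta_map w = cp1 y1 y0" for w
    using cp1_cases[of "zeta_map w"] by metis
  have "\<exists>x1 x0 y1 y0. (x1, x0) \<noteq> (0, 0) \<and> (y1, y0) \<noteq> (0, 0) \<and> zeta_map u = cp1 x1 x0 \<and> zeta_map v = cp1 y1 y0 \<and>
    product_form (vector [x1, x0]) (vector [y1, y0])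
      (zeta_map (curve_add a u v)) (zeta_map (curve_add a u (cneg v)))"
    using assms(1)
  proof (cases rule: curve_points_cases)
    case infty
    obtain y1 y0 where y: "(y1, y0) \<noteq> (0, 0)" "zeta_map v = cp1 y1 y0" using rep by blast
    have "form_at 2 (polyD a) (vector [1, 0]) (vector [y1, y0]) = [:1 * (y1 * y1), - (1 * (y1 * y0 + y0 * y1)), 1 * (y0 * y0):]"
      unfolding form_at_polyD by (simp add: power2_eq_square)
    then have "product_form (vector [1, 0]) (vector [y1, y0]) (zeta_map v) (zeta_map v)"
      using y by (intro product_formI[of 1]) auto
    then show ?thesis
      using y infty assms(2) zeta_map_cneg[OF assms(2)] by (intro exI[of _ 1] exI[of _ 0] exI[of _ y1] exI[of _ y0]) (simp add: infty_def)
  next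
    case u: (affine x1 y1)
    show ?thesis
      using assms(2)
    proof (cases rule: curve_points_cases)
      case infty
      have "form_at 2 (polyD a) (vector [x1, 1]) (vector [1, 0]) = [:1 * (x1 * x1), - (1 * (x1 * 1 + 1 * x1)), 1 * (1 * 1):]"
        unfolding form_at_polyD by (simp add: power2_eq_square)
      then have "product_form (vector [x1, 1]) (vector [1, 0]) (cp1 x1 1) (cp1 x1 1)"
        by (intro product_formI[of 1]) auto
      then show ?thesis
        using u infty by (intro exI[of _ x1] exI[of _ 1] exI[of _ 1] exI[of _ 0]) (simp add: infty_def)
    next
      case v: (affine x2 y2)
      have "product_form (vector [x1, 1]) (vector [x2, 1])
          (zeta_map (curve_add a u v)) (zeta_map (curve_add a u (cneg v)))"
      proof (cases "x1 = x2")
        case False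
        obtain l m s where L: "line_cuts a l m x1 x2 s" "y1 = l * x1 + m" "y2 = l * x2 + m"
          using line_cuts_exists[OF u(2) v(2)] False by blast
        have v': "(- y2)^2 = cubic a x2" using v(2) by simp
        obtain l' m' d where L': "line_cuts a l' m' x1 x2 d" "y1 = l' * x1 + m'" "- y2 = l' * x2 + m'"
          using line_cuts_exists[OF u(2) v'] False by blast
        have e: "l' * x1 + m' = l * x1 + m" "l' * x2 + m' = - (l * x2 + m)" using L L' by simp_all
        note sp = abscissae_sum_product[OF L(1) L'(1) False e]
        have "form_at 2 (polyD a) (vector [x1, 1]) (vector [x2, 1]) =
          [:(x1 - x2)^2 * (s * d), - ((x1 - x2)^2 * (s * 1 + 1 * d)), (x1 - x2)^2 * (1 * 1):]"
          unfolding form_at_polyD mult_1_right mult_1_left sp by (simp add: power2_eq_square algebra_simps)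
        moreover have "curve_add a u v = cp2 s (- (l * s + m)) 1"
          using curve_add_line_cuts[OF L(1)] L(2,3) u v by simp
        moreover have "curve_add a u (cneg v) = cp2 d (- (l' * d + m')) 1"
          using curve_add_line_cuts[OF L'(1)] L'(2,3) u v by simp
        ultimately show ?thesis using False by (intro product_formI[of "(x1 - x2)^2" s 1 d 1]) auto
      next
        case True
        then have "v = u \<or> v = cneg u" using zeta_map_eq_iff[OF assms] u v by simp
        moreover have "product_form (vector [x1, 1]) (vector [x2, 1]) (zeta_map (curve_add a u u)) infty"
          using product_form_double[OF u(2)] u True by simp
        ultimately show ?thesis
          using product_form_commute curve_add_cneg[OF assms(1)] cneg_cneg[OF assms(1)] by auto
      qed
      then show ?thesis using u v by (intro exI[of _ x1] exI[of _ 1] exI[of _ x2] exI[of _ 1]) simp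
    qed
  qed
  then show thesis using that by blast
qed

lemma mult_by_polyD:
  assumes "u \<in> E" "v \<in> E"
  shows "mult_by 2 (polyD a) (zeta_map u) (zeta_map v) =
    Some {#zeta_map (curve_add a u v), zeta_map (curve_add a u (cneg v))#}"
proof -
  obtain x1 x0 y1 y0 where x: "(x1, x0) \<noteq> (0, 0)" "(y1, y0) \<noteq> (0, 0)"
    and z: "zeta_map u = cp1 x1 x0" "zeta_map v = cp1 y1 y0"
    and "product_form (vector [x1, x0]) (vector [y1, y0])
      (zeta_map (curve_add a u v)) (zeta_map (curve_add a u (cneg v)))"
    using product_form_exists[OF assms] .
  then obtain k p1 p2 q1 q2 where k: "k \<noteq> 0" "(p1, p2) \<noteq> (0, 0)" "(q1, q2) \<noteq> (0, 0)"
    and s: "zeta_map (curve_add a u v) = cp1 p1 p2" "zeta_map (curve_add a u (cneg v)) = cp1 q1 q2"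
    and f: "form_at 2 (polyD a) (vector [x1, x0]) (vector [y1, y0]) =
      [:k * (p1 * q1), - (k * (p1 * q2 + p2 * q1)), k * (p2 * q2):]"
    unfolding product_form_def by blast
  show ?thesis unfolding z s by (rule mult_by_split[OF x k f])
qed

lemma mult_by_polyB:
  assumes "u \<in> E" "v \<in> E"
  shows "mult_by 2 (polyB a) (recip (zeta_map u)) (recip (zeta_map v)) =
    Some {#recip (zeta_map (curve_add a u v)), recip (zeta_map (curve_add a u (cneg v)))#}"
proof -
  obtain x1 x0 y1 y0 where x: "(x1, x0) \<noteq> (0, 0)" "(y1, y0) \<noteq> (0, 0)"
    and z: "zeta_map u = cp1 x1 x0" "zeta_map v = cp1 y1 y0"
    and "product_form (vector [x1, x0]) (vector [y1, y0])
      (zeta_map (curve_add a u v)) (zeta_map (curve_add a u (cneg v)))"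
    using product_form_exists[OF assms] .
  then obtain k p1 p2 q1 q2 where k: "k \<noteq> 0" "(p1, p2) \<noteq> (0, 0)" "(q1, q2) \<noteq> (0, 0)"
    and s: "zeta_map (curve_add a u v) = cp1 p1 p2" "zeta_map (curve_add a u (cneg v)) = cp1 q1 q2"
    and f: "form_at 2 (polyD a) (vector [x1, x0]) (vector [y1, y0]) =
      [:k * (p1 * q1), - (k * (p1 * q2 + p2 * q1)), k * (p2 * q2):]"
    unfolding product_form_def by blast
  have f': "form_at 2 (polyB a) (vector [x0, x1]) (vector [y0, y1]) =
      [:k * (p2 * q2), - (k * (p2 * q1 + p1 * q2)), k * (p1 * q1):]"
    unfolding form_at_polyB_polyD[OF f] by (simp add: algebra_simps)
  have x': "(x0, x1) \<noteq> (0, 0)" "(y0, y1) \<noteq> (0, 0)" "(p2, p1) \<noteq> (0, 0)" "(q2, q1) \<noteq> (0, 0)"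
    using x k by auto
  show ?thesis
    unfolding z s recip_cp1[OF x(1)] recip_cp1[OF x(2)] recip_cp1[OF k(2)] recip_cp1[OF k(3)]
    by (rule mult_by_split[OF x'(1,2) k(1) x'(3,4) f'])
qed

lemma inversion_quotient_D: "inversion_quotient (curve_group a) zeta_map (polyD a)"
proof -
  interpret comm_group "curve_group a" by (rule comm_group_curve)
  show ?thesis
    by unfold_locales (auto simp: zeta_map_surj zeta_map_eq_iff mult_by_polyD)
qed

lemma inversion_quotient_B: "inversion_quotient (curve_group a) (recip \<circ> zeta_map) (polyB a)"
proof -
  interpret comm_group "curve_group a" by (rule comm_group_curve)
  have "recip x = recip y \<longleftrightarrow> x = y" for x y by (metis recip_recip)
  moreover have "x \<in> (\<lambda>u. recip (zeta_map u)) ` E" for x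
    using zeta_map_surj recip_recip[of x] by (metis UNIV_I image_iff)
  ultimately show ?thesis
    by unfold_locales (auto simp: zeta_map_eq_iff mult_by_polyB image_comp[symmetric])
qed

lemma nv_isomorphic_D_B: "nv_isomorphic UNIV (mult_by 2 (polyD a)) UNIV (mult_by 2 (polyB a))"
proof -
  have "variety_iso UNIV UNIV recip"
    unfolding variety_iso_def using regular_map_recip by (metis recip_recip)
  moreover have "map_option (image_mset recip) (mult_by 2 (polyD a) x y) = mult_by 2 (polyB a) (recip x) (recip y)" for x y
  proof -
    obtain u v where "u \<in> E" "x = zeta_map u" "v \<in> E" "y = zeta_map v"
      using zeta_map_surj by (metis UNIV_I image_iff)
    then show ?thesis by (simp add: mult_by_polyD mult_by_polyB)
  qed
  ultimately show ?thesis unfolding nv_isomorphic_def by blast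
qed

lemma image_mset_H:
  assumes "v \<in> E"
  shows "{#f (h v). h \<in># mset_set H#} = {#f v, f (cneg v)#}"
  unfolding mset_set_H using assms by (simp add: sigma_eq)

lemma coset_nv_group_curve:
  assumes "inversion_quotient (curve_group a) \<pi> P" "regular_map E UNIV \<pi>"
  shows "coset_nv_group 2 \<lparr>cover = curve_group a, autos = H, orbits = UNIV, orbit_map = \<pi>,
      orbit_mult = mult_by 2 P\<rparr> (\<pi> curve_infty) Some"
proof -
  interpret inversion_quotient "curve_group a" \<pi> P by (rule assms(1))
  have "\<pi> u = \<pi> v \<longleftrightarrow> (\<exists>h\<in>H. v = h u)" if "u \<in> E" "v \<in> E" for u v
    using that eq_iff[of u v] by (simp add: H_eq sigma_eq)
  moreover have "mult_by 2 P (\<pi> u) (\<pi> v) = Some {#\<pi> (curve_add a u (h v)). h \<in># mset_set H#}"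
    if "u \<in> E" "v \<in> E" for u v
    using that mult_by_eq[of u v] image_mset_H[of v "\<lambda>w. \<pi> (curve_add a u w)"] by simp
  moreover have "\<exists>h\<in>H. cneg u = h u" if "u \<in> E" for u
    by (rule bexI[of _ "sigma a"]) (use that in \<open>simp_all add: H_eq sigma_eq\<close>)
  moreover have "\<pi> ` E = UNIV" using surj by simp
  ultimately show ?thesis
    unfolding coset_nv_group_def Let_def coset_data.simps
    using algebraic_group_curve subgroup_H card_H regular_H assms(2) by simp
qed

lemma coset_nv_group_D: "coset_nv_group 2 (coset_D a) infty Some"
  using coset_nv_group_curve[OF inversion_quotient_D regular_zeta_map]
  unfolding coset_D_def H_def by simp

lemma coset_nv_group_B: "coset_nv_group 2 (coset_B a) (cp1 0 1) Some"
  using coset_nv_group_curve[OF inversion_quotient_B regular_map_recip_comp[OF regular_zeta_map]]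
  unfolding coset_B_def H_def by (simp add: infty_def recip_cp1)

lemma mult_by_polyB_formula:
  assumes "(x1, x0) \<noteq> (0, 0)" "(y1, y0) \<noteq> (0, 0)"
    and u2: "u2 = (x1 * y0 - x0 * y1)^2"
    and u1: "- (1 / 2) * u1 =
           x1 * x0 * (2 * a $ 1 * y1 * y0 + a $ 2 * y1^2 + y0^2)
           + x1^2 * y1 * (a $ 2 * y0 + 2 * a $ 3 * y1) + x0^2 * y0 * y1"
    and u0: "u0 =
           x1^2 * y1 * ((a $ 2)^2 * y1 - 4 * a $ 3 * (a $ 1 * y1 + y0))
           - 2 * x0 * x1 * y1 * (a $ 2 * y0 + 2 * a $ 3 * y1) + x0^2 * y0^2"
  shows "(u2, u1, u0) \<noteq> (0, 0, 0)"
    and "mult_by 2 (polyB a) (cp1 x1 x0) (cp1 y1 y0) = Some (zeros_of_cp2 (cp2 u2 u1 u0))"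
proof -
  have f: "form_at 2 (polyB a) (vector [x1, x0]) (vector [y1, y0]) = [:u2, u1, u0:]"
  proof -
    have "u1 = - 2 * (- (1 / 2) * u1)" by simp
    then show ?thesis unfolding form_at_polyB u2 u0 u1 by simp
  qed
  have m: "mult_by 2 (polyB a) (cp1 x1 x0) (cp1 y1 y0) =
      (if [:u2, u1, u0:] = 0 then None else Some (binary_form_zeros 2 [:u2, u1, u0:]))"
    unfolding mult_by_cp1[OF assms(1,2)] f ..
  moreover have "mult_by 2 (polyB a) (cp1 x1 x0) (cp1 y1 y0) \<noteq> None"
    by (rule inversion_quotient.mult_by_defined[OF inversion_quotient_B])
  ultimately have nz: "[:u2, u1, u0:] \<noteq> 0"
    and e: "mult_by 2 (polyB a) (cp1 x1 x0) (cp1 y1 y0) = Some (binary_form_zeros 2 [:u2, u1, u0:])"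
    by (auto split: if_splits)
  show u: "(u2, u1, u0) \<noteq> (0, 0, 0)" using nz by auto
  obtain c where c: "c \<noteq> 0" "rep_proj (cp2 u2 u1 u0) = c *s vector [u2, u1, u0]"
    using rep_cp2[OF u] .
  have "zeros_of_cp2 (cp2 u2 u1 u0) = binary_form_zeros 2 (smult c [:u2, u1, u0:])"
    unfolding zeros_of_cp2_def Let_def c(2) by simp
  then show "mult_by 2 (polyB a) (cp1 x1 x0) (cp1 y1 y0) = Some (zeros_of_cp2 (cp2 u2 u1 u0))"
    unfolding e using binary_form_zeros_smult[OF c(1), of 2 "[:u2, u1, u0:]"] by metis
qed

end

section \<open>Injective regular maps of the projective line\<close>

lemma poly_funs_on_line:
  assumes "g \<in> poly_funs (range (\<lambda>i v. v $ i))"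
  shows "\<exists>q. \<forall>t. g (v + t *s w) = poly q t"
  using assms
proof induction
  case (const c)
  show ?case by (rule exI[of _ "[:c:]"]) simp
next
  case (coord f)
  then obtain i where "f = (\<lambda>v. v $ i)" by auto
  then show ?case by (intro exI[of _ "[:v $ i, w $ i:]"]) simp
next
  case (add f g)
  then show ?case by (metis poly_add)
next
  case (mult f g)
  then show ?case by (metis poly_mult)
qed

lemma poly_with_finite_nonroots_eq_0:
  fixes q :: "complex poly"
  assumes "finite T" "\<And>t. t \<notin> T \<Longrightarrow> poly q t = 0"
  shows "q = 0"
proof (rule ccontr)
  assume "q \<noteq> 0"
  then have "finite ({t. poly q t = 0} \<union> T)" using assms(1) poly_roots_finite by blast
  moreover have "{t. poly q t = 0} \<union> T = UNIV" using assms(2) by blast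
  ultimately show False using infinite_UNIV_char_0[where 'a = complex] by simp
qed

text \<open>Along the vectors \<open>v + t w\<close> the homogeneous coordinates of the map are polynomials in \<open>t\<close>. The chart at
  \<open>v\<close> is left only where some nonzero polynomial \<open>r\<close> vanishes.\<close>

lemma regular_map_on_line:
  assumes "regular_map UNIV UNIV (f :: 2 proj \<Rightarrow> 2 proj)" "v \<noteq> 0" "\<And>t. v + t *s w \<noteq> 0"
  obtains p q r where "poly r 0 \<noteq> (0 :: complex)"
    "\<And>t. poly r t \<noteq> 0 \<Longrightarrow> (poly p t, poly q t) \<noteq> (0, 0) \<and> f (abs_proj (v + t *s w)) = cp1 (poly p t) (poly q t)"
proof -
  obtain Z d and G :: "complex ^ 2 \<Rightarrow> complex ^ 2" where Z: "zariski_closed Z" "abs_proj v \<notin> Z"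
    and h: "\<forall>j. homogeneous d (\<lambda>v. G v $ j)"
    and G: "\<forall>v. v \<noteq> 0 \<and> abs_proj v \<in> UNIV - Z \<longrightarrow> G v \<noteq> 0 \<and> f (abs_proj v) = abs_proj (G v)"
    using assms(1) unfolding regular_map_def by blast
  obtain S where S: "\<forall>g\<in>S. \<exists>d. homogeneous d g" "Z = {p. \<forall>g\<in>S. g (rep_proj p) = 0}"
    using Z(1) unfolding zariski_closed_def by blast
  then obtain g e where g: "g \<in> S" "homogeneous e g" "g (rep_proj (abs_proj v)) \<noteq> 0"
    using Z(2) by blast
  have poly: "\<exists>q. \<forall>t. g (v + t *s w) = poly q t" if "homogeneous e g" for g e
    using poly_funs_on_line that unfolding homogeneous_def by blast
  obtain r where r: "\<And>t. g (v + t *s w) = poly r t" using poly[OF g(2)] by blast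
  obtain p where p: "\<And>t. G (v + t *s w) $ 1 = poly p t" using poly[of d "\<lambda>v. G v $ 1"] h by blast
  obtain q where q: "\<And>t. G (v + t *s w) $ 2 = poly q t" using poly[of d "\<lambda>v. G v $ 2"] h by blast
  have "poly r 0 \<noteq> 0" using r[of 0] g homogeneous_zero_iff[OF g(2) assms(2)] by simp
  moreover have "(poly p t, poly q t) \<noteq> (0, 0) \<and> f (abs_proj (v + t *s w)) = cp1 (poly p t) (poly q t)"
    if "poly r t \<noteq> 0" for t
  proof -
    have "g (rep_proj (abs_proj (v + t *s w))) \<noteq> 0"
      using that r homogeneous_zero_iff[OF g(2) assms(3)] by simp
    then have "abs_proj (v + t *s w) \<notin> Z" using S(2) g(1) by blast
    then have "G (v + t *s w) \<noteq> 0" "f (abs_proj (v + t *s w)) = abs_proj (G (v + t *s w))"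
      using G assms(3) by blast+
    then show ?thesis using p q by (auto simp: vec2_eq_iff abs_proj_cp1)
  qed
  ultimately show thesis using that by blast
qed

text \<open>On a line through a given point, parallelism of the coordinates of \<open>f\<close> and of the linear map is the
  vanishing of a polynomial, which has infinitely many zeros and hence vanishes at the point itself.\<close>

lemma regular_map_eq_linear:
  assumes f: "regular_map UNIV UNIV f" and "finite T"
    and L: "\<And>x y. (x, y) \<noteq> (0, 0) \<Longrightarrow> (\<alpha> * x + \<beta> * y, \<gamma> * x + \<delta> * y) \<noteq> (0, 0)"
    and eq: "\<And>x y. (x, y) \<noteq> (0, 0) \<Longrightarrow> cp1 x y \<notin> T \<Longrightarrow> f (cp1 x y) = cp1 (\<alpha> * x + \<beta> * y) (\<gamma> * x + \<delta> * y)"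
    and xy: "(x, y) \<noteq> (0, 0)"
  shows "f (cp1 x y) = cp1 (\<alpha> * x + \<beta> * y) (\<gamma> * x + \<delta> * y)"
proof -
  define w1 w2 :: complex where "w1 = (if y = 0 then 0 else 1)" and "w2 = (if y = 0 then 1 else 0)"
  have det: "x * w2 - y * w1 \<noteq> 0" using xy by (auto simp: w1_def w2_def)
  define v w :: "complex ^ 2" where "v = vector [x, y]" and "w = vector [w1, w2]"
  have nz: "(x + t * w1, y + t * w2) \<noteq> (0, 0)" for t
    using xy by (auto simp: w1_def w2_def)
  have ab: "abs_proj (v + t *s w) = cp1 (x + t * w1) (y + t * w2)" for t
    by (simp add: abs_proj_cp1 v_def w_def)
  have inj: "inj (\<lambda>t. cp1 (x + t * w1) (y + t * w2))"
  proof (rule injI)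
    fix s t assume "cp1 (x + s * w1) (y + s * w2) = cp1 (x + t * w1) (y + t * w2)"
    then have "(x + s * w1) * (y + t * w2) = (x + t * w1) * (y + s * w2)"
      by (simp only: cp1_eq_iff[OF nz nz])
    then have "(x * w2 - y * w1) * (t - s) = 0" by (simp add: algebra_simps)
    then show "s = t" using det by simp
  qed
  have v: "v \<noteq> 0" and vw: "\<And>t. v + t *s w \<noteq> 0"
    using xy nz by (auto simp: v_def w_def vec2_eq_iff)
  obtain p q r where r: "poly r 0 \<noteq> (0 :: complex)"
    and pq: "\<And>t. poly r t \<noteq> 0 \<Longrightarrow> (poly p t, poly q t) \<noteq> (0, 0) \<and>
       f (abs_proj (v + t *s w)) = cp1 (poly p t) (poly q t)"
    by (rule regular_map_on_line[OF f v vw]) blast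
  note pq = pq[unfolded ab]
  define l1 l2 where "l1 = [:\<alpha> * x + \<beta> * y, \<alpha> * w1 + \<beta> * w2:]" and "l2 = [:\<gamma> * x + \<delta> * y, \<gamma> * w1 + \<delta> * w2:]"
  have l: "poly l1 t = \<alpha> * (x + t * w1) + \<beta> * (y + t * w2)" "poly l2 t = \<gamma> * (x + t * w1) + \<delta> * (y + t * w2)" for t
    by (simp_all add: l1_def l2_def algebra_simps)
  define T' where "T' = {t. poly r t = 0} \<union> (\<lambda>t. cp1 (x + t * w1) (y + t * w2)) -` T"
  have "finite T'"
    unfolding T'_def using r poly_roots_finite[of r] finite_vimageI[OF \<open>finite T\<close> inj] by fastforce
  then have "p * l2 - l1 * q = 0"
  proof (rule poly_with_finite_nonroots_eq_0)
    fix t assume "t \<notin> T'"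
    then have "poly r t \<noteq> 0" "cp1 (x + t * w1) (y + t * w2) \<notin> T" by (auto simp: T'_def)
    then have "(poly p t, poly q t) \<noteq> (0, 0)" "cp1 (poly p t) (poly q t) = cp1 (poly l1 t) (poly l2 t)"
      using pq[of t] eq[OF nz[of t]] unfolding l by auto
    moreover have "(poly l1 t, poly l2 t) \<noteq> (0, 0)" unfolding l by (rule L[OF nz])
    ultimately show "poly (p * l2 - l1 * q) t = 0" by (simp add: cp1_eq_iff)
  qed
  then have "poly p 0 * poly l2 0 = poly l1 0 * poly q 0"
    by (metis poly_mult right_minus_eq)
  then have "cp1 (poly p 0) (poly q 0) = cp1 (poly l1 0) (poly l2 0)"
    using pq[OF r] L[OF xy] by (subst cp1_eq_iff) (auto simp: l)
  then show ?thesis using pq[OF r] by (simp add: l)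
qed

text \<open>If \<open>p / q\<close> is injective off a finite set, then for almost all \<open>c\<close> the polynomial \<open>p - c q\<close>
  has a single root, which is multiple if the degree is at least two. The Wronskian \<open>p' q - p q'\<close>
  then has infinitely many roots and vanishes, so that \<open>p\<close> and \<open>q\<close> are constant.\<close>

lemma degree_le_1_if_injective:
  fixes p q :: "complex poly"
  assumes "finite F" and cop: "coprime p q"
    and inj: "\<And>s t. s \<notin> F \<Longrightarrow> t \<notin> F \<Longrightarrow> cp1 (poly p s) (poly q s) = cp1 (poly p t) (poly q t) \<Longrightarrow> s = t"
  shows "degree p \<le> 1 \<and> degree q \<le> 1"
proof (rule ccontr)
  assume n: "\<not> (degree p \<le> 1 \<and> degree q \<le> 1)"
  have nr: "(poly p t, poly q t) \<noteq> (0, 0)" for t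
  proof
    assume "(poly p t, poly q t) = (0, 0)"
    then have "[:- t, 1:] dvd p" "[:- t, 1:] dvd q" by (simp_all add: poly_eq_0_iff_dvd)
    then have "is_unit [:- t, 1:]" using cop by (meson coprime_def)
    then show False by (simp add: is_unit_pCons_iff)
  qed
  define W where "W = pderiv p * q - p * pderiv q"
  define Bad where "Bad = (\<lambda>t. poly p t / poly q t) ` F \<union> {c. degree (p - smult c q) \<le> 1}"
  have "c = c'" if "degree (p - smult c q) \<le> 1" "degree (p - smult c' q) \<le> 1" for c c'
  proof (rule ccontr)
    assume "c \<noteq> c'"
    have "degree ((p - smult c q) - (p - smult c' q)) \<le> 1" using that by (rule degree_diff_le)
    moreover have "(p - smult c q) - (p - smult c' q) = smult (c' - c) q" by (simp add: smult_diff_left)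
    ultimately have q: "degree q \<le> 1" using \<open>c \<noteq> c'\<close> by simp
    have "degree ((p - smult c q) + smult c q) \<le> 1"
      by (rule degree_add_le) (use that q degree_smult_le[of c q] in auto)
    then show False using n q by simp
  qed
  then have "{c. degree (p - smult c q) \<le> 1} = {} \<or> (\<exists>c. {c. degree (p - smult c q) \<le> 1} = {c})" by blast
  then have "finite {c. degree (p - smult c q) \<le> 1}" by auto
  then have "finite Bad" using assms(1) by (simp add: Bad_def)
  then have "infinite (- Bad)" using infinite_UNIV_char_0[where 'a = complex] by (metis Compl_eq_Diff_UNIV finite_Diff2)
  moreover have "- Bad \<subseteq> (\<lambda>t. poly p t / poly q t) ` {t. poly W t = 0}"
  proof
    fix c assume c: "c \<in> - Bad"
    define g where "g = p - smult c q"
    have dg: "degree g \<ge> 2" using c by (simp add: Bad_def g_def)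
    have root: "poly q t \<noteq> 0 \<and> poly p t / poly q t = c \<and> t \<notin> F" if "poly g t = 0" for t
    proof -
      have e: "poly p t = c * poly q t" using that by (simp add: g_def)
      then have "poly q t \<noteq> 0" using nr[of t] by auto
      moreover from this have "poly p t / poly q t = c" using e by simp
      ultimately show ?thesis using c unfolding Bad_def by blast
    qed
    have uniq: "s = t" if "poly g s = 0" "poly g t = 0" for s t
      using root[OF that(1)] root[OF that(2)] nr by (intro inj) (auto simp: cp1_eq_iff field_simps)
    have "\<not> constant (poly g)" using dg by (simp add: constant_degree)
    then obtain t where t: "poly g t = 0" using fundamental_theorem_of_algebra by blast
    then obtain h where h: "g = [:- t, 1:] * h" by (auto simp: poly_eq_0_iff_dvd)
    then have "h \<noteq> 0" using dg by auto
    then have "degree g = 1 + degree h" unfolding h by (subst degree_mult_eq) auto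
    then have "\<not> constant (poly h)" using dg by (simp add: constant_degree)
    then obtain s where s: "poly h s = 0" using fundamental_theorem_of_algebra by blast
    then have "poly g s = 0" by (simp add: h)
    then have "poly h t = 0" using uniq[OF _ t] s by blast
    then have "poly (pderiv g) t = 0" unfolding h pderiv_mult by (simp add: pderiv_pCons del: mult_pCons_left)
    then have d: "poly (pderiv p) t = c * poly (pderiv q) t" by (simp add: g_def pderiv_diff pderiv_smult)
    have "poly p t = c * poly q t" using t by (simp add: g_def)
    then have "poly W t = 0" using d by (simp add: W_def)
    then show "c \<in> (\<lambda>t. poly p t / poly q t) ` {t. poly W t = 0}" using root[OF t] by force
  qed
  ultimately have "infinite {t. poly W t = 0}" using finite_surj by blast
  then have "W = 0" using poly_roots_finite by blast
  then have W: "pderiv p * q = p * pderiv q" by (simp add: W_def)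
  have "pderiv u = 0" if "coprime u v" "u dvd pderiv u * v" for u v :: "complex poly"
  proof (rule ccontr)
    assume nz: "pderiv u \<noteq> 0"
    have "u dvd pderiv u" using that by (simp add: coprime_dvd_mult_left_iff)
    then have "degree u \<le> degree (pderiv u)" using nz by (rule dvd_imp_degree_le)
    moreover have "degree u \<noteq> 0" using nz by (simp add: pderiv_eq_0_iff)
    ultimately show False by (simp add: degree_pderiv)
  qed
  moreover have "p dvd pderiv p * q" unfolding W by simp
  moreover have "q dvd pderiv q * p" using W by (metis dvd_triv_right mult.commute)
  ultimately have "pderiv p = 0" "pderiv q = 0" using cop coprime_commute by blast+
  then show False using n by (simp add: pderiv_eq_0_iff)
qed

lemma injective_regular_map_linear:
  assumes f: "regular_map UNIV UNIV f" "inj f"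
  obtains \<alpha> \<beta> \<gamma> \<delta> where "\<alpha> * \<delta> - \<beta> * \<gamma> \<noteq> 0"
    "\<And>x y. (x, y) \<noteq> (0, 0) \<Longrightarrow> f (cp1 x y) = cp1 (\<alpha> * x + \<beta> * y) (\<gamma> * x + \<delta> * y)"
proof -
  define v w :: "complex ^ 2" where "v = vector [0, 1]" and "w = vector [1, 0]"
  have ab: "abs_proj (v + t *s w) = cp1 t 1" for t
    by (simp add: abs_proj_cp1 v_def w_def)
  have v: "v \<noteq> 0" and vw: "\<And>t. v + t *s w \<noteq> 0" by (auto simp: v_def w_def vec2_eq_iff)
  obtain p q r where r: "poly r 0 \<noteq> (0 :: complex)"
    and pq: "\<And>t. poly r t \<noteq> 0 \<Longrightarrow> (poly p t, poly q t) \<noteq> (0, 0) \<and>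
       f (abs_proj (v + t *s w)) = cp1 (poly p t) (poly q t)"
    by (rule regular_map_on_line[OF f(1) v vw]) blast
  note pq = pq[unfolded ab]
  define F where "F = {t. poly r t = 0}"
  have F: "finite F" unfolding F_def using r poly_roots_finite[of r] by fastforce
  have "p \<noteq> 0 \<or> q \<noteq> 0" using pq[OF r] by auto
  then obtain p' q' where p': "p = p' * gcd p q" "q = q' * gcd p q" "coprime p' q'"
    using gcd_coprime_exists[of p q] by auto
  have pq': "(poly p' t, poly q' t) \<noteq> (0, 0) \<and> f (cp1 t 1) = cp1 (poly p' t) (poly q' t)" if "t \<notin> F" for t
  proof -
    have a: "(poly p t, poly q t) \<noteq> (0, 0)" "f (cp1 t 1) = cp1 (poly p t) (poly q t)"
      using pq[of t] that by (auto simp: F_def)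
    have b: "poly p t = poly (gcd p q) t * poly p' t" "poly q t = poly (gcd p q) t * poly q' t"
      using p'(1,2) by (metis poly_mult mult.commute)+
    have "poly (gcd p q) t \<noteq> 0" "(poly p' t, poly q' t) \<noteq> (0, 0)" using a(1) b by auto
    then show ?thesis using a(2) b cp1_scale by simp
  qed
  have inj: "s = t" if "s \<notin> F" "t \<notin> F" "cp1 (poly p' s) (poly q' s) = cp1 (poly p' t) (poly q' t)" for s t
  proof -
    have "f (cp1 s 1) = f (cp1 t 1)" using pq'[OF that(1)] pq'[OF that(2)] that(3) by simp
    then have "cp1 s 1 = cp1 t 1" using f(2) by (simp add: inj_eq)
    then show ?thesis by simp
  qed
  \<comment> \<open>after division by the gcd the map has degree one; injectivity also makes the determinant nonzero\<close>
  have "degree p' \<le> 1 \<and> degree q' \<le> 1"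
    by (rule degree_le_1_if_injective[OF F p'(3) inj])
  moreover have "u = [:coeff u 0, coeff u 1:]" if "degree u \<le> 1" for u :: "complex poly"
    using that by (intro poly_eqI) (auto simp: coeff_pCons coeff_eq_0 split: nat.split)
  ultimately obtain \<alpha> \<beta> \<gamma> \<delta> where p'': "p' = [:\<beta>, \<alpha>:]" and q'': "q' = [:\<delta>, \<gamma>:]"
    by blast
  have det: "\<alpha> * \<delta> - \<beta> * \<gamma> \<noteq> 0"
  proof
    assume d: "\<alpha> * \<delta> - \<beta> * \<gamma> = 0"
    have inf: "infinite (- F)"
      using F infinite_UNIV_char_0[where 'a = complex] by (metis Compl_eq_Diff_UNIV finite_Diff2)
    then obtain s where s: "s \<notin> F" by (metis ComplD ex_in_conv finite.emptyI)
    then obtain t where t: "t \<notin> F" "t \<noteq> s"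
      using inf by (metis ComplD finite.emptyI finite_insert finite_subset insertCI subsetI)
    have "poly p' s * poly q' t - poly p' t * poly q' s = (\<alpha> * \<delta> - \<beta> * \<gamma>) * (s - t)"
      unfolding p'' q'' by (simp add: algebra_simps)
    then have "poly p' s * poly q' t = poly p' t * poly q' s" using d by simp
    then have "cp1 (poly p' s) (poly q' s) = cp1 (poly p' t) (poly q' t)"
      using pq'[OF s] pq'[OF t(1)] cp1_eq_iff by blast
    then show False using inj[OF s t(1)] t(2) by simp
  qed
  have L: "(\<alpha> * x + \<beta> * y, \<gamma> * x + \<delta> * y) \<noteq> (0, 0)" if "(x, y) \<noteq> (0, 0)" for x y
  proof
    assume "(\<alpha> * x + \<beta> * y, \<gamma> * x + \<delta> * y) = (0, 0)"
    then have z: "\<alpha> * x + \<beta> * y = 0" "\<gamma> * x + \<delta> * y = 0" by auto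
    have "(\<alpha> * \<delta> - \<beta> * \<gamma>) * x = \<delta> * (\<alpha> * x + \<beta> * y) - \<beta> * (\<gamma> * x + \<delta> * y)"
      "(\<alpha> * \<delta> - \<beta> * \<gamma>) * y = \<alpha> * (\<gamma> * x + \<delta> * y) - \<gamma> * (\<alpha> * x + \<beta> * y)"
      by (simp_all add: algebra_simps)
    then show False using z det that by simp
  qed
  define T where "T = insert infty ((\<lambda>t. cp1 t 1) ` F)"
  have "finite T" using F by (simp add: T_def)
  moreover have "f (cp1 x y) = cp1 (\<alpha> * x + \<beta> * y) (\<gamma> * x + \<delta> * y)"
    if "(x, y) \<noteq> (0, 0)" "cp1 x y \<notin> T" for x y
  proof -
    have "\<exists>t. cp1 x y = cp1 t 1 \<and> t \<notin> F"
      using cp1_affine_or_infty[of "cp1 x y"] that(2) by (auto simp: T_def)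
    then obtain t where t: "cp1 x y = cp1 t 1" "t \<notin> F" by blast
    have xt: "x = t * y" using t(1) that(1) by (simp add: cp1_eq_iff)
    then have y: "y \<noteq> 0" using that(1) by auto
    have "f (cp1 x y) = cp1 (poly p' t) (poly q' t)" using pq'[OF t(2)] t(1) by simp
    also have "\<dots> = cp1 (y * poly p' t) (y * poly q' t)" using pq'[OF t(2)] y by (simp add: cp1_scale)
    also have "\<dots> = cp1 (\<alpha> * x + \<beta> * y) (\<gamma> * x + \<delta> * y)"
      unfolding p'' q'' xt by (simp add: algebra_simps)
    finally show ?thesis .
  qed
  ultimately have "f (cp1 x y) = cp1 (\<alpha> * x + \<beta> * y) (\<gamma> * x + \<delta> * y)" if "(x, y) \<noteq> (0, 0)" for x y
    using regular_map_eq_linear[OF f(1) _ L] that by blast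
  then show thesis using that det by blast
qed

section \<open>The j-invariant\<close>

text \<open>The coefficients of the cubics when \<open>f'(c\<^sup>2 x + r) = c\<^sup>6 f(x)\<close>, i.e. when
  \<open>(\<zeta>, \<eta>) \<mapsto> (c\<^sup>2 \<zeta> + r, c\<^sup>3 \<eta>)\<close> maps one curve to the other.\<close>

definition scaled :: "complex ^ 3 \<Rightarrow> complex ^ 3 \<Rightarrow> complex \<Rightarrow> complex \<Rightarrow> bool" where
  "scaled a a' c r \<longleftrightarrow> c \<noteq> 0 \<and> c^2 * a $ 1 = 3 * r + a' $ 1 \<and>
     c^4 * a $ 2 = 3 * r^2 + 2 * a' $ 1 * r + a' $ 2 \<and>
     c^6 * a $ 3 = r^3 + a' $ 1 * r^2 + a' $ 2 * r + a' $ 3"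

definition scale_point :: "complex \<Rightarrow> complex \<Rightarrow> 3 proj \<Rightarrow> 3 proj" where
  "scale_point c r p = (if p = curve_infty then curve_infty else cp2 (c^2 * zeta p + r) (c^3 * eta p) 1)"

lemma scale_point_simps [simp]:
  "scale_point c r curve_infty = curve_infty"
  "scale_point c r (cp2 x y 1) = cp2 (c^2 * x + r) (c^3 * y) 1"
  by (simp_all add: scale_point_def)

lemma scaled_cubic:
  assumes "scaled a a' c r"
  shows "cubic a' (c^2 * x + r) = c^6 * cubic a x"
proof -
  have "c^6 * cubic a x = c^6 * x^3 + c^4 * (c^2 * a $ 1) * x^2 + c^2 * (c^4 * a $ 2) * x + c^6 * a $ 3"
    unfolding cubic_def by algebra
  also have "\<dots> = cubic a' (c^2 * x + r)"
    using assms unfolding scaled_def cubic_def by algebra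
  finally show ?thesis by simp
qed

lemma scaled_sym:
  assumes "scaled a a' c r"
  shows "scaled a' a (1 / c) (- (r / c^2))"
proof -
  have c: "c \<noteq> 0" and a1: "a $ 1 = (3 * r + a' $ 1) / c^2"
    and a2: "a $ 2 = (3 * r^2 + 2 * a' $ 1 * r + a' $ 2) / c^4"
    and a3: "a $ 3 = (r^3 + a' $ 1 * r^2 + a' $ 2 * r + a' $ 3) / c^6"
    using assms unfolding scaled_def by (auto simp: nonzero_eq_divide_eq mult.commute)
  have p: "c^4 = c^2 * c^2" "c^6 = c^2 * c^2 * c^2" by algebra+
  show ?thesis
    using c unfolding scaled_def a1 a2 a3 power_one_over p
    by (simp add: field_simps power2_eq_square power3_eq_cube)
qed

lemma scale_point_inverse:
  assumes "c \<noteq> 0" "p \<in> curve_points a"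
  shows "scale_point (1 / c) (- (r / c^2)) (scale_point c r p) = p"
  using assms(2)
proof (cases rule: curve_points_cases)
  case (affine x y)
  have "1 / d * (d * x + r) + - (r / d) = x" "1 / d * (d * y) = y" if "d \<noteq> 0" for d
    using that by (simp_all add: distrib_left)
  from this(1)[of "c^2"] this(2)[of "c^3"] show ?thesis
    using affine assms(1) by (simp add: power_one_over)
qed simp

lemma scale_point_in_curve:
  assumes "scaled a a' c r" "p \<in> curve_points a"
  shows "scale_point c r p \<in> curve_points a'"
  using assms(2)
proof (cases rule: curve_points_cases)
  case (affine x y)
  have "(c^3 * y)^2 = c^6 * y^2" by algebra
  then show ?thesis using affine scaled_cubic[OF assms(1)] by simp
qed simp

lemma scale_point_cneg: "p \<in> curve_points a \<Longrightarrow> scale_point c r (cneg p) = cneg (scale_point c r p)"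
  by (erule curve_points_cases) auto

text \<open>The line \<open>\<eta> = l \<zeta> + m\<close> goes to the line of slope \<open>c l\<close>.\<close>

lemma scale_point_zero_sum:
  assumes s: "scaled a a' c r" and "zero_sum a P Q R" "P \<in> curve_points a" "Q \<in> curve_points a" "R \<in> curve_points a"
  shows "zero_sum a' (scale_point c r P) (scale_point c r Q) (scale_point c r R)"
proof -
  consider "P = curve_infty \<and> R = cneg Q" | "Q = curve_infty \<and> P = cneg R"
    | "R = curve_infty \<and> Q = cneg P"
    | l m x1 x2 x3 where "line_cuts a l m x1 x2 x3" "P = cp2 x1 (l * x1 + m) 1"
        "Q = cp2 x2 (l * x2 + m) 1" "R = cp2 x3 (l * x3 + m) 1"
    using assms(2) unfolding zero_sum_def by blast
  then show ?thesis
  proof cases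
    case 4
    define l' m' where "l' = c * l" and "m' = c^3 * m - c * l * r"
    have y: "c^3 * (l * x + m) = l' * (c^2 * x + r) + m'" for x
      unfolding l'_def m'_def by algebra
    have a1: "a' $ 1 = c^2 * a $ 1 - 3 * r"
      and a2: "a' $ 2 = c^4 * a $ 2 - 3 * r^2 - 2 * a' $ 1 * r"
      and a3: "a' $ 3 = c^6 * a $ 3 - r^3 - a' $ 1 * r^2 - a' $ 2 * r"
      using s unfolding scaled_def by (auto simp: algebra_simps)
    have L: "a $ 1 = l^2 - (x1 + x2 + x3)" "a $ 2 = 2 * l * m + (x1 * x2 + x1 * x3 + x2 * x3)"
      "a $ 3 = m^2 - x1 * x2 * x3" using 4(1) unfolding line_cuts_def by auto
    have 1: "a' $ 1 = l'^2 - (c^2 * x1 + r + (c^2 * x2 + r) + (c^2 * x3 + r))"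
      unfolding a1 L l'_def by algebra
    have 2: "a' $ 2 = 2 * l' * m' + ((c^2 * x1 + r) * (c^2 * x2 + r) + (c^2 * x1 + r) * (c^2 * x3 + r) + (c^2 * x2 + r) * (c^2 * x3 + r))"
      unfolding a2 1 L l'_def m'_def by algebra
    have 3: "a' $ 3 = m'^2 - (c^2 * x1 + r) * (c^2 * x2 + r) * (c^2 * x3 + r)"
      unfolding a3 2 1 L l'_def m'_def by algebra
    have "line_cuts a' l' m' (c^2 * x1 + r) (c^2 * x2 + r) (c^2 * x3 + r)"
      unfolding line_cuts_def using 1 2 3 by blast
    moreover have "scale_point c r P = cp2 (c^2 * x1 + r) (l' * (c^2 * x1 + r) + m') 1"
      "scale_point c r Q = cp2 (c^2 * x2 + r) (l' * (c^2 * x2 + r) + m') 1"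
      "scale_point c r R = cp2 (c^2 * x3 + r) (l' * (c^2 * x3 + r) + m') 1"
      unfolding 4 scale_point_simps y by (rule refl)+
    ultimately show ?thesis unfolding zero_sum_def by blast
  qed (use assms(3-5) in \<open>auto simp: zero_sum_def scale_point_cneg\<close>)
qed

lemma regular_scale_point:
  assumes "delta a \<noteq> 0" "scaled a a' c r"
  shows "regular_map (curve_points a) (curve_points a') (scale_point c r)"
proof (rule regular_map_linear[where G = "\<lambda>v. vector [c^2 * v $ 1 + r * v $ 3, c^3 * v $ 2, v $ 3]"])
  interpret elliptic_curve a by unfold_locales (rule assms)
  show "scale_point c r ` curve_points a \<subseteq> curve_points a'"
    using scale_point_in_curve[OF assms(2)] by blast
  show "homogeneous 1 (\<lambda>v::complex^3. (vector [c^2 * v $ 1 + r * v $ 3, c^3 * v $ 2, v $ 3] :: complex ^ 3) $ j)" for j :: 3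
    using exhaust_3[of j]
    by (elim disjE; simp; intro homogeneous_add homogeneous_cmult homogeneous_coord[simplified])
  have c: "c \<noteq> 0" using assms(2) by (simp add: scaled_def)
  show "vector [c^2 * v $ 1 + r * v $ 3, c^3 * v $ 2, v $ 3] \<noteq> (0 :: complex ^ 3) \<and>
      scale_point c r (abs_proj v) = abs_proj (vector [c^2 * v $ 1 + r * v $ 3, c^3 * v $ 2, v $ 3])"
    if "v \<noteq> 0" "abs_proj v \<in> curve_points a" for v
    using that
  proof (cases rule: curve_cone)
    case infty
    have "cp2 (c^3 * v $ 2 * 0) (c^3 * v $ 2 * 1) (c^3 * v $ 2 * 0) = cp2 0 1 0"
      by (rule cp2_scale) (use c infty in auto)
    moreover have "scale_point c r (abs_proj v) = cp2 0 1 0"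
      unfolding infty(4) by (simp add: curve_infty_def[symmetric])
    ultimately show ?thesis using infty(1-3) c by (simp add: vec3_eq_iff cp2_def)
  next
    case affine
    have "cp2 (v $ 3 * (c^2 * (v $ 1 / v $ 3) + r)) (v $ 3 * (c^3 * (v $ 2 / v $ 3))) (v $ 3 * 1) =
        cp2 (c^2 * (v $ 1 / v $ 3) + r) (c^3 * (v $ 2 / v $ 3)) 1"
      by (rule cp2_scale) (use affine in auto)
    moreover have "v $ 3 * (c^2 * (v $ 1 / v $ 3) + r) = c^2 * v $ 1 + r * v $ 3"
      "v $ 3 * (c^3 * (v $ 2 / v $ 3)) = c^3 * v $ 2"
      using affine(1) by (simp_all add: distrib_left)
    moreover have "scale_point c r (abs_proj v) = cp2 (c^2 * (v $ 1 / v $ 3) + r) (c^3 * (v $ 2 / v $ 3)) 1"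
      unfolding affine(2) by simp
    ultimately show ?thesis using affine(1) by (simp add: vec3_eq_iff cp2_def)
  qed
qed

lemma iso_scale_point:
  assumes "delta a \<noteq> 0" "delta a' \<noteq> 0" "scaled a a' c r"
  shows "scale_point c r \<in> iso (curve_group a) (curve_group a')"
    and "variety_iso (curve_points a) (curve_points a') (scale_point c r)"
proof -
  interpret A: elliptic_curve a by unfold_locales (rule assms)
  interpret B: elliptic_curve a' by unfold_locales (rule assms)
  have c: "c \<noteq> 0" using assms(3) by (simp add: scaled_def)
  let ?g = "scale_point (1 / c) (- (r / c^2))"
  have inv1: "?g (scale_point c r p) = p" if "p \<in> A.E" for p
    using scale_point_inverse[OF c that] .
  have inv2: "scale_point c r (?g p) = p" if "p \<in> B.E" for p
    using scale_point_inverse[OF _ that, of "1 / c" "- (r / c^2)"] c by (simp add: power_one_over)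
  have bij: "bij_betw (scale_point c r) A.E B.E"
    by (rule bij_betw_byWitness[where f' = ?g])
      (use inv1 inv2 scale_point_in_curve[OF assms(3)] scale_point_in_curve[OF scaled_sym[OF assms(3)]] in auto)
  have hom: "scale_point c r (curve_add a P Q) = curve_add a' (scale_point c r P) (scale_point c r Q)"
    if "P \<in> A.E" "Q \<in> A.E" for P Q
  proof -
    have s: "curve_add a P Q \<in> A.E" using that by (rule A.curve_add_closed)
    have "zero_sum a' (scale_point c r P) (scale_point c r Q) (scale_point c r (cneg (curve_add a P Q)))"
      by (rule scale_point_zero_sum[OF assms(3) A.zero_sum_curve_add]) (use that s in auto)
    then have "curve_add a' (scale_point c r P) (scale_point c r Q) = cneg (scale_point c r (cneg (curve_add a P Q)))"
      by (rule B.curve_add_eq_if_zero_sum) (use that s scale_point_in_curve[OF assms(3)] in auto)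
    then show ?thesis using s scale_point_in_curve[OF assms(3) s] by (simp add: scale_point_cneg cneg_cneg)
  qed
  show "scale_point c r \<in> iso (curve_group a) (curve_group a')"
    unfolding iso_def hom_def using bij hom scale_point_in_curve[OF assms(3)] by auto
  show "variety_iso (curve_points a) (curve_points a') (scale_point c r)"
    unfolding variety_iso_def
    using regular_scale_point[OF assms(1,3)] regular_scale_point[OF assms(2) scaled_sym[OF assms(3)]] inv1 inv2
    by blast
qed

text \<open>In the coordinates \<open>(x\<^sub>1 : x\<^sub>0)\<close> of the orbit space of \<^const>\<open>coset_B\<close>, in which the abscissa is
  \<open>x\<^sub>0 / x\<^sub>1\<close>, the substitution \<open>\<zeta> \<mapsto> c\<^sup>2 \<zeta> + r\<close> is the linear map
  \<open>(x\<^sub>1 : x\<^sub>0) \<mapsto> (x\<^sub>1 : r x\<^sub>1 + c\<^sup>2 x\<^sub>0)\<close>.\<close>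

lemma coset_isomorphic_if_scaled:
  assumes "delta a \<noteq> 0" "delta a' \<noteq> 0" "scaled a a' c r"
  shows "coset_isomorphic (coset_B a) (coset_B a')"
proof -
  interpret A: elliptic_curve a by unfold_locales (rule assms)
  interpret B: elliptic_curve a' by unfold_locales (rule assms)
  have c: "c \<noteq> 0" using assms(3) by (simp add: scaled_def)
  let ?\<phi> = "scale_point c r"
  define \<psi> where "\<psi> r c p = cp1 (rep_proj p $ 1) (r * rep_proj p $ 1 + c^2 * rep_proj p $ 2)" for r c :: complex and p :: "2 proj"
  have \<psi>: "\<psi> r c (cp1 x y) = cp1 x (r * x + c^2 * y)" if "(x, y) \<noteq> (0, 0)" "c \<noteq> 0" for r c x y
  proof -
    from rep_cp1[OF that(1)]
    obtain k where k: "k \<noteq> 0" "rep_proj (cp1 x y) $ 1 = k * x" "rep_proj (cp1 x y) $ 2 = k * y"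
      by blast
    have "(x, r * x + c^2 * y) \<noteq> (0, 0)" using that by auto
    from cp1_scale[OF k(1) this] show ?thesis unfolding \<psi>_def k by (simp add: algebra_simps)
  qed
  have reg: "regular_map UNIV UNIV (\<psi> r c)" if "c \<noteq> 0" for r c
    by (rule regular_map_cp1_linear[of 1 0 r "c^2"]) (use that \<psi> in auto)
  have "\<psi> (- (r / c^2)) (1 / c) (\<psi> r c p) = p" if "c \<noteq> 0" for r c p
  proof -
    obtain x y where xy: "(x, y) \<noteq> (0, 0)" "p = cp1 x y" by (rule cp1_cases)
    have "(x, r * x + c^2 * y) \<noteq> (0, 0)" using that xy by auto
    then have "\<psi> (- (r / c^2)) (1 / c) (\<psi> r c p) = cp1 x (- (r / c^2) * x + (1 / c)^2 * (r * x + c^2 * y))"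
      using \<psi> xy that by simp
    also have "- (r / c^2) * x + (1 / c)^2 * (r * x + c^2 * y) = y"
      using that by (simp add: distrib_left power_one_over)
    finally show ?thesis using xy by simp
  qed
  from this[OF c, of r] this[of "1 / c" "- (r / c^2)"] c
  have inv: "\<psi> (- (r / c^2)) (1 / c) (\<psi> r c p) = p" "\<psi> r c (\<psi> (- (r / c^2)) (1 / c) p) = p" for p
    by (simp_all add: power_one_over)
  have iso: "variety_iso UNIV UNIV (\<psi> r c)"
    unfolding variety_iso_def using reg[OF c] reg[of "1 / c" "- (r / c^2)"] inv c by auto
  have proj: "\<psi> r c (recip (zeta_map m)) = recip (zeta_map (?\<phi> m))" if "m \<in> A.E" for m
    using that
  proof (cases rule: curve_points_cases)
    case infty
    have "cp1 0 (c^2) = cp1 0 1" using c by (simp add: cp1_eq_iff)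
    then show ?thesis using infty \<psi>[of 0 1 c r] c by (simp add: infty_def recip_cp1)
  next
    case (affine x y)
    then show ?thesis using \<psi>[of 1 x c r] c by (simp add: recip_cp1 add.commute)
  qed
  have hom: "?\<phi> (curve_add a P Q) = curve_add a' (?\<phi> P) (?\<phi> Q)" if "P \<in> A.E" "Q \<in> A.E" for P Q
    using iso_scale_point(1)[OF assms] that unfolding iso_def hom_def by simp
  have inE: "?\<phi> P \<in> B.E" if "P \<in> A.E" for P
    using scale_point_in_curve[OF assms(3) that] .
  have cov: "image_mset ?\<phi> {#curve_add a m1 (h m2). h \<in># mset_set A.H#} =
      {#curve_add a' (?\<phi> m1) (h (?\<phi> m2)). h \<in># mset_set B.H#}" if "m1 \<in> A.E" "m2 \<in> A.E" for m1 m2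
    using that A.image_mset_H[of m2 "curve_add a m1"] B.image_mset_H[of "?\<phi> m2" "curve_add a' (?\<phi> m1)"]
    by (simp add: hom inE scale_point_cneg)
  have mult: "map_option (image_mset (\<psi> r c)) (mult_by 2 (polyB a) x y) = mult_by 2 (polyB a') (\<psi> r c x) (\<psi> r c y)" for x y
  proof -
    interpret QA: inversion_quotient "curve_group a" "recip \<circ> zeta_map" "polyB a"
      by (rule A.inversion_quotient_B)
    obtain u where u: "u \<in> A.E" "x = recip (zeta_map u)" using QA.lift[of x] by auto
    obtain v where v: "v \<in> A.E" "y = recip (zeta_map v)" using QA.lift[of y] by auto
    note uv = u v
    show ?thesis
      unfolding uv proj[OF uv(1)] proj[OF uv(3)]
      using uv(1,3) by (simp add: A.mult_by_polyB B.mult_by_polyB proj hom inE scale_point_cneg A.curve_add_closed)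
  qed
  show ?thesis
    unfolding coset_isomorphic_def coset_B_def coset_data.simps
    using iso_scale_point[OF assms] iso proj cov mult unfolding A.H_def B.H_def
    by (intro exI[of _ ?\<phi>] exI[of _ "\<psi> r c"]) simp
qed

text \<open>With these expressions as \<open>p\<close> and \<open>q\<close>, the cubic is
  \<open>f(x) = (x + a\<^sub>1 / 3)\<^sup>3 + (p / 3) (x + a\<^sub>1 / 3) + q / 27\<close>. Rescaling multiplies them by \<open>c\<^sup>4\<close> and \<open>c\<^sup>6\<close>.\<close>

definition jp :: "complex ^ 3 \<Rightarrow> complex" where "jp a = 3 * a $ 2 - (a $ 1)^2"
definition jq :: "complex ^ 3 \<Rightarrow> complex" where "jq a = 27 * a $ 3 - 9 * a $ 1 * a $ 2 + 2 * (a $ 1)^3"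

lemma j_invariant_eq: "j_invariant a = 6912 * jp a ^ 3 / (4 * jp a ^ 3 + jq a ^ 2)"
  by (simp add: j_invariant_def jp_def jq_def)

lemma jpq_delta: "4 * jp a ^ 3 + jq a ^ 2 = - 27 * delta a"
  unfolding delta_eq jp_def jq_def by algebra

lemma scaled_if_jpq:
  assumes "c \<noteq> 0" "jp a' = c^4 * jp a" "jq a' = c^6 * jq a"
  shows "scaled a a' c ((c^2 * a $ 1 - a' $ 1) / 3)"
proof -
  define r where "r = (c^2 * a $ 1 - a' $ 1) / 3"
  have a1: "a' $ 1 = c^2 * a $ 1 - 3 * r" by (simp add: r_def)
  have "3 * (c^4 * a $ 2) = 3 * (3 * r^2 + 2 * a' $ 1 * r + a' $ 2)"
    using assms(2) unfolding jp_def a1 by algebra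
  then have a2: "c^4 * a $ 2 = 3 * r^2 + 2 * a' $ 1 * r + a' $ 2"
    by (subst (asm) mult_left_cancel) auto
  then have a2': "a' $ 2 = c^4 * a $ 2 - 3 * r^2 - 2 * (c^2 * a $ 1 - 3 * r) * r" unfolding a1 by algebra
  have "27 * (c^6 * a $ 3) = 27 * (r^3 + a' $ 1 * r^2 + a' $ 2 * r + a' $ 3)"
    using assms(3) unfolding jq_def a1 a2' by algebra
  then have "c^6 * a $ 3 = r^3 + a' $ 1 * r^2 + a' $ 2 * r + a' $ 3"
    by (subst (asm) mult_left_cancel) auto
  then show ?thesis unfolding scaled_def r_def[symmetric] using assms(1) a1 a2 by auto
qed

lemma complex_root_exists:
  assumes "n > 0"
  shows "\<exists>c :: complex. c ^ n = z"
proof -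
  have "\<not> constant (poly (Polynomial.monom 1 n - [:z:]))"
  proof -
    have "degree (Polynomial.monom 1 n - [:z:]) = n"
      unfolding diff_conv_add_uminus using assms by (subst degree_add_eq_left) (simp_all add: degree_monom_eq)
    then show ?thesis using assms by (simp add: constant_degree)
  qed
  then obtain c where "poly (Polynomial.monom 1 n - [:z:]) c = 0"
    using fundamental_theorem_of_algebra by blast
  then show ?thesis by (intro exI[of _ c]) (simp add: poly_monom)
qed

text \<open>Equality of the \<open>j\<close>-invariants means \<open>p\<^sup>3 q'\<^sup>2 = p'\<^sup>3 q\<^sup>2\<close>, so that \<open>c\<^sup>2 = q' p / (q p')\<close> solves both
  equations unless one of \<open>p\<close>, \<open>q\<close> vanishes, when a single root extraction is enough.\<close>

lemma jpq_if_j_eq: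
  assumes "delta a \<noteq> 0" "delta a' \<noteq> 0" "j_invariant a = j_invariant a'"
  obtains c where "c \<noteq> 0" "jp a' = c^4 * jp a" "jq a' = c^6 * jq a"
proof -
  define p q p' q' where "p = jp a" and "q = jq a" and "p' = jp a'" and "q' = jq a'"
  have nz: "4 * p^3 + q^2 \<noteq> 0" "4 * p'^3 + q'^2 \<noteq> 0"
    using assms(1,2) unfolding p_def q_def p'_def q'_def jpq_delta by simp_all
  have "p^3 / (4 * p^3 + q^2) = p'^3 / (4 * p'^3 + q'^2)"
    using assms(3) unfolding j_invariant_eq p_def q_def p'_def q'_def by (simp add: times_divide_eq_right[symmetric] del: times_divide_eq_right)
  then have "p^3 * (4 * p'^3 + q'^2) = p'^3 * (4 * p^3 + q^2)"
    using nz by (simp add: frac_eq_eq)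
  then have e: "p^3 * q'^2 = p'^3 * q^2" by algebra
  have "\<exists>c. c \<noteq> 0 \<and> p' = c^4 * p \<and> q' = c^6 * q"
  proof (cases "p = 0")
    case True
    then have q: "q \<noteq> 0" using nz by auto
    then have "p' = 0" using e True by auto
    then have q': "q' \<noteq> 0" using nz by auto
    obtain c where c: "c^6 = q' / q" using complex_root_exists[of 6] by auto
    then have "c \<noteq> 0" using q q' by auto
    then show ?thesis using c q True \<open>p' = 0\<close> by auto
  next
    case False
    then have p: "p \<noteq> 0" .
    have p': "p' \<noteq> 0"
    proof
      assume "p' = 0"
      then have "q' = 0" using e p by auto
      then show False using nz \<open>p' = 0\<close> by simp
    qed
    show ?thesis
    proof (cases "q = 0")
      case True
      then have "q' = 0" using e p by auto
      obtain c where c: "c^4 = p' / p" using complex_root_exists[of 4] by auto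
      then have "c \<noteq> 0" using p p' by auto
      then show ?thesis using c p True \<open>q' = 0\<close> by auto
    next
      case False
      then have q': "q' \<noteq> 0" using e p' by auto
      obtain c where c: "c^2 = q' * p / (q * p')" using complex_root_exists[of 2] by auto
      then have c0: "c \<noteq> 0" using p p' q' False by auto
      have "c^4 * p = (c^2)^2 * p" by algebra
      also have "\<dots> = p^3 * q'^2 / (q^2 * p'^2)" unfolding c by (simp add: power2_eq_square power3_eq_cube mult_ac)
      also have "\<dots> = p'" unfolding e using False p' by (simp add: power2_eq_square power3_eq_cube)
      finally have 4: "p' = c^4 * p" by simp
      have "c^6 * q = c^4 * p * (c^2 * q / p)" using p by (simp add: field_simps)
      also have "\<dots> = p' * (c^2 * q / p)" using 4 by simp
      also have "\<dots> = q'" unfolding c using p p' False by (simp add: field_simps)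
      finally show ?thesis using c0 4 by auto
    qed
  qed
  then show thesis using that unfolding p_def q_def p'_def q'_def by blast
qed

context elliptic_curve
begin

lemma cubic_roots:
  obtains e1 e2 e3 where "e1 \<noteq> e2" "e1 \<noteq> e3" "e2 \<noteq> e3"
    "cubic a e1 = 0" "cubic a e2 = 0" "cubic a e3 = 0"
proof -
  have "\<not> constant (poly [:a $ 3, a $ 2, a $ 1, 1:])" by (simp add: constant_degree)
  then obtain e1 where "poly [:a $ 3, a $ 2, a $ 1, 1:] e1 = 0" using fundamental_theorem_of_algebra by blast
  then have e1: "cubic a e1 = 0" by (simp add: cubic_def algebra_simps power2_eq_square power3_eq_cube)
  define b c where "b = a $ 1 + e1" and "c = a $ 2 + e1 * b"
  have f: "cubic a x = (x - e1) * (x^2 + b * x + c)" for x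
    using e1 unfolding cubic_def b_def c_def by algebra
  define e2 e3 where "e2 = (- b + csqrt (b^2 - 4 * c)) / 2" and "e3 = - b - e2"
  have "(2 * e2 + b)^2 = b^2 - 4 * c" by (simp add: e2_def)
  then have "4 * (e2^2 + b * e2 + c) = 0" by algebra
  then have e2: "e2^2 + b * e2 + c = 0" by (simp only: mult_eq_0_iff) simp
  then have e3: "e3^2 + b * e3 + c = 0" unfolding e3_def by algebra
  have bc: "b = - (e2 + e3)" "c = e2 * e3" using e2 by (simp add: e3_def) (use e2 in \<open>unfold e3_def, algebra\<close>)
  have d: "3 * x^2 + 2 * a $ 1 * x + a $ 2 = (x - e2) * (x - e3) + (x - e1) * (2 * x - e2 - e3)" for x
  proof -
    have "a $ 1 = b - e1" "a $ 2 = c - e1 * b" by (simp_all add: b_def c_def)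
    then show ?thesis unfolding bc by algebra
  qed
  have z: "cubic a e1 = 0" "cubic a e2 = 0" "cubic a e3 = 0" using e1 e2 e3 by (simp_all add: f)
  show thesis
    by (rule that[OF _ _ _ z]) (use no_double_root[OF z(1)] no_double_root[OF z(2)] d[of e1] d[of e2] in auto)
qed

end

text \<open>The difference of the cubic and \<open>(t - x1) (t - x2) (t - x3)\<close> has degree at most two and three zeros.\<close>

lemma vieta_cubic:
  assumes "x1 \<noteq> x2" "x1 \<noteq> x3" "x2 \<noteq> x3" "cubic a x1 = 0" "cubic a x2 = 0" "cubic a x3 = 0"
  shows "a $ 1 = - (x1 + x2 + x3)" "a $ 2 = x1 * x2 + x1 * x3 + x2 * x3" "a $ 3 = - (x1 * x2 * x3)"
proof -
  define A B C where "A = a $ 1 + (x1 + x2 + x3)" and "B = a $ 2 - (x1 * x2 + x1 * x3 + x2 * x3)"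
    and "C = a $ 3 + x1 * x2 * x3"
  have z: "A * x1^2 + B * x1 + C = 0" "A * x2^2 + B * x2 + C = 0" "A * x3^2 + B * x3 + C = 0"
    using assms(4-6) unfolding cubic_def A_def B_def C_def by algebra+
  have "(x1 - x2) * (A * (x1 + x2) + B) = 0" "(x1 - x3) * (A * (x1 + x3) + B) = 0"
    using z by algebra+
  then have ab: "A * (x1 + x2) + B = 0" "A * (x1 + x3) + B = 0" using assms(1,2) by auto
  then have "A * (x2 - x3) = 0" by algebra
  then have "A = 0" using assms(3) by simp
  moreover from this have "B = 0" using ab by simp
  moreover from calculation have "C = 0" using z by simp
  ultimately show "a $ 1 = - (x1 + x2 + x3)" "a $ 2 = x1 * x2 + x1 * x3 + x2 * x3" "a $ 3 = - (x1 * x2 * x3)"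
    by (simp_all add: A_def B_def C_def add_eq_0_iff)
qed

text \<open>By the relations of Vieta, applied to both cubics, \<open>p' = s\<^sup>2 p\<close> and \<open>q' = s\<^sup>3 q\<close>.\<close>

lemma j_eq_if_affine:
  assumes "delta a \<noteq> 0" "s \<noteq> 0" and roots: "\<And>e. cubic a e = 0 \<Longrightarrow> cubic a' (s * e + t) = 0"
  shows "j_invariant a = j_invariant a'"
proof -
  interpret elliptic_curve a by unfold_locales (rule assms)
  obtain e1 e2 e3 where e: "e1 \<noteq> e2" "e1 \<noteq> e3" "e2 \<noteq> e3" "cubic a e1 = 0" "cubic a e2 = 0" "cubic a e3 = 0"
    by (rule cubic_roots)
  note a = vieta_cubic[OF e]
  have n: "s * e1 + t \<noteq> s * e2 + t" "s * e1 + t \<noteq> s * e3 + t" "s * e2 + t \<noteq> s * e3 + t"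
    using e assms(2) by auto
  note a' = vieta_cubic[OF n roots[OF e(4)] roots[OF e(5)] roots[OF e(6)]]
  have p: "jp a' = s^2 * jp a" unfolding jp_def a a' by algebra
  have q: "jq a' = s^3 * jq a" unfolding jq_def a a' by algebra
  have "j_invariant a' = (s^6 * (6912 * jp a ^ 3)) / (s^6 * (4 * jp a ^ 3 + jq a ^ 2))"
  proof -
    have "(s^2 * jp a)^3 = s^6 * jp a ^ 3" "(s^3 * jq a)^2 = s^6 * jq a ^ 2" by algebra+
    then show ?thesis unfolding j_invariant_eq p q by (simp add: algebra_simps)
  qed
  then show ?thesis using assms(2) by (simp add: j_invariant_eq)
qed

text \<open>The map of orbit spaces is linear and fixes \<open>(0 : 1)\<close>, the image of the neutral element, so it is
  affine in the abscissa. The roots of the cubics are the abscissae of the points of order two.\<close>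

lemma j_eq_if_coset_isomorphic:
  assumes "delta a \<noteq> 0" "delta a' \<noteq> 0" "coset_isomorphic (coset_B a) (coset_B a')"
  shows "j_invariant a = j_invariant a'"
proof -
  interpret A: elliptic_curve a by unfold_locales (rule assms)
  interpret B: elliptic_curve a' by unfold_locales (rule assms)
  interpret GA: comm_group "curve_group a" by (rule A.comm_group_curve)
  interpret GB: comm_group "curve_group a'" by (rule B.comm_group_curve)
  obtain \<phi> \<psi> where \<phi>: "\<phi> \<in> iso (curve_group a) (curve_group a')"
    and \<psi>: "variety_iso UNIV UNIV \<psi>"
    and proj: "\<And>m. m \<in> A.E \<Longrightarrow> \<psi> (recip (zeta_map m)) = recip (zeta_map (\<phi> m))"
    using assms(3) unfolding coset_isomorphic_def coset_B_def coset_data.simps by auto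
  have hom: "\<phi> (curve_add a P Q) = curve_add a' (\<phi> P) (\<phi> Q)" if "P \<in> A.E" "Q \<in> A.E" for P Q
    using \<phi> that unfolding iso_def hom_def by simp
  have inE: "\<phi> P \<in> B.E" if "P \<in> A.E" for P
    using \<phi> that unfolding iso_def hom_def by auto
  have inj: "inj_on \<phi> A.E" using \<phi> unfolding iso_def bij_betw_def by simp
  have "curve_add a' (\<phi> curve_infty) (\<phi> curve_infty) = \<phi> curve_infty"
    using hom[of curve_infty curve_infty] by simp
  then have one: "\<phi> curve_infty = curve_infty"
    using GB.l_cancel_one[of "\<phi> curve_infty" "\<phi> curve_infty"] inE[of curve_infty] by simp
  have "inj \<psi>" using \<psi> unfolding variety_iso_def by (metis UNIV_I injI)
  moreover have "regular_map UNIV UNIV \<psi>" using \<psi> by (simp add: variety_iso_def)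
  ultimately obtain \<alpha> \<beta> \<gamma> \<delta> where det: "\<alpha> * \<delta> - \<beta> * \<gamma> \<noteq> 0"
    and L: "\<And>x y. (x, y) \<noteq> (0, 0) \<Longrightarrow> \<psi> (cp1 x y) = cp1 (\<alpha> * x + \<beta> * y) (\<gamma> * x + \<delta> * y)"
    using injective_regular_map_linear by metis
  have "\<psi> (cp1 0 1) = cp1 0 1"
    using proj[of curve_infty] one by (simp add: infty_def recip_cp1)
  moreover have "(\<beta>, \<delta>) \<noteq> (0, 0)" using det by auto
  ultimately have \<beta>: "\<beta> = 0" using L[of 0 1] by (simp add: cp1_eq_iff)
  then have \<alpha>\<delta>: "\<alpha> \<noteq> 0" "\<delta> \<noteq> 0" using det by auto
  have "cubic a' (\<delta> / \<alpha> * e + \<gamma> / \<alpha>) = 0" if "cubic a e = 0" for e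
  proof -
    let ?P = "cp2 e 0 1"
    have P: "?P \<in> A.E" using that by simp
    have "curve_add a ?P ?P = curve_infty" using A.curve_add_cneg[OF P] by simp
    then have d: "curve_add a' (\<phi> ?P) (\<phi> ?P) = curve_infty" using hom[OF P P] one by simp
    have "\<phi> ?P \<noteq> curve_infty" using inj_onD[OF inj, of ?P curve_infty] one P by auto
    then obtain x y where xy: "\<phi> ?P = cp2 x y 1" "y^2 = cubic a' x"
      using inE[OF P] by (auto elim: curve_points_cases)
    have "\<phi> ?P = cneg (\<phi> ?P)" using GB.inv_equality[of "\<phi> ?P" "\<phi> ?P"] d inE[OF P] by simp
    then have "y = - y" using xy by simp
    then have "2 * y = 0" by algebra
    then have "y = 0" by simp
    then have x: "cubic a' x = 0" using xy by simp
    have "cp1 1 x = cp1 \<alpha> (\<gamma> + \<delta> * e)"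
      using proj[OF P] xy(1) L[of 1 e] \<beta> by (simp add: recip_cp1)
    then have "x * \<alpha> = \<gamma> + \<delta> * e" using \<alpha>\<delta> by (simp add: cp1_eq_iff)
    then have "x = \<delta> / \<alpha> * e + \<gamma> / \<alpha>" using \<alpha>\<delta> by (simp add: field_simps)
    then show ?thesis using x by simp
  qed
  then show ?thesis using j_eq_if_affine[OF assms(1), of "\<delta> / \<alpha>" a' "\<gamma> / \<alpha>"] \<alpha>\<delta> by simp
qed

lemma coset_isomorphic_iff_j_eq:
  assumes "delta a \<noteq> 0" "delta a' \<noteq> 0"
  shows "coset_isomorphic (coset_B a) (coset_B a') \<longleftrightarrow> j_invariant a = j_invariant a'"
proof
  assume "j_invariant a = j_invariant a'"
  then obtain c where "c \<noteq> 0" "jp a' = c^4 * jp a" "jq a' = c^6 * jq a"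
    using jpq_if_j_eq assms by metis
  then show "coset_isomorphic (coset_B a) (coset_B a')"
    using scaled_if_jpq coset_isomorphic_if_scaled assms by blast
qed (rule j_eq_if_coset_isomorphic[OF assms])

theorem theorem1:
  fixes a :: "complex ^ 3"
  assumes "delta a \<noteq> 0"
  shows
    "(nv_isomorphic UNIV (mult_by 2 (polyD a)) UNIV (mult_by 2 (polyB a)) \<and>
      algebraic_nv_group 2 UNIV (mult_by 2 (polyD a)) infty Some \<and>
      nv_regular UNIV (mult_by 2 (polyD a)) Some \<and>
      nv_involutive 2 UNIV (mult_by 2 (polyD a)) infty Some \<and>
      coset_nv_group 2 (coset_D a) infty Some \<and>
      algebraic_nv_group 2 UNIV (mult_by 2 (polyB a)) (cp1 0 1) Some \<and>
      coset_nv_group 2 (coset_B a) (cp1 0 1) Some \<and>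
      (\<forall>x1 x0 y1 y0 u2 u1 u0.
         (x1, x0) \<noteq> (0, 0) \<and> (y1, y0) \<noteq> (0, 0) \<and>
         u2 = (x1 * y0 - x0 * y1)^2 \<and>
         - (1 / 2) * u1 =
           x1 * x0 * (2 * a $ 1 * y1 * y0 + a $ 2 * y1^2 + y0^2)
           + x1^2 * y1 * (a $ 2 * y0 + 2 * a $ 3 * y1) + x0^2 * y0 * y1 \<and>
         u0 =
           x1^2 * y1 * ((a $ 2)^2 * y1 - 4 * a $ 3 * (a $ 1 * y1 + y0))
           - 2 * x0 * x1 * y1 * (a $ 2 * y0 + 2 * a $ 3 * y1) + x0^2 * y0^2 \<longrightarrow>
         (u2, u1, u0) \<noteq> (0, 0, 0) \<and>
         mult_by 2 (polyB a) (cp1 x1 x0) (cp1 y1 y0) = Some (zeros_of_cp2 (cp2 u2 u1 u0))))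
     \<and>
     (\<forall>a' :: complex ^ 3. delta a' \<noteq> 0 \<longrightarrow>
        (coset_isomorphic (coset_B a) (coset_B a') \<longleftrightarrow> j_invariant a = j_invariant a'))"
proof -
  interpret elliptic_curve a by unfold_locales (rule assms)
  interpret D: inversion_quotient "curve_group a" zeta_map "polyD a" by (rule inversion_quotient_D)
  interpret B: inversion_quotient "curve_group a" "recip \<circ> zeta_map" "polyB a" by (rule inversion_quotient_B)
  have D: "algebraic_nv_group 2 UNIV (mult_by 2 (polyD a)) infty Some"
    "nv_involutive 2 UNIV (mult_by 2 (polyD a)) infty Some"
    using D.algebraic_nv_group D.nv_involutive by simp_all
  have B: "algebraic_nv_group 2 UNIV (mult_by 2 (polyB a)) (cp1 0 1) Some"
    using B.algebraic_nv_group by (simp add: infty_def recip_cp1)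
  show ?thesis
    by (intro conjI nv_isomorphic_D_B D D.nv_regular coset_nv_group_D B coset_nv_group_B allI impI
          coset_isomorphic_iff_j_eq[OF assms]; (elim conjE)?)
       (rule mult_by_polyB_formula; assumption)+
qed

end
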